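(* Let $(\mathcal{C},\otimes,I,\sigma)$ be a symmetric monoidal category that has equalizers, let $A$ be a cocommutative bialgebra in $\mathcal{C}$, and let $x\colon X\to A$ and $y\colon Y\to A$ be two subobjects of $A$ in the category $\mathsf{BiAlg}_{\mathcal{C},coc}$ of cocommutative bialgebras in $\mathcal{C}$. Then the following are equivalent: (i) $m\cdot\sigma\cdot(x\otimes y)=m\cdot(x\otimes y)$ as morphisms $X\otimes Y\to A$; (ii) $[X,Y]=0$, i.e. there exists a (unique) morphism of bialgebras $p\colon X\otimes Y\to A$ such that $p\cdot(1_X\otimes u_Y)=x$ and $p\cdot(u_X\otimes 1_Y)=y$.
   Context: $(\mathcal{C},\otimes,I,\sigma)$ is a symmetric monoidal category with equalizers (associativity and unit isomorphisms are suppressed); $f\cdot g$ denotes the composite "first $g$, then $f$". Algebras $(A,m,u_A)$ in $\mathcal{C}$ are associative and unital, coalgebras $(C,\Delta,\epsilon_C)$ are coassociative and counital. A bialgebra is an object with an algebra and a coalgebra structure such that $\Delta$ and $\epsilon$ are algebra morphisms; it is cocommutative if $\sigma\cdot\Delta=\Delta$. Morphisms of bialgebras are morphisms in $\mathcal{C}$ that are both algebra and coalgebra morphisms. $\mathsf{BiAlg}_{\mathcal{C},coc}$ is the category of cocommutative bialgebras in $\mathcal{C}$; it is pointed with zero object $I$, and the categorical product of $X$ and $Y$ is $X\otimes Y$ (with the tensor product bialgebra structure) with projections $1_X\otimes\epsilon_Y$ and $\epsilon_X\otimes 1_Y$. In (i), $m$ is the multiplication of $A$ and $\sigma=\sigma_{A,A}$.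 Subobjects are (represented by) monomorphisms in $\mathsf{BiAlg}_{\mathcal{C},coc}$. In a pointed category with binary products, two subobjects $x\colon X\to A$, $y\colon Y\to A$ commute in the sense of Huq, written $[X,Y]=0$, if there is a morphism $p\colon X\times Y\to A$ with $p\cdot(1,0)=x$ and $p\cdot(0,1)=y$. *)

theory Defs
  imports Main
begin

section \<open>Categories\<close>

text \<open>
  A category is given by its objects, its hom-sets, identities and composition. Every category
  presented by arrows with a domain and a codomain fits this format, with
  \<open>Hom a b = {f. dom f = a \<and> cod f = b}\<close>. The hom-sets are not required to be disjoint, so that a
  category of structured objects can reuse the arrows and the composition of the underlying
  category; consequently an arrow is always considered together with a source and a target.
  Objects outside \<open>Ob C\<close>, and arrows outside the relevant hom-set, carry no information.
  The composite \<open>f \<cdot> g\<close> is ``first \<open>g\<close>, then \<open>f\<close>''.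
\<close>

record ('o, 'm) cat =
  Ob :: "'o set"
  Hom :: "'o \<Rightarrow> 'o \<Rightarrow> 'm set"
  Id :: "'o \<Rightarrow> 'm"
  Comp :: "'m \<Rightarrow> 'm \<Rightarrow> 'm"  (infixr "\<cdot>\<index>" 70)

locale category =
  fixes C :: "('o, 'm, 'z) cat_scheme" (structure)
  assumes Id_Hom: "a \<in> Ob C \<Longrightarrow> Id C a \<in> Hom C a a"
    and Comp_Hom: "\<lbrakk>a \<in> Ob C; b \<in> Ob C; c \<in> Ob C; f \<in> Hom C a b; g \<in> Hom C b c\<rbrakk>
      \<Longrightarrow> g \<cdot> f \<in> Hom C a c"
    and Comp_Id_right: "\<lbrakk>a \<in> Ob C; b \<in> Ob C; f \<in> Hom C a b\<rbrakk> \<Longrightarrow> f \<cdot> Id C a = f"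
    and Comp_Id_left: "\<lbrakk>a \<in> Ob C; b \<in> Ob C; f \<in> Hom C a b\<rbrakk> \<Longrightarrow> Id C b \<cdot> f = f"
    and Comp_assoc: "\<lbrakk>a \<in> Ob C; b \<in> Ob C; c \<in> Ob C; d \<in> Ob C;
        f \<in> Hom C a b; g \<in> Hom C b c; h \<in> Hom C c d\<rbrakk>
      \<Longrightarrow> (h \<cdot> g) \<cdot> f = h \<cdot> (g \<cdot> f)"

definition inverse_arrows ::
    "('o, 'm, 'z) cat_scheme \<Rightarrow> 'o \<Rightarrow> 'o \<Rightarrow> 'm \<Rightarrow> 'm \<Rightarrow> bool" where
  "inverse_arrows C a b f g \<longleftrightarrow>
     f \<in> Hom C a b \<and> g \<in> Hom C b a \<and> g \<cdot>\<^bsub>C\<^esub> f = Id C a \<and> f \<cdot>\<^bsub>C\<^esub> g = Id C b"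

definition isomorphism :: "('o, 'm, 'z) cat_scheme \<Rightarrow> 'o \<Rightarrow> 'o \<Rightarrow> 'm \<Rightarrow> bool" where
  "isomorphism C a b f \<longleftrightarrow> (\<exists>g. inverse_arrows C a b f g)"

definition inverse_of :: "('o, 'm, 'z) cat_scheme \<Rightarrow> 'o \<Rightarrow> 'o \<Rightarrow> 'm \<Rightarrow> 'm" where
  "inverse_of C a b f = (THE g. inverse_arrows C a b f g)"

definition monomorphism :: "('o, 'm, 'z) cat_scheme \<Rightarrow> 'o \<Rightarrow> 'o \<Rightarrow> 'm \<Rightarrow> bool" where
  "monomorphism C a b f \<longleftrightarrow>
     f \<in> Hom C a b \<and>
     (\<forall>c \<in> Ob C. \<forall>g \<in> Hom C c a. \<forall>h \<in> Hom C c a. f \<cdot>\<^bsub>C\<^esub> g = f \<cdot>\<^bsub>C\<^esub> h \<longrightarrow> g = h)"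

definition is_equalizer ::
    "('o, 'm, 'z) cat_scheme \<Rightarrow> 'o \<Rightarrow> 'o \<Rightarrow> 'm \<Rightarrow> 'm \<Rightarrow> 'o \<Rightarrow> 'm \<Rightarrow> bool" where
  "is_equalizer C a b f g e k \<longleftrightarrow>
     e \<in> Ob C \<and> k \<in> Hom C e a \<and> f \<cdot>\<^bsub>C\<^esub> k = g \<cdot>\<^bsub>C\<^esub> k \<and>
     (\<forall>c \<in> Ob C. \<forall>h \<in> Hom C c a. f \<cdot>\<^bsub>C\<^esub> h = g \<cdot>\<^bsub>C\<^esub> h \<longrightarrow>
        (\<exists>!l. l \<in> Hom C c e \<and> k \<cdot>\<^bsub>C\<^esub> l = h))"

definition has_equalizers :: "('o, 'm, 'z) cat_scheme \<Rightarrow> bool" where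
  "has_equalizers C \<longleftrightarrow>
     (\<forall>a \<in> Ob C. \<forall>b \<in> Ob C. \<forall>f \<in> Hom C a b. \<forall>g \<in> Hom C a b. \<exists>e k. is_equalizer C a b f g e k)"

definition is_product ::
    "('o, 'm, 'z) cat_scheme \<Rightarrow> 'o \<Rightarrow> 'o \<Rightarrow> 'o \<Rightarrow> 'm \<Rightarrow> 'm \<Rightarrow> bool" where
  "is_product C a b p \<pi>\<^sub>1 \<pi>\<^sub>2 \<longleftrightarrow>
     p \<in> Ob C \<and> \<pi>\<^sub>1 \<in> Hom C p a \<and> \<pi>\<^sub>2 \<in> Hom C p b \<and>
     (\<forall>c \<in> Ob C. \<forall>f \<in> Hom C c a. \<forall>g \<in> Hom C c b.
        \<exists>!h. h \<in> Hom C c p \<and> \<pi>\<^sub>1 \<cdot>\<^bsub>C\<^esub> h = f \<and> \<pi>\<^sub>2 \<cdot>\<^bsub>C\<^esub> h = g)"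

definition is_zero_object :: "('o, 'm, 'z) cat_scheme \<Rightarrow> 'o \<Rightarrow> bool" where
  "is_zero_object C z \<longleftrightarrow>
     z \<in> Ob C \<and> (\<forall>a \<in> Ob C. (\<exists>!f. f \<in> Hom C a z) \<and> (\<exists>!f. f \<in> Hom C z a))"

definition is_zero_arrow :: "('o, 'm, 'z) cat_scheme \<Rightarrow> 'o \<Rightarrow> 'o \<Rightarrow> 'm \<Rightarrow> bool" where
  "is_zero_arrow C a b f \<longleftrightarrow>
     (\<exists>z. is_zero_object C z \<and> (\<exists>t \<in> Hom C a z. \<exists>i \<in> Hom C z b. f = i \<cdot>\<^bsub>C\<^esub> t))"

text \<open>
  \<open>[X, Y] = 0\<close> for \<open>x : X \<rightarrow> A\<close> and \<open>y : Y \<rightarrow> A\<close>. Here \<open>P\<close> with \<open>\<pi>\<^sub>1, \<pi>\<^sub>2\<close> is a product of \<open>X\<close> and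
  \<open>Y\<close> (which one is immaterial, products being unique up to isomorphism), and \<open>i\<^sub>1 = (1, 0)\<close>,
  \<open>i\<^sub>2 = (0, 1)\<close>.
\<close>

definition huq_commute ::
    "('o, 'm, 'z) cat_scheme \<Rightarrow> 'o \<Rightarrow> 'o \<Rightarrow> 'o \<Rightarrow> 'm \<Rightarrow> 'm \<Rightarrow> bool" where
  "huq_commute C X Y A x y \<longleftrightarrow>
     (\<exists>P \<pi>\<^sub>1 \<pi>\<^sub>2 i\<^sub>1 i\<^sub>2 p.
        is_product C X Y P \<pi>\<^sub>1 \<pi>\<^sub>2 \<and>
        i\<^sub>1 \<in> Hom C X P \<and> \<pi>\<^sub>1 \<cdot>\<^bsub>C\<^esub> i\<^sub>1 = Id C X \<and> is_zero_arrow C X Y (\<pi>\<^sub>2 \<cdot>\<^bsub>C\<^esub> i\<^sub>1) \<and>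
        i\<^sub>2 \<in> Hom C Y P \<and> is_zero_arrow C Y X (\<pi>\<^sub>1 \<cdot>\<^bsub>C\<^esub> i\<^sub>2) \<and> \<pi>\<^sub>2 \<cdot>\<^bsub>C\<^esub> i\<^sub>2 = Id C Y \<and>
        p \<in> Hom C P A \<and> p \<cdot>\<^bsub>C\<^esub> i\<^sub>1 = x \<and> p \<cdot>\<^bsub>C\<^esub> i\<^sub>2 = y)"


section \<open>Symmetric monoidal categories\<close>

text \<open>
  Not assumed strict. The components of the structural isomorphisms are
  \<open>Assoc C a b c : (a \<odot> b) \<odot> c \<rightarrow> a \<odot> (b \<odot> c)\<close>, \<open>LUnit C a : \<I> \<odot> a \<rightarrow> a\<close>,
  \<open>RUnit C a : a \<odot> \<I> \<rightarrow> a\<close> and \<open>Braid C a b : a \<odot> b \<rightarrow> b \<odot> a\<close>. The tensor product is written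
  \<open>\<odot>\<close> on objects and \<open>\<otimes>\<close> on arrows.
\<close>

record ('o, 'm) smc = "('o, 'm) cat" +
  TensorOb :: "'o \<Rightarrow> 'o \<Rightarrow> 'o"  (infixr "\<odot>\<index>" 75)
  Tensor :: "'m \<Rightarrow> 'm \<Rightarrow> 'm"  (infixr "\<otimes>\<index>" 75)
  UnitOb :: 'o  ("\<I>\<index>")
  Assoc :: "'o \<Rightarrow> 'o \<Rightarrow> 'o \<Rightarrow> 'm"
  LUnit :: "'o \<Rightarrow> 'm"
  RUnit :: "'o \<Rightarrow> 'm"
  Braid :: "'o \<Rightarrow> 'o \<Rightarrow> 'm"

locale symmetric_monoidal_category = category C
  for C :: "('o, 'm, 'z) smc_scheme" (structure) +
  assumes Unit_Ob: "\<I> \<in> Ob C"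
    and Tensor_Ob: "\<lbrakk>a \<in> Ob C; b \<in> Ob C\<rbrakk> \<Longrightarrow> a \<odot> b \<in> Ob C"
    and Tensor_Hom: "\<lbrakk>a \<in> Ob C; b \<in> Ob C; c \<in> Ob C; d \<in> Ob C; f \<in> Hom C a b; g \<in> Hom C c d\<rbrakk>
      \<Longrightarrow> f \<otimes> g \<in> Hom C (a \<odot> c) (b \<odot> d)"
    and Tensor_Id: "\<lbrakk>a \<in> Ob C; b \<in> Ob C\<rbrakk> \<Longrightarrow> Id C a \<otimes> Id C b = Id C (a \<odot> b)"
    and Tensor_Comp: "\<lbrakk>a \<in> Ob C; b \<in> Ob C; c \<in> Ob C; a' \<in> Ob C; b' \<in> Ob C; c' \<in> Ob C;
        f \<in> Hom C a b; g \<in> Hom C b c; f' \<in> Hom C a' b'; g' \<in> Hom C b' c'\<rbrakk>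
      \<Longrightarrow> (g \<cdot> f) \<otimes> (g' \<cdot> f') = (g \<otimes> g') \<cdot> (f \<otimes> f')"
    and Assoc_iso: "\<lbrakk>a \<in> Ob C; b \<in> Ob C; c \<in> Ob C\<rbrakk>
      \<Longrightarrow> isomorphism C ((a \<odot> b) \<odot> c) (a \<odot> (b \<odot> c)) (Assoc C a b c)"
    and LUnit_iso: "a \<in> Ob C \<Longrightarrow> isomorphism C (\<I> \<odot> a) a (LUnit C a)"
    and RUnit_iso: "a \<in> Ob C \<Longrightarrow> isomorphism C (a \<odot> \<I>) a (RUnit C a)"
    and Braid_Hom: "\<lbrakk>a \<in> Ob C; b \<in> Ob C\<rbrakk> \<Longrightarrow> Braid C a b \<in> Hom C (a \<odot> b) (b \<odot> a)"
    and Assoc_natural: "\<lbrakk>a \<in> Ob C; b \<in> Ob C; c \<in> Ob C; a' \<in> Ob C; b' \<in> Ob C; c' \<in> Ob C;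
        f \<in> Hom C a a'; g \<in> Hom C b b'; h \<in> Hom C c c'\<rbrakk>
      \<Longrightarrow> Assoc C a' b' c' \<cdot> ((f \<otimes> g) \<otimes> h) = (f \<otimes> (g \<otimes> h)) \<cdot> Assoc C a b c"
    and LUnit_natural: "\<lbrakk>a \<in> Ob C; b \<in> Ob C; f \<in> Hom C a b\<rbrakk>
      \<Longrightarrow> LUnit C b \<cdot> (Id C \<I> \<otimes> f) = f \<cdot> LUnit C a"
    and RUnit_natural: "\<lbrakk>a \<in> Ob C; b \<in> Ob C; f \<in> Hom C a b\<rbrakk>
      \<Longrightarrow> RUnit C b \<cdot> (f \<otimes> Id C \<I>) = f \<cdot> RUnit C a"
    and Braid_natural: "\<lbrakk>a \<in> Ob C; b \<in> Ob C; a' \<in> Ob C; b' \<in> Ob C; f \<in> Hom C a a'; g \<in> Hom C b b'\<rbrakk>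
      \<Longrightarrow> Braid C a' b' \<cdot> (f \<otimes> g) = (g \<otimes> f) \<cdot> Braid C a b"
    and pentagon: "\<lbrakk>a \<in> Ob C; b \<in> Ob C; c \<in> Ob C; d \<in> Ob C\<rbrakk>
      \<Longrightarrow> Assoc C a b (c \<odot> d) \<cdot> Assoc C (a \<odot> b) c d
        = (Id C a \<otimes> Assoc C b c d) \<cdot> Assoc C a (b \<odot> c) d \<cdot> (Assoc C a b c \<otimes> Id C d)"
    and triangle: "\<lbrakk>a \<in> Ob C; b \<in> Ob C\<rbrakk>
      \<Longrightarrow> (Id C a \<otimes> LUnit C b) \<cdot> Assoc C a \<I> b = RUnit C a \<otimes> Id C b"
    and hexagon: "\<lbrakk>a \<in> Ob C; b \<in> Ob C; c \<in> Ob C\<rbrakk>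
      \<Longrightarrow> Assoc C b c a \<cdot> Braid C a (b \<odot> c) \<cdot> Assoc C a b c
        = (Id C b \<otimes> Braid C a c) \<cdot> Assoc C b a c \<cdot> (Braid C a b \<otimes> Id C c)"
    and symmetry: "\<lbrakk>a \<in> Ob C; b \<in> Ob C\<rbrakk> \<Longrightarrow> Braid C b a \<cdot> Braid C a b = Id C (a \<odot> b)"

definition assoc_inv :: "('o, 'm, 'z) smc_scheme \<Rightarrow> 'o \<Rightarrow> 'o \<Rightarrow> 'o \<Rightarrow> 'm" where
  "assoc_inv C a b c = inverse_of C ((a \<odot>\<^bsub>C\<^esub> b) \<odot>\<^bsub>C\<^esub> c) (a \<odot>\<^bsub>C\<^esub> (b \<odot>\<^bsub>C\<^esub> c)) (Assoc C a b c)"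

definition lunit_inv :: "('o, 'm, 'z) smc_scheme \<Rightarrow> 'o \<Rightarrow> 'm" where
  "lunit_inv C a = inverse_of C (\<I>\<^bsub>C\<^esub> \<odot>\<^bsub>C\<^esub> a) a (LUnit C a)"

definition runit_inv :: "('o, 'm, 'z) smc_scheme \<Rightarrow> 'o \<Rightarrow> 'm" where
  "runit_inv C a = inverse_of C (a \<odot>\<^bsub>C\<^esub> \<I>\<^bsub>C\<^esub>) a (RUnit C a)"

text \<open>
  The isomorphism \<open>(a \<odot> b) \<odot> (c \<odot> d) \<rightarrow> (a \<odot> c) \<odot> (b \<odot> d)\<close> which is \<open>1 \<otimes> \<sigma>\<^bsub>b,c\<^esub> \<otimes> 1\<close> when the
  associativity isomorphisms are suppressed.
\<close>

definition middle_swap :: "('o, 'm, 'z) smc_scheme \<Rightarrow> 'o \<Rightarrow> 'o \<Rightarrow> 'o \<Rightarrow> 'o \<Rightarrow> 'm" where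
  "middle_swap C a b c d =
     assoc_inv C a c (b \<odot>\<^bsub>C\<^esub> d)
     \<cdot>\<^bsub>C\<^esub> (Id C a \<otimes>\<^bsub>C\<^esub> (Assoc C c b d \<cdot>\<^bsub>C\<^esub> (Braid C b c \<otimes>\<^bsub>C\<^esub> Id C d) \<cdot>\<^bsub>C\<^esub> assoc_inv C b c d))
     \<cdot>\<^bsub>C\<^esub> Assoc C a b (c \<odot>\<^bsub>C\<^esub> d)"


section \<open>Algebras, coalgebras and bialgebras\<close>

definition algebra :: "('o, 'm, 'z) smc_scheme \<Rightarrow> 'o \<Rightarrow> 'm \<Rightarrow> 'm \<Rightarrow> bool" where
  "algebra C a m u \<longleftrightarrow>
     a \<in> Ob C \<and> m \<in> Hom C (a \<odot>\<^bsub>C\<^esub> a) a \<and> u \<in> Hom C \<I>\<^bsub>C\<^esub> a \<and>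
     m \<cdot>\<^bsub>C\<^esub> (m \<otimes>\<^bsub>C\<^esub> Id C a) = m \<cdot>\<^bsub>C\<^esub> (Id C a \<otimes>\<^bsub>C\<^esub> m) \<cdot>\<^bsub>C\<^esub> Assoc C a a a \<and>
     m \<cdot>\<^bsub>C\<^esub> (u \<otimes>\<^bsub>C\<^esub> Id C a) = LUnit C a \<and>
     m \<cdot>\<^bsub>C\<^esub> (Id C a \<otimes>\<^bsub>C\<^esub> u) = RUnit C a"

definition coalgebra :: "('o, 'm, 'z) smc_scheme \<Rightarrow> 'o \<Rightarrow> 'm \<Rightarrow> 'm \<Rightarrow> bool" where
  "coalgebra C a \<Delta> \<epsilon> \<longleftrightarrow>
     a \<in> Ob C \<and> \<Delta> \<in> Hom C a (a \<odot>\<^bsub>C\<^esub> a) \<and> \<epsilon> \<in> Hom C a \<I>\<^bsub>C\<^esub> \<and>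
     Assoc C a a a \<cdot>\<^bsub>C\<^esub> (\<Delta> \<otimes>\<^bsub>C\<^esub> Id C a) \<cdot>\<^bsub>C\<^esub> \<Delta> = (Id C a \<otimes>\<^bsub>C\<^esub> \<Delta>) \<cdot>\<^bsub>C\<^esub> \<Delta> \<and>
     LUnit C a \<cdot>\<^bsub>C\<^esub> (\<epsilon> \<otimes>\<^bsub>C\<^esub> Id C a) \<cdot>\<^bsub>C\<^esub> \<Delta> = Id C a \<and>
     RUnit C a \<cdot>\<^bsub>C\<^esub> (Id C a \<otimes>\<^bsub>C\<^esub> \<epsilon>) \<cdot>\<^bsub>C\<^esub> \<Delta> = Id C a"

definition algebra_morphism ::
    "('o, 'm, 'z) smc_scheme \<Rightarrow> 'o \<Rightarrow> 'm \<Rightarrow> 'm \<Rightarrow> 'o \<Rightarrow> 'm \<Rightarrow> 'm \<Rightarrow> 'm \<Rightarrow> bool" where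
  "algebra_morphism C a m u a' m' u' f \<longleftrightarrow>
     f \<in> Hom C a a' \<and> f \<cdot>\<^bsub>C\<^esub> m = m' \<cdot>\<^bsub>C\<^esub> (f \<otimes>\<^bsub>C\<^esub> f) \<and> f \<cdot>\<^bsub>C\<^esub> u = u'"

definition coalgebra_morphism ::
    "('o, 'm, 'z) smc_scheme \<Rightarrow> 'o \<Rightarrow> 'm \<Rightarrow> 'm \<Rightarrow> 'o \<Rightarrow> 'm \<Rightarrow> 'm \<Rightarrow> 'm \<Rightarrow> bool" where
  "coalgebra_morphism C a \<Delta> \<epsilon> a' \<Delta>' \<epsilon>' f \<longleftrightarrow>
     f \<in> Hom C a a' \<and> \<Delta>' \<cdot>\<^bsub>C\<^esub> f = (f \<otimes>\<^bsub>C\<^esub> f) \<cdot>\<^bsub>C\<^esub> \<Delta> \<and> \<epsilon>' \<cdot>\<^bsub>C\<^esub> f = \<epsilon>"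

definition tensor_mult :: "('o, 'm, 'z) smc_scheme \<Rightarrow> 'o \<Rightarrow> 'm \<Rightarrow> 'o \<Rightarrow> 'm \<Rightarrow> 'm" where
  "tensor_mult C a m b n = (m \<otimes>\<^bsub>C\<^esub> n) \<cdot>\<^bsub>C\<^esub> middle_swap C a b a b"

definition tensor_unit :: "('o, 'm, 'z) smc_scheme \<Rightarrow> 'm \<Rightarrow> 'm \<Rightarrow> 'm" where
  "tensor_unit C u v = (u \<otimes>\<^bsub>C\<^esub> v) \<cdot>\<^bsub>C\<^esub> lunit_inv C \<I>\<^bsub>C\<^esub>"

definition tensor_comult :: "('o, 'm, 'z) smc_scheme \<Rightarrow> 'o \<Rightarrow> 'm \<Rightarrow> 'o \<Rightarrow> 'm \<Rightarrow> 'm" where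
  "tensor_comult C a \<Delta> b \<Gamma> = middle_swap C a a b b \<cdot>\<^bsub>C\<^esub> (\<Delta> \<otimes>\<^bsub>C\<^esub> \<Gamma>)"

definition tensor_counit :: "('o, 'm, 'z) smc_scheme \<Rightarrow> 'm \<Rightarrow> 'm \<Rightarrow> 'm" where
  "tensor_counit C \<epsilon> \<eta> = LUnit C \<I>\<^bsub>C\<^esub> \<cdot>\<^bsub>C\<^esub> (\<epsilon> \<otimes>\<^bsub>C\<^esub> \<eta>)"

record ('o, 'm) bialg =
  Car :: 'o
  mult :: 'm
  unt :: 'm
  comult :: 'm
  counit :: 'm

definition bialgebra :: "('o, 'm, 'z) smc_scheme \<Rightarrow> ('o, 'm) bialg \<Rightarrow> bool" where
  "bialgebra C A \<longleftrightarrow>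
     algebra C (Car A) (mult A) (unt A) \<and>
     coalgebra C (Car A) (comult A) (counit A) \<and>
     algebra_morphism C (Car A) (mult A) (unt A)
       (Car A \<odot>\<^bsub>C\<^esub> Car A) (tensor_mult C (Car A) (mult A) (Car A) (mult A))
       (tensor_unit C (unt A) (unt A)) (comult A) \<and>
     algebra_morphism C (Car A) (mult A) (unt A)
       \<I>\<^bsub>C\<^esub> (LUnit C \<I>\<^bsub>C\<^esub>) (Id C \<I>\<^bsub>C\<^esub>) (counit A)"

definition cocommutative :: "('o, 'm, 'z) smc_scheme \<Rightarrow> ('o, 'm) bialg \<Rightarrow> bool" where
  "cocommutative C A \<longleftrightarrow> Braid C (Car A) (Car A) \<cdot>\<^bsub>C\<^esub> comult A = comult A"

definition bialgebra_morphism ::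
    "('o, 'm, 'z) smc_scheme \<Rightarrow> ('o, 'm) bialg \<Rightarrow> ('o, 'm) bialg \<Rightarrow> 'm \<Rightarrow> bool" where
  "bialgebra_morphism C A B f \<longleftrightarrow>
     algebra_morphism C (Car A) (mult A) (unt A) (Car B) (mult B) (unt B) f \<and>
     coalgebra_morphism C (Car A) (comult A) (counit A) (Car B) (comult B) (counit B) f"

definition tensor_bialgebra ::
    "('o, 'm, 'z) smc_scheme \<Rightarrow> ('o, 'm) bialg \<Rightarrow> ('o, 'm) bialg \<Rightarrow> ('o, 'm) bialg" where
  "tensor_bialgebra C A B =
     \<lparr>Car = Car A \<odot>\<^bsub>C\<^esub> Car B,
      mult = tensor_mult C (Car A) (mult A) (Car B) (mult B),
      unt = tensor_unit C (unt A) (unt B),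
      comult = tensor_comult C (Car A) (comult A) (Car B) (comult B),
      counit = tensor_counit C (counit A) (counit B)\<rparr>"

definition BiAlg_coc :: "('o, 'm, 'z) smc_scheme \<Rightarrow> (('o, 'm) bialg, 'm) cat" where
  "BiAlg_coc C =
     \<lparr>Ob = {A. bialgebra C A \<and> cocommutative C A},
      Hom = (\<lambda>A B. {f. bialgebra_morphism C A B f}),
      Id = (\<lambda>A. Id C (Car A)),
      Comp = Comp C\<rparr>"

text \<open>
  \<open>1\<^sub>X \<otimes> u\<^sub>Y : X \<rightarrow> X \<otimes> Y\<close> and \<open>u\<^sub>X \<otimes> 1\<^sub>Y : Y \<rightarrow> X \<otimes> Y\<close>, with the unit isomorphisms
  \<open>X \<cong> X \<otimes> I\<close> and \<open>Y \<cong> I \<otimes> Y\<close> made explicit.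
\<close>

definition tensor_inl ::
    "('o, 'm, 'z) smc_scheme \<Rightarrow> ('o, 'm) bialg \<Rightarrow> ('o, 'm) bialg \<Rightarrow> 'm" where
  "tensor_inl C X Y = (Id C (Car X) \<otimes>\<^bsub>C\<^esub> unt Y) \<cdot>\<^bsub>C\<^esub> runit_inv C (Car X)"

definition tensor_inr ::
    "('o, 'm, 'z) smc_scheme \<Rightarrow> ('o, 'm) bialg \<Rightarrow> ('o, 'm) bialg \<Rightarrow> 'm" where
  "tensor_inr C X Y = (unt X \<otimes>\<^bsub>C\<^esub> Id C (Car Y)) \<cdot>\<^bsub>C\<^esub> lunit_inv C (Car Y)"

end

theory Submission
  imports Defs
begin

text \<open>
  The tensor product of two cocommutative bialgebras is their product in the category of
  cocommutative bialgebras, with pairing \<open>(f \<otimes> g) \<cdot> \<Delta>\<close>. If \<open>p : X \<otimes> Y \<rightarrow> A\<close> restricts to \<open>x\<close> and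
  \<open>y\<close>, then \<open>p\<close> is multiplicative, and the multiplication of \<open>X \<otimes> Y\<close> sends \<open>(1 \<otimes> u) \<otimes> (u \<otimes> 1)\<close>
  to the identity and \<open>(u \<otimes> 1) \<otimes> (1 \<otimes> u)\<close> to the symmetry; hence \<open>p = m \<cdot> (x \<otimes> y)\<close> and
  \<open>p = m \<cdot> (y \<otimes> x) \<cdot> \<sigma> = m \<cdot> \<sigma> \<cdot> (x \<otimes> y)\<close>. Conversely, if \<open>x\<close> and \<open>y\<close> commute, then \<open>m \<cdot> (x \<otimes> y)\<close>
  is a morphism of bialgebras.

  The structural isomorphisms are handled by a coherence theorem: a formal tensor product of
  pairwise distinct atoms has a normal form, the right-nested product of its sorted atoms, and the
  normalization isomorphism, built by merging sorted words, is compatible with all structural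
  isomorphisms.
\<close>

section \<open>Arrows between formal tensor products\<close>

text \<open>Since \<open>C\<close> is not strict, already associativity of the multiplication on X
  \<otimes> Y is a large diagram of associators and braidings; the obstacle is to dispose of all
  such diagrams at once. No syntax of structural arrows is introduced. Coherence is an invariant
  instead: an arrow between trees with distinct leaves is coherent if it commutes with the
  normalization arrows. The invariant passes to composites, tensor products and inverses, and it
  determines the arrow because normalization arrows have left inverses.

  Bialgebra computations are carried out with formal arrows, over a labelling of leaves by the
  bialgebras at hand, and then read in \<open>C\<close>. Cocommutativity of a test object enters
  through \<Delta> being a morphism of bialgebras, which makes the pairing a morphism. That m
  \<cdot> (x \<otimes> y) is multiplicative amounts to comparing two fourfold products that differ
  by exchanging the middle factors; rebracketing brings these next to each other, and there (i)
  applies.\<close>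

context category begin

lemma inverse_arrows_unique:
  assumes "a \<in> Ob C" "b \<in> Ob C" "inverse_arrows C a b f g" "inverse_arrows C a b f h"
  shows "g = h"
proof -
  have "g = g \<cdot> (f \<cdot> h)"
    using assms Comp_Id_right[of b a g] by (simp add: inverse_arrows_def)
  also have "\<dots> = (g \<cdot> f) \<cdot> h"
    using assms by (intro Comp_assoc[symmetric, of b a b a]) (auto simp: inverse_arrows_def)
  also have "\<dots> = h"
    using assms Comp_Id_left[of b a h] by (simp add: inverse_arrows_def)
  finally show ?thesis .
qed

lemma inverse_arrows_inverse_of:
  assumes "a \<in> Ob C" "b \<in> Ob C" "isomorphism C a b f"
  shows "inverse_arrows C a b f (inverse_of C a b f)"
  unfolding inverse_of_def
  by (rule theI') (use assms inverse_arrows_unique in \<open>auto simp: isomorphism_def\<close>)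

end

text \<open>Leaves carry numbers because normal forms sort them.\<close>

datatype tree = Leaf nat | One | Node tree tree  (infixr "\<boxdot>" 75)

primrec subst :: "(nat \<Rightarrow> tree) \<Rightarrow> tree \<Rightarrow> tree" where
  "subst \<theta> (Leaf i) = \<theta> i"
| "subst \<theta> One = One"
| "subst \<theta> (s \<boxdot> t) = subst \<theta> s \<boxdot> subst \<theta> t"

text \<open>
  An arrow of \<open>C\<close> together with a formal source and target. As formal tensor products determine
  their factors, letting ill-typed composites be \<open>None\<close> makes associativity, interchange and
  naturality hold without typing conditions.
\<close>

type_synonym 'm tarr = "(tree \<times> 'm \<times> tree) option"

definition src :: "'m tarr \<Rightarrow> tree" where "src x = fst (the x)"
definition tgt :: "'m tarr \<Rightarrow> tree" where "tgt x = snd (snd (the x))"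
definition arr :: "'m tarr \<Rightarrow> 'm" where "arr x = fst (snd (the x))"

text \<open>The labelling is total, so every tree evaluates to an object and membership in
  \<open>Ob C\<close> never returns as a side condition.\<close>

locale labelled = symmetric_monoidal_category C
  for C :: "('o, 'm, 'z) smc_scheme" (structure) +
  fixes v :: "nat \<Rightarrow> 'o"
  assumes v_Ob: "v i \<in> Ob C"
begin

primrec ev :: "tree \<Rightarrow> 'o" where
  "ev (Leaf i) = v i"
| "ev One = \<I>"
| "ev (s \<boxdot> t) = ev s \<odot> ev t"

lemma ev_Ob [simp]: "ev t \<in> Ob C"
  by (induction t) (auto simp: v_Ob Unit_Ob Tensor_Ob)

text \<open>The bridge between an arrow of \<open>C\<close> and its tagged form. As a relation it is
  derived along the structure of an expression (\<open>lifts_cmp\<close>, \<open>lifts_ten\<close>,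
  \<open>lifts_structure\<close>), so one derivation yields the type and the underlying arrow
  together.\<close>

definition lifts :: "tree \<Rightarrow> tree \<Rightarrow> 'm \<Rightarrow> 'm tarr \<Rightarrow> bool" where
  "lifts s t f x \<longleftrightarrow> f \<in> Hom C (ev s) (ev t) \<and> x = Some (s, f, t)"

definition tag :: "tree \<Rightarrow> tree \<Rightarrow> 'm \<Rightarrow> 'm tarr" where
  "tag s t f = (if f \<in> Hom C (ev s) (ev t) then Some (s, f, t) else None)"

definition defd :: "'m tarr \<Rightarrow> bool" where
  "defd x \<longleftrightarrow> (\<exists>s t f. lifts s t f x)"

definition cmp :: "'m tarr \<Rightarrow> 'm tarr \<Rightarrow> 'm tarr"  (infixr "\<bullet>" 70) where
  "y \<bullet> x = (if defd y \<and> defd x \<and> src y = tgt x then Some (src x, arr y \<cdot> arr x, tgt y) else None)"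

definition ten :: "'m tarr \<Rightarrow> 'm tarr \<Rightarrow> 'm tarr"  (infixr "\<boxtimes>" 75) where
  "x \<boxtimes> y = (if defd x \<and> defd y then Some (src x \<boxdot> src y, arr x \<otimes> arr y, tgt x \<boxdot> tgt y) else None)"

definition "idn a = tag a a (Id C (ev a))"
definition "al a b c = tag ((a \<boxdot> b) \<boxdot> c) (a \<boxdot> b \<boxdot> c) (Assoc C (ev a) (ev b) (ev c))"
definition "al' a b c = tag (a \<boxdot> b \<boxdot> c) ((a \<boxdot> b) \<boxdot> c) (assoc_inv C (ev a) (ev b) (ev c))"
definition "lam a = tag (One \<boxdot> a) a (LUnit C (ev a))"
definition "lam' a = tag a (One \<boxdot> a) (lunit_inv C (ev a))"
definition "rho a = tag (a \<boxdot> One) a (RUnit C (ev a))"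
definition "rho' a = tag a (a \<boxdot> One) (runit_inv C (ev a))"
definition "sg a b = tag (a \<boxdot> b) (b \<boxdot> a) (Braid C (ev a) (ev b))"

lemma Assoc_inverse: "inverse_arrows C ((ev a \<odot> ev b) \<odot> ev c) (ev a \<odot> (ev b \<odot> ev c))
    (Assoc C (ev a) (ev b) (ev c)) (assoc_inv C (ev a) (ev b) (ev c))"
  unfolding assoc_inv_def by (intro inverse_arrows_inverse_of Tensor_Ob Assoc_iso ev_Ob)

lemma LUnit_inverse: "inverse_arrows C (\<I> \<odot> ev a) (ev a) (LUnit C (ev a)) (lunit_inv C (ev a))"
  unfolding lunit_inv_def by (intro inverse_arrows_inverse_of Tensor_Ob LUnit_iso ev_Ob Unit_Ob)

lemma RUnit_inverse: "inverse_arrows C (ev a \<odot> \<I>) (ev a) (RUnit C (ev a)) (runit_inv C (ev a))"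
  unfolding runit_inv_def by (intro inverse_arrows_inverse_of Tensor_Ob RUnit_iso ev_Ob Unit_Ob)

lemma lifts_tag: "f \<in> Hom C (ev s) (ev t) \<Longrightarrow> lifts s t f (tag s t f)"
  by (simp add: lifts_def tag_def)

lemma lifts_structure:
  "lifts a a (Id C (ev a)) (idn a)"
  "lifts ((a \<boxdot> b) \<boxdot> c) (a \<boxdot> b \<boxdot> c) (Assoc C (ev a) (ev b) (ev c)) (al a b c)"
  "lifts (a \<boxdot> b \<boxdot> c) ((a \<boxdot> b) \<boxdot> c) (assoc_inv C (ev a) (ev b) (ev c)) (al' a b c)"
  "lifts (One \<boxdot> a) a (LUnit C (ev a)) (lam a)"
  "lifts a (One \<boxdot> a) (lunit_inv C (ev a)) (lam' a)"
  "lifts (a \<boxdot> One) a (RUnit C (ev a)) (rho a)"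
  "lifts a (a \<boxdot> One) (runit_inv C (ev a)) (rho' a)"
  "lifts (a \<boxdot> b) (b \<boxdot> a) (Braid C (ev a) (ev b)) (sg a b)"
  unfolding idn_def al_def al'_def lam_def lam'_def rho_def rho'_def sg_def
  using Assoc_inverse[of a b c] LUnit_inverse[of a] RUnit_inverse[of a]
  by (auto intro!: lifts_tag Id_Hom Braid_Hom simp: inverse_arrows_def)

lemma lifts_cmp: "lifts s t f x \<Longrightarrow> lifts t u g y \<Longrightarrow> lifts s u (g \<cdot> f) (y \<bullet> x)"
  by (auto simp: lifts_def cmp_def defd_def src_def tgt_def arr_def intro!: Comp_Hom[of _ "ev t"])

lemma lifts_ten: "lifts s t f x \<Longrightarrow> lifts s' t' f' x' \<Longrightarrow> lifts (s \<boxdot> s') (t \<boxdot> t') (f \<otimes> f') (x \<boxtimes> x')"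
  by (auto simp: lifts_def ten_def defd_def src_def tgt_def arr_def intro!: Tensor_Hom)

lemma liftsD: "lifts s t f x \<Longrightarrow> defd x" "lifts s t f x \<Longrightarrow> src x = s" "lifts s t f x \<Longrightarrow> tgt x = t"
    "lifts s t f x \<Longrightarrow> arr x = f" "lifts s t f x \<Longrightarrow> f \<in> Hom C (ev s) (ev t)"
  by (auto simp: lifts_def defd_def src_def tgt_def arr_def)

lemma defd_lifts: "defd x \<Longrightarrow> lifts (src x) (tgt x) (arr x) x"
  by (auto simp: lifts_def defd_def src_def tgt_def arr_def)

lemma lifts_eq_iff: "lifts s t f x \<Longrightarrow> lifts s t g y \<Longrightarrow> x = y \<longleftrightarrow> f = g"
  by (auto simp: lifts_def)

lemma undefd: "\<not> defd y \<Longrightarrow> y \<bullet> x = None" "\<not> defd x \<Longrightarrow> y \<bullet> x = None"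
    "\<not> defd y \<Longrightarrow> y \<boxtimes> x = None" "\<not> defd x \<Longrightarrow> y \<boxtimes> x = None"
    "src y \<noteq> tgt x \<Longrightarrow> y \<bullet> x = None" "\<not> defd None"
  by (auto simp: cmp_def ten_def defd_def lifts_def)

lemma defd_cmp [simp]: "defd (y \<bullet> x) \<longleftrightarrow> defd y \<and> defd x \<and> src y = tgt x"
  using lifts_cmp[of "src x" "tgt x" "arr x" x "tgt y" "arr y" y] defd_lifts[of x] defd_lifts[of y]
  by (metis liftsD(1) undefd)

lemma defd_ten [simp]: "defd (y \<boxtimes> x) \<longleftrightarrow> defd y \<and> defd x"
  using lifts_ten defd_lifts by (metis liftsD(1) undefd)

lemma src_cmp [simp]: "defd y \<Longrightarrow> defd x \<Longrightarrow> src y = tgt x \<Longrightarrow> src (y \<bullet> x) = src x"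
  and tgt_cmp [simp]: "defd y \<Longrightarrow> defd x \<Longrightarrow> src y = tgt x \<Longrightarrow> tgt (y \<bullet> x) = tgt y"
  and src_ten [simp]: "defd y \<Longrightarrow> defd x \<Longrightarrow> src (y \<boxtimes> x) = src y \<boxdot> src x"
  and tgt_ten [simp]: "defd y \<Longrightarrow> defd x \<Longrightarrow> tgt (y \<boxtimes> x) = tgt y \<boxdot> tgt x"
  by (simp_all add: cmp_def ten_def src_def tgt_def)

lemma defd_structure [simp]: "defd (idn a)" "defd (al a b c)" "defd (al' a b c)" "defd (lam a)"
    "defd (lam' a)" "defd (rho a)" "defd (rho' a)" "defd (sg a b)"
  using lifts_structure liftsD(1) by blast+

lemma src_structure [simp]: "src (idn a) = a" "src (al a b c) = (a \<boxdot> b) \<boxdot> c"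
    "src (al' a b c) = a \<boxdot> b \<boxdot> c" "src (lam a) = One \<boxdot> a" "src (lam' a) = a"
    "src (rho a) = a \<boxdot> One" "src (rho' a) = a" "src (sg a b) = a \<boxdot> b"
  using lifts_structure liftsD(2) by blast+

lemma tgt_structure [simp]: "tgt (idn a) = a" "tgt (al a b c) = a \<boxdot> b \<boxdot> c"
    "tgt (al' a b c) = (a \<boxdot> b) \<boxdot> c" "tgt (lam a) = a" "tgt (lam' a) = One \<boxdot> a"
    "tgt (rho a) = a" "tgt (rho' a) = a \<boxdot> One" "tgt (sg a b) = b \<boxdot> a"
  using lifts_structure liftsD(3) by blast+

text \<open>In this form resolution types both sides first and leaves the equation in
  \<open>C\<close>, to be settled by an axiom of the category.\<close>

lemma lifts_cong: "lifts s t f x \<Longrightarrow> lifts s t g y \<Longrightarrow> f = g \<Longrightarrow> x = y"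
  by (simp add: lifts_eq_iff)

lemma cmp_assoc [simp]: "(z \<bullet> y) \<bullet> x = z \<bullet> y \<bullet> x"
proof (cases "defd z \<and> defd y \<and> defd x \<and> src z = tgt y \<and> src y = tgt x")
  case True
  then have x: "lifts (src x) (tgt x) (arr x) x" and y: "lifts (tgt x) (tgt y) (arr y) y"
    and z: "lifts (tgt y) (tgt z) (arr z) z"
    by (metis defd_lifts)+
  show ?thesis
    by (rule lifts_cong, rule lifts_cmp[OF x lifts_cmp[OF y z]],
      rule lifts_cmp[OF lifts_cmp[OF x y] z], rule Comp_assoc[OF ev_Ob ev_Ob ev_Ob ev_Ob])
      (use x y z liftsD(5) in blast)+
next
  case False
  then have "\<not> defd ((z \<bullet> y) \<bullet> x)" "\<not> defd (z \<bullet> y \<bullet> x)" by auto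
  then show ?thesis by (metis cmp_def defd_cmp)
qed

lemma interchange: "(y \<boxtimes> y') \<bullet> (x \<boxtimes> x') = (y \<bullet> x) \<boxtimes> (y' \<bullet> x')"
proof (cases "defd y \<and> defd x \<and> src y = tgt x \<and> defd y' \<and> defd x' \<and> src y' = tgt x'")
  case True
  then have x: "lifts (src x) (tgt x) (arr x) x" and y: "lifts (tgt x) (tgt y) (arr y) y"
   and x': "lifts (src x') (tgt x') (arr x') x'" and y': "lifts (tgt x') (tgt y') (arr y') y'"
    by (metis defd_lifts)+
  show ?thesis
    by (rule lifts_cong, rule lifts_cmp[OF lifts_ten[OF x x'] lifts_ten[OF y y']],
      rule lifts_ten[OF lifts_cmp[OF x y] lifts_cmp[OF x' y']], rule sym,
      rule Tensor_Comp[OF ev_Ob ev_Ob ev_Ob ev_Ob ev_Ob ev_Ob])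
      (use x y x' y' liftsD(5) in blast)+
next
  case False
  then have "\<not> defd ((y \<boxtimes> y') \<bullet> (x \<boxtimes> x'))" "\<not> defd ((y \<bullet> x) \<boxtimes> (y' \<bullet> x'))" by auto
  then show ?thesis by (metis cmp_def ten_def defd_cmp defd_ten)
qed

text \<open>\<open>cmp_assoc\<close> keeps composites nested to the right, so a law for two adjacent
  factors does not match when more factors follow. This is interchange with such a tail;
  \<open>cmp_cong_left\<close> does the same for an arbitrary equation.\<close>

lemma interchange_cmp: "(y \<boxtimes> y') \<bullet> (x \<boxtimes> x') \<bullet> z = ((y \<bullet> x) \<boxtimes> (y' \<bullet> x')) \<bullet> z"
  by (metis interchange cmp_assoc)

lemma cmp_idn [simp]: "defd x \<Longrightarrow> src x = a \<Longrightarrow> x \<bullet> idn a = x"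
proof -
  assume "defd x" "src x = a"
  then have x: "lifts a (tgt x) (arr x) x" using defd_lifts by blast
  show ?thesis
    by (rule lifts_cong[OF lifts_cmp[OF lifts_structure(1) x] x], rule Comp_Id_right[OF ev_Ob ev_Ob])
     (use x liftsD(5) in blast)
qed

lemma idn_cmp [simp]: "defd x \<Longrightarrow> tgt x = a \<Longrightarrow> idn a \<bullet> x = x"
proof -
  assume "defd x" "tgt x = a"
  then have x: "lifts (src x) a (arr x) x" using defd_lifts by blast
  show ?thesis
    by (rule lifts_cong[OF lifts_cmp[OF x lifts_structure(1)] x], rule Comp_Id_left[OF ev_Ob ev_Ob])
     (use x liftsD(5) in blast)
qed

lemma idn_ten [simp]: "idn a \<boxtimes> idn b = idn (a \<boxdot> b)"
  by (rule lifts_cong[OF lifts_ten[OF lifts_structure(1) lifts_structure(1)] lifts_structure(1)])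
    (simp add: Tensor_Id)

lemma inverses [simp]:
  "al a b c \<bullet> al' a b c = idn (a \<boxdot> b \<boxdot> c)" "al' a b c \<bullet> al a b c = idn ((a \<boxdot> b) \<boxdot> c)"
  "lam a \<bullet> lam' a = idn a" "lam' a \<bullet> lam a = idn (One \<boxdot> a)"
  "rho a \<bullet> rho' a = idn a" "rho' a \<bullet> rho a = idn (a \<boxdot> One)"
  "sg b a \<bullet> sg a b = idn (a \<boxdot> b)"
proof -
  note [intro] = lifts_structure and I = lifts_cong[OF lifts_cmp lifts_structure(1)]
  show "al a b c \<bullet> al' a b c = idn (a \<boxdot> b \<boxdot> c)"
    by (rule I) (use Assoc_inverse[of a b c] in \<open>auto simp: inverse_arrows_def\<close>)
  show "al' a b c \<bullet> al a b c = idn ((a \<boxdot> b) \<boxdot> c)"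
    by (rule I) (use Assoc_inverse[of a b c] in \<open>auto simp: inverse_arrows_def\<close>)
  show "lam a \<bullet> lam' a = idn a"
    by (rule I) (use LUnit_inverse[of a] in \<open>auto simp: inverse_arrows_def\<close>)
  show "lam' a \<bullet> lam a = idn (One \<boxdot> a)"
    by (rule I) (use LUnit_inverse[of a] in \<open>auto simp: inverse_arrows_def\<close>)
  show "rho a \<bullet> rho' a = idn a"
    by (rule I) (use RUnit_inverse[of a] in \<open>auto simp: inverse_arrows_def\<close>)
  show "rho' a \<bullet> rho a = idn (a \<boxdot> One)"
    by (rule I) (use RUnit_inverse[of a] in \<open>auto simp: inverse_arrows_def\<close>)
  show "sg b a \<bullet> sg a b = idn (a \<boxdot> b)"
    by (rule I) (use symmetry in \<open>auto simp: inverse_arrows_def\<close>)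
qed

lemma cmp_cong_left: "y \<bullet> x = z \<Longrightarrow> y \<bullet> x \<bullet> w = z \<bullet> w"
  by (metis cmp_assoc)

lemma cancel [simp]:
  "defd x \<Longrightarrow> tgt x = a \<boxdot> b \<boxdot> c \<Longrightarrow> al a b c \<bullet> al' a b c \<bullet> x = x"
  "defd x \<Longrightarrow> tgt x = (a \<boxdot> b) \<boxdot> c \<Longrightarrow> al' a b c \<bullet> al a b c \<bullet> x = x"
  "defd x \<Longrightarrow> tgt x = a \<Longrightarrow> lam a \<bullet> lam' a \<bullet> x = x"
  "defd x \<Longrightarrow> tgt x = One \<boxdot> a \<Longrightarrow> lam' a \<bullet> lam a \<bullet> x = x"
  "defd x \<Longrightarrow> tgt x = a \<Longrightarrow> rho a \<bullet> rho' a \<bullet> x = x"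
  "defd x \<Longrightarrow> tgt x = a \<boxdot> One \<Longrightarrow> rho' a \<bullet> rho a \<bullet> x = x"
  "defd x \<Longrightarrow> tgt x = a \<boxdot> b \<Longrightarrow> sg b a \<bullet> sg a b \<bullet> x = x"
  by (simp_all add: cmp_cong_left[OF inverses(1)] cmp_cong_left[OF inverses(2)]
    cmp_cong_left[OF inverses(3)] cmp_cong_left[OF inverses(4)] cmp_cong_left[OF inverses(5)]
    cmp_cong_left[OF inverses(6)] cmp_cong_left[OF inverses(7)])

lemma al_natural:
  assumes "tgt x = a" "tgt y = b" "tgt z = c"
  shows "al a b c \<bullet> ((x \<boxtimes> y) \<boxtimes> z) = (x \<boxtimes> y \<boxtimes> z) \<bullet> al (src x) (src y) (src z)"
proof (cases "defd x \<and> defd y \<and> defd z")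
  case True
  then have x: "lifts (src x) a (arr x) x" and y: "lifts (src y) b (arr y) y"
     and z: "lifts (src z) c (arr z) z"
    using assms defd_lifts by blast+
  show ?thesis
    by (rule lifts_cong, rule lifts_cmp[OF lifts_ten[OF lifts_ten[OF x y] z] lifts_structure(2)],
      rule lifts_cmp[OF lifts_structure(2) lifts_ten[OF x lifts_ten[OF y z]]],
      rule Assoc_natural[OF ev_Ob ev_Ob ev_Ob ev_Ob ev_Ob ev_Ob])
      (use x y z liftsD(5) in blast)+
qed (auto simp: undefd)

lemma lam_natural:
  assumes "tgt x = a"
  shows "lam a \<bullet> (idn One \<boxtimes> x) = x \<bullet> lam (src x)"
proof (cases "defd x")
  case True
  then have x: "lifts (src x) a (arr x) x"
    using assms defd_lifts by blast+
  have "arr x \<in> Hom C (ev (src x)) (ev a)" using x liftsD(5) by blast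
  then have "LUnit C (ev a) \<cdot> (Id C (ev One) \<otimes> arr x) = arr x \<cdot> LUnit C (ev (src x))"
    using LUnit_natural[OF ev_Ob ev_Ob] by simp
  then show ?thesis
    by (rule lifts_cong[OF lifts_cmp[OF lifts_ten[OF lifts_structure(1) x] lifts_structure(4)]
      lifts_cmp[OF lifts_structure(4) x]])
qed (auto simp: undefd)

lemma rho_natural:
  assumes "tgt x = a"
  shows "rho a \<bullet> (x \<boxtimes> idn One) = x \<bullet> rho (src x)"
proof (cases "defd x")
  case True
  then have x: "lifts (src x) a (arr x) x"
    using assms defd_lifts by blast+
  have "arr x \<in> Hom C (ev (src x)) (ev a)" using x liftsD(5) by blast
  then have "RUnit C (ev a) \<cdot> (arr x \<otimes> Id C (ev One)) = arr x \<cdot> RUnit C (ev (src x))"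
    using RUnit_natural[OF ev_Ob ev_Ob] by simp
  then show ?thesis
    by (rule lifts_cong[OF lifts_cmp[OF lifts_ten[OF x lifts_structure(1)] lifts_structure(6)]
      lifts_cmp[OF lifts_structure(6) x]])
qed (auto simp: undefd)

lemma sg_natural:
  assumes "tgt x = a" "tgt y = b"
  shows "sg a b \<bullet> (x \<boxtimes> y) = (y \<boxtimes> x) \<bullet> sg (src x) (src y)"
proof (cases "defd x \<and> defd y")
  case True
  then have x: "lifts (src x) a (arr x) x" and y: "lifts (src y) b (arr y) y"
    using assms defd_lifts by blast+
  show ?thesis
    by (rule lifts_cong, rule lifts_cmp[OF lifts_ten[OF x y] lifts_structure(8)],
      rule lifts_cmp[OF lifts_structure(8) lifts_ten[OF y x]],
      rule Braid_natural[OF ev_Ob ev_Ob ev_Ob ev_Ob])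
      (use x y liftsD(5) in blast)+
qed (auto simp: undefd)

lemma pentagon_tree: "al a b (c \<boxdot> d) \<bullet> al (a \<boxdot> b) c d
    = (idn a \<boxtimes> al b c d) \<bullet> al a (b \<boxdot> c) d \<bullet> (al a b c \<boxtimes> idn d)"
  by (rule lifts_cong, (rule lifts_cmp lifts_ten lifts_structure)+)
    (simp add: pentagon)

lemma triangle_tree: "(idn a \<boxtimes> lam b) \<bullet> al a One b = rho a \<boxtimes> idn b"
  by (rule lifts_cong, (rule lifts_cmp lifts_ten lifts_structure)+)
    (simp add: triangle)

lemma hexagon_tree: "al b c a \<bullet> sg a (b \<boxdot> c) \<bullet> al a b c
    = (idn b \<boxtimes> sg a c) \<bullet> al b a c \<bullet> (sg a b \<boxtimes> idn c)"
  by (rule lifts_cong, (rule lifts_cmp lifts_ten lifts_structure)+)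
    (simp add: hexagon)

section \<open>Unit laws and hexagons\<close>

lemma right_cancel:
  assumes "x \<bullet> z = y \<bullet> z" "z \<bullet> w = idn a" "defd x" "src x = a" "defd y" "src y = a"
  shows "x = y"
proof -
  have "x \<bullet> z \<bullet> w = y \<bullet> z \<bullet> w"
    using arg_cong[OF assms(1), of "\<lambda>u. u \<bullet> w"] by simp
  with assms show ?thesis by simp
qed

lemma left_cancel:
  assumes "z \<bullet> x = z \<bullet> y" "w \<bullet> z = idn a" "defd x" "tgt x = a" "defd y" "tgt y = a"
  shows "x = y"
proof -
  have "(w \<bullet> z) \<bullet> x = (w \<bullet> z) \<bullet> y"
    using arg_cong[OF assms(1), of "\<lambda>u. w \<bullet> u"] by simp
  with assms show ?thesis by (simp del: cmp_assoc)
qed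

text \<open>Tensoring with the unit is faithful because \<open>lam\<close> is a natural isomorphism.
  The unit laws below are therefore proved after tensoring with \<open>One\<close>, where pentagon,
  triangle and hexagon become applicable.\<close>

lemma idn_One_ten_inject:
  assumes "idn One \<boxtimes> x = idn One \<boxtimes> y" "defd x" "defd y"
  shows "x = y"
proof -
  have "src x = src y" "tgt x = tgt y"
    using arg_cong[OF assms(1), of src] arg_cong[OF assms(1), of tgt] assms(2,3) by simp_all
  then have "x \<bullet> lam (src x) = y \<bullet> lam (src x)"
    using lam_natural[of x "tgt x"] lam_natural[of y "tgt x"] assms(1) by simp
  then show ?thesis by (rule right_cancel[OF _ inverses(3)]) (use assms \<open>src x = src y\<close> in simp_all)
qed

lemma ten_idn_One_inject:
  assumes "x \<boxtimes> idn One = y \<boxtimes> idn One" "defd x" "defd y"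
  shows "x = y"
proof -
  have "src x = src y" "tgt x = tgt y"
    using arg_cong[OF assms(1), of src] arg_cong[OF assms(1), of tgt] assms(2,3) by simp_all
  then have "x \<bullet> rho (src x) = y \<bullet> rho (src x)"
    using rho_natural[of x "tgt x"] rho_natural[of y "tgt x"] assms(1) by simp
  then show ?thesis by (rule right_cancel[OF _ inverses(5)]) (use assms \<open>src x = src y\<close> in simp_all)
qed

text \<open>Kelly's argument: tensored with \<open>One\<close> on the left, the claim follows from
  the pentagon at \<open>One\<close>, \<open>One\<close>, a, b and two triangles, once the
  invertible associators on the right are cancelled.\<close>

lemma lam_al: "lam (a \<boxdot> b) \<bullet> al One a b = lam a \<boxtimes> idn b"
proof (rule idn_One_ten_inject)
  have P: "al One One (a \<boxdot> b) \<bullet> al (One \<boxdot> One) a b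
    = (idn One \<boxtimes> al One a b) \<bullet> al One (One \<boxdot> a) b \<bullet> (al One One a \<boxtimes> idn b)"
    by (rule pentagon_tree)
  have "(idn One \<boxtimes> (lam (a \<boxdot> b) \<bullet> al One a b)) \<bullet> al One (One \<boxdot> a) b \<bullet> (al One One a \<boxtimes> idn b)
      = (idn One \<boxtimes> lam (a \<boxdot> b)) \<bullet> al One One (a \<boxdot> b) \<bullet> al (One \<boxdot> One) a b"
    unfolding P by (simp add: interchange_cmp)
  also have "\<dots> = (rho One \<boxtimes> idn (a \<boxdot> b)) \<bullet> al (One \<boxdot> One) a b"
    by (simp flip: triangle_tree)
  also have "\<dots> = al One a b \<bullet> ((rho One \<boxtimes> idn a) \<boxtimes> idn b)"
    using al_natural[of "rho One" One "idn a" a "idn b" b] by simp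
  also have "\<dots> = al One a b \<bullet> ((idn One \<boxtimes> lam a) \<boxtimes> idn b) \<bullet> (al One One a \<boxtimes> idn b)"
    by (simp add: interchange triangle_tree)
  also have "\<dots> = (idn One \<boxtimes> (lam a \<boxtimes> idn b)) \<bullet> al One (One \<boxdot> a) b \<bullet> (al One One a \<boxtimes> idn b)"
    using cmp_cong_left[OF al_natural[of "idn One" One "lam a" a "idn b" b]] by simp
  finally have E: "(idn One \<boxtimes> (lam (a \<boxdot> b) \<bullet> al One a b)) \<bullet> al One (One \<boxdot> a) b
      \<bullet> (al One One a \<boxtimes> idn b)
    = (idn One \<boxtimes> (lam a \<boxtimes> idn b)) \<bullet> al One (One \<boxdot> a) b \<bullet> (al One One a \<boxtimes> idn b)" .
  show "idn One \<boxtimes> (lam (a \<boxdot> b) \<bullet> al One a b) = idn One \<boxtimes> (lam a \<boxtimes> idn b)"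
    by (rule right_cancel[OF E, of "(al' One One a \<boxtimes> idn b) \<bullet> al' One (One \<boxdot> a) b"])
      (simp_all add: interchange_cmp)
qed simp_all

text \<open>The mirror image of \<open>lam_al\<close>: tensor with \<open>One\<close> on the right,
  use the pentagon at a, b, \<open>One\<close>, \<open>One\<close>, and cancel an associator on the
  left.\<close>

lemma rho_al: "(idn a \<boxtimes> rho b) \<bullet> al a b One = rho (a \<boxdot> b)"
proof (rule ten_idn_One_inject)
  have P: "al a b (One \<boxdot> One) \<bullet> al (a \<boxdot> b) One One
    = (idn a \<boxtimes> al b One One) \<bullet> al a (b \<boxdot> One) One \<bullet> (al a b One \<boxtimes> idn One)"
    by (rule pentagon_tree)
  have "al a b One \<bullet> (((idn a \<boxtimes> rho b) \<bullet> al a b One) \<boxtimes> idn One)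
      = al a b One \<bullet> ((idn a \<boxtimes> rho b) \<boxtimes> idn One) \<bullet> (al a b One \<boxtimes> idn One)"
    by (simp add: interchange)
  also have "\<dots> = (idn a \<boxtimes> (rho b \<boxtimes> idn One)) \<bullet> al a (b \<boxdot> One) One \<bullet> (al a b One \<boxtimes> idn One)"
    using cmp_cong_left[OF al_natural[of "idn a" a "rho b" b "idn One" One]] by simp
  also have "\<dots> = (idn a \<boxtimes> (idn b \<boxtimes> lam One)) \<bullet> (idn a \<boxtimes> al b One One) \<bullet> al a (b \<boxdot> One) One
      \<bullet> (al a b One \<boxtimes> idn One)"
    by (simp add: interchange_cmp triangle_tree)
  also have "\<dots> = (idn a \<boxtimes> (idn b \<boxtimes> lam One)) \<bullet> al a b (One \<boxdot> One) \<bullet> al (a \<boxdot> b) One One"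
    by (simp add: P)
  also have "\<dots> = al a b One \<bullet> (idn (a \<boxdot> b) \<boxtimes> lam One) \<bullet> al (a \<boxdot> b) One One"
    using cmp_cong_left[OF al_natural[of "idn a" a "idn b" b "lam One" One]] by simp
  also have "\<dots> = al a b One \<bullet> (rho (a \<boxdot> b) \<boxtimes> idn One)"
    by (simp add: triangle_tree)
  finally have E: "al a b One \<bullet> (((idn a \<boxtimes> rho b) \<bullet> al a b One) \<boxtimes> idn One)
    = al a b One \<bullet> (rho (a \<boxdot> b) \<boxtimes> idn One)" .
  show "((idn a \<boxtimes> rho b) \<bullet> al a b One) \<boxtimes> idn One = rho (a \<boxdot> b) \<boxtimes> idn One"
    by (rule left_cancel[OF E inverses(2)]) simp_all
qed simp_all

text \<open>Naturality of \<open>lam\<close> at \<open>lam One\<close> identifies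
  \<open>idn One \<boxtimes> lam One\<close> with \<open>lam (One \<boxdot> One)\<close>; composed
  with the associator, the first is the triangle and the second is \<open>lam_al\<close>.\<close>

lemma lam_One: "lam One = rho One"
proof (rule ten_idn_One_inject)
  have "lam One \<bullet> (idn One \<boxtimes> lam One) = lam One \<bullet> lam (One \<boxdot> One)"
    using lam_natural[of "lam One" One] by simp
  then have "idn One \<boxtimes> lam One = lam (One \<boxdot> One)"
    by (rule left_cancel[OF _ inverses(4)]) simp_all
  then show "lam One \<boxtimes> idn One = rho One \<boxtimes> idn One"
    by (simp flip: triangle_tree lam_al)
qed simp_all

text \<open>The braiding axioms do not mention units. Tensoring with \<open>One\<close> on the right
  makes the claim a consequence of the hexagon at a, \<open>One\<close>, \<open>One\<close>, with
  \<open>lam_al\<close> and the triangle removing the associators.\<close>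

lemma lam_sg: "lam a \<bullet> sg a One = rho a"
proof (rule ten_idn_One_inject)
  have "sg a One \<bullet> ((lam a \<bullet> sg a One) \<boxtimes> idn One)
      = sg a One \<bullet> (lam a \<boxtimes> idn One) \<bullet> (sg a One \<boxtimes> idn One)"
    by (simp add: interchange)
  also have "\<dots> = sg a One \<bullet> lam (a \<boxdot> One) \<bullet> al One a One \<bullet> (sg a One \<boxtimes> idn One)"
    by (simp flip: lam_al)
  also have "\<dots> = lam (One \<boxdot> a) \<bullet> (idn One \<boxtimes> sg a One) \<bullet> al One a One \<bullet> (sg a One \<boxtimes> idn One)"
    using cmp_cong_left[OF lam_natural[of "sg a One" "One \<boxdot> a"]] by simp
  also have "\<dots> = lam (One \<boxdot> a) \<bullet> al One One a \<bullet> sg a (One \<boxdot> One) \<bullet> al a One One"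
    by (simp add: hexagon_tree)
  also have "\<dots> = (lam One \<boxtimes> idn a) \<bullet> sg a (One \<boxdot> One) \<bullet> al a One One"
    using cmp_cong_left[OF lam_al[of One a]] by simp
  also have "\<dots> = sg a One \<bullet> (idn a \<boxtimes> lam One) \<bullet> al a One One"
    using cmp_cong_left[OF sg_natural[of "idn a" a "lam One" One]] by simp
  also have "\<dots> = sg a One \<bullet> (rho a \<boxtimes> idn One)"
    by (simp add: triangle_tree)
  finally have E: "sg a One \<bullet> ((lam a \<bullet> sg a One) \<boxtimes> idn One) = sg a One \<bullet> (rho a \<boxtimes> idn One)" .
  show "(lam a \<bullet> sg a One) \<boxtimes> idn One = rho a \<boxtimes> idn One"
    by (rule left_cancel[OF E inverses(7)]) simp_all
qed simp_all

lemma rho_sg: "rho a \<bullet> sg One a = lam a"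
  by (simp flip: lam_sg)

text \<open>The elementary move on right-nested words: b is brought to the front, past a, while c
  stays behind. It serves both the merging of words and the inner part of
  \<open>middle_swap\<close>.\<close>

definition "sw a b c = al b a c \<bullet> (sg a b \<boxtimes> idn c) \<bullet> al' a b c"

lemma sw_structure [simp]: "defd (sw a b c)" "src (sw a b c) = a \<boxdot> b \<boxdot> c" "tgt (sw a b c)
    = b \<boxdot> a \<boxdot> c"
  by (simp_all add: sw_def)

lemma al'_natural:
  assumes "tgt x = a" "tgt y = b" "tgt z = c"
  shows "al' a b c \<bullet> (x \<boxtimes> y \<boxtimes> z) = ((x \<boxtimes> y) \<boxtimes> z) \<bullet> al' (src x) (src y) (src z)"
proof (cases "defd x \<and> defd y \<and> defd z")
  case True
  show ?thesis
    by (rule left_cancel[OF _ inverses(2)[of a b c]])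
      (use True assms in \<open>simp_all add: cmp_cong_left[OF al_natural]\<close>)
qed (auto simp: undefd)

lemma sw_natural:
  assumes "tgt x = a" "tgt y = b" "tgt z = c"
  shows "sw a b c \<bullet> (x \<boxtimes> y \<boxtimes> z) = (y \<boxtimes> x \<boxtimes> z) \<bullet> sw (src x) (src y) (src z)"
proof (cases "defd x \<and> defd y \<and> defd z")
  case True
  have "sw a b c \<bullet> (x \<boxtimes> y \<boxtimes> z) = al b a c \<bullet> ((sg a b \<bullet> (x \<boxtimes> y)) \<boxtimes> z) \<bullet> al' (src x) (src y) (src z)"
    using assms True by (simp add: sw_def al'_natural interchange_cmp)
  also have "\<dots> = al b a c \<bullet> ((y \<boxtimes> x) \<boxtimes> z) \<bullet> (sg (src x) (src y) \<boxtimes> idn (src z))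
      \<bullet> al' (src x) (src y) (src z)"
    using True by (simp add: sg_natural[OF assms(1,2)] interchange_cmp)
  also have "\<dots> = (y \<boxtimes> x \<boxtimes> z) \<bullet> sw (src x) (src y) (src z)"
    using assms True by (simp add: sw_def cmp_cong_left[OF al_natural])
  finally show ?thesis .
qed (auto simp: undefd)

lemma sw_One: "(idn b \<boxtimes> lam c) \<bullet> sw One b c = lam (b \<boxdot> c)"
proof -
  have "(idn b \<boxtimes> lam c) \<bullet> sw One b c = (rho b \<boxtimes> idn c) \<bullet> (sg One b \<boxtimes> idn c) \<bullet> al' One b c"
    by (simp add: sw_def cmp_cong_left[OF triangle_tree])
  also have "\<dots> = (lam b \<boxtimes> idn c) \<bullet> al' One b c"
    by (simp add: interchange_cmp rho_sg)
  also have "\<dots> = lam (b \<boxdot> c)"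
    by (simp flip: lam_al)
  finally show ?thesis .
qed

text \<open>A rearranged hexagon, obtained by precomposing with the invertible arrow
  \<open>sg c (a \<boxdot> b) \<bullet> al c a b\<close>. It carries the inductive step of
  \<open>mg_sg\<close>.\<close>

lemma sw_sg: "sw c a b \<bullet> sg (a \<boxdot> b) c = (idn a \<boxtimes> sg b c) \<bullet> al a b c"
proof -
  have H: "al a b c \<bullet> sg c (a \<boxdot> b) \<bullet> al c a b = (idn a \<boxtimes> sg c b) \<bullet> al a c b \<bullet> (sg c a \<boxtimes> idn b)"
    by (rule hexagon_tree)
  have "(idn a \<boxtimes> sg b c) \<bullet> al a b c \<bullet> (sg c (a \<boxdot> b) \<bullet> al c a b)
      = sw c a b \<bullet> sg (a \<boxdot> b) c \<bullet> (sg c (a \<boxdot> b) \<bullet> al c a b)"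
    by (simp add: H interchange_cmp sw_def)
  then have E: "((idn a \<boxtimes> sg b c) \<bullet> al a b c) \<bullet> (sg c (a \<boxdot> b) \<bullet> al c a b)
      = (sw c a b \<bullet> sg (a \<boxdot> b) c) \<bullet> (sg c (a \<boxdot> b) \<bullet> al c a b)" by simp
  show ?thesis
    by (rule right_cancel[OF E, of "al' c a b \<bullet> sg (a \<boxdot> b) c", symmetric]) simp_all
qed

text \<open>Two pentagons with naturality of the associator in between. It is the step of
  \<open>mg_assoc\<close> in which the least letter heads the middle word.\<close>

lemma sw_al_mid:
  "(idn b \<boxtimes> al a c d) \<bullet> al b (a \<boxdot> c) d \<bullet> (sw a b c \<boxtimes> idn d)
    = sw a b (c \<boxdot> d) \<bullet> (idn a \<boxtimes> al b c d) \<bullet> al a (b \<boxdot> c) d"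
proof -
  have "(idn b \<boxtimes> al a c d) \<bullet> al b (a \<boxdot> c) d \<bullet> (sw a b c \<boxtimes> idn d) \<bullet> (al a b c \<boxtimes> idn d)
    = ((idn b \<boxtimes> al a c d) \<bullet> al b (a \<boxdot> c) d \<bullet> (al b a c \<boxtimes> idn d)) \<bullet> ((sg a b \<boxtimes> idn c) \<boxtimes> idn d)"
    by (simp add: sw_def interchange)
  also have "\<dots> = al b a (c \<boxdot> d) \<bullet> al (b \<boxdot> a) c d \<bullet> ((sg a b \<boxtimes> idn c) \<boxtimes> idn d)"
    by (simp flip: pentagon_tree)
  also have "\<dots> = sw a b (c \<boxdot> d) \<bullet> al a b (c \<boxdot> d) \<bullet> al (a \<boxdot> b) c d"
    by (simp add: al_natural sw_def)
  also have "\<dots> = (sw a b (c \<boxdot> d) \<bullet> (idn a \<boxtimes> al b c d) \<bullet> al a (b \<boxdot> c) d) \<bullet> (al a b c \<boxtimes> idn d)"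
    by (simp add: pentagon_tree)
  finally have E: "((idn b \<boxtimes> al a c d) \<bullet> al b (a \<boxdot> c) d \<bullet> (sw a b c \<boxtimes> idn d)) \<bullet> (al a b c \<boxtimes> idn d)
    = (sw a b (c \<boxdot> d) \<bullet> (idn a \<boxtimes> al b c d) \<bullet> al a (b \<boxdot> c) d) \<bullet> (al a b c \<boxtimes> idn d)" by simp
  show ?thesis
    by (rule right_cancel[OF E, of "al' a b c \<boxtimes> idn d"]) (simp_all add: interchange)
qed

text \<open>By symmetry the second hexagon is the inverse of the first one.\<close>

lemma hexagon': "sg (a \<boxdot> b) c = al c a b \<bullet> (sg a c \<boxtimes> idn b) \<bullet> al' a c b \<bullet> (idn a \<boxtimes> sg b c)
    \<bullet> al a b c"
  using arg_cong[OF sw_sg[of c a b], of "\<lambda>x. sw a c b \<bullet> x"]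
  by (simp add: sw_def interchange_cmp)

text \<open>Moving c past a \<otimes> b in one go or past b and then a is the same, by the second
  hexagon; the pentagon accounts for the spectator d. It is the step of \<open>mg_assoc\<close> in
  which the least letter heads the last word.\<close>

lemma sw_al_right:
  "(idn c \<boxtimes> al a b d) \<bullet> sw (a \<boxdot> b) c d = sw a c (b \<boxdot> d) \<bullet> (idn a \<boxtimes> sw b c d) \<bullet> al a b (c \<boxdot> d)"
proof -
  have "sw a c (b \<boxdot> d) \<bullet> (idn a \<boxtimes> sw b c d) \<bullet> al a b (c \<boxdot> d) \<bullet> al (a \<boxdot> b) c d
     = sw a c (b \<boxdot> d) \<bullet> (idn a \<boxtimes> (sw b c d \<bullet> al b c d)) \<bullet> al a (b \<boxdot> c) d \<bullet> (al a b c \<boxtimes> idn d)"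
    by (simp add: pentagon_tree interchange_cmp)
  also have "\<dots> = sw a c (b \<boxdot> d) \<bullet> (idn a \<boxtimes> al c b d) \<bullet> (idn a \<boxtimes> (sg b c \<boxtimes> idn d)) \<bullet> al a (b \<boxdot> c) d
      \<bullet> (al a b c \<boxtimes> idn d)"
    by (simp add: sw_def interchange_cmp)
  also have "\<dots> = (sw a c (b \<boxdot> d) \<bullet> (idn a \<boxtimes> al c b d) \<bullet> al a (c \<boxdot> b) d) \<bullet> ((idn a \<boxtimes> sg b c) \<boxtimes> idn d)
      \<bullet> (al a b c \<boxtimes> idn d)"
    by (simp add: cmp_cong_left[OF al_natural])
  also have "\<dots> = (idn c \<boxtimes> al a b d) \<bullet> al c (a \<boxdot> b) d \<bullet> ((sw a c b \<bullet> (idn a \<boxtimes> sg b c)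
      \<bullet> al a b c) \<boxtimes> idn d)"
    by (simp add: interchange flip: sw_al_mid)
  also have "sw a c b \<bullet> (idn a \<boxtimes> sg b c) \<bullet> al a b c = sg (a \<boxdot> b) c"
    by (simp add: hexagon' sw_def)
  finally have E: "((idn c \<boxtimes> al a b d) \<bullet> sw (a \<boxdot> b) c d) \<bullet> al (a \<boxdot> b) c d
    = (sw a c (b \<boxdot> d) \<bullet> (idn a \<boxtimes> sw b c d) \<bullet> al a b (c \<boxdot> d)) \<bullet> al (a \<boxdot> b) c d"
    by (simp add: sw_def)
  show ?thesis
    by (rule right_cancel[OF E, of "al' (a \<boxdot> b) c d"]) simp_all
qed

end

section \<open>Coherence\<close>

fun merge :: "nat list \<Rightarrow> nat list \<Rightarrow> nat list" where
  "merge [] K = K"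
| "merge (a # L) [] = a # L"
| "merge (a # L) (b # K) = (if a < b then a # merge L (b # K) else b # merge (a # L) K)"

lemma merge_Nil [simp]: "merge L [] = L"
  by (cases L) simp_all

lemma set_merge [simp]: "set (merge L K) = set L \<union> set K"
  by (induction L K rule: merge.induct) auto

lemma merge_Cons_left: "\<forall>x \<in> set K. a < x \<Longrightarrow> merge (a # L) K = a # merge L K"
  by (cases K) simp_all

lemma merge_Cons_right: "\<forall>x \<in> set L. b < x \<Longrightarrow> merge L (b # K) = b # merge L K"
  by (cases L) auto

abbreviation "increasing \<equiv> sorted_wrt ((<) :: nat \<Rightarrow> nat \<Rightarrow> bool)"

lemma increasing_merge:
  "increasing L \<Longrightarrow> increasing K \<Longrightarrow> set L \<inter> set K = {} \<Longrightarrow> increasing (merge L K)"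
proof (induction L K rule: merge.induct)
  case (3 a L b K)
  then have "a \<noteq> b" by auto
  with 3 show ?case by (auto dest: less_trans)
qed simp_all

text \<open>The inductions below peel off the overall least letter. This treats the words
  symmetrically, which the recursion equations of \<open>merge\<close> do not.\<close>

lemma least_head_cases:
  fixes L K :: "nat list"
  assumes "increasing L" "increasing K" "set L \<inter> set K = {}"
  obtains "L = []" | "K = []"
  | a L' where "L = a # L'" "\<forall>x \<in> set L' \<union> set K. a < x"
  | b K' where "K = b # K'" "\<forall>x \<in> set L \<union> set K'. b < x"
proof (cases L; cases K)
  fix a L' b K' assume *: "L = a # L'" "K = b # K'"
  then consider "a < b" | "b < a" using assms by force
  then show thesis
  proof cases
    case 1 then show thesis using that(3)[of a L'] * assms by force
  next
    case 2 then show thesis using that(4)[of b K'] * assms by force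
  qed
qed (use that in auto)

context labelled begin

text \<open>Every word ends in \<open>One\<close>, so a letter is put in front in the same way
  whether or not others follow; accordingly a single leaf is normalized by
  \<open>rho'\<close>.\<close>

primrec word :: "nat list \<Rightarrow> tree" where
  "word [] = One"
| "word (a # L) = Leaf a \<boxdot> word L"

text \<open>Lets an equality of lists be read off from the targets of equal arrows, as in
  \<open>coh_sg\<close>.\<close>

lemma word_inject: "word L = word K \<Longrightarrow> L = K"
  by (induction L arbitrary: K; case_tac K) auto

text \<open>The shuffle isomorphism realizing \<open>merge\<close>: a head taken from the left word
  only needs reassociation, a head taken from the right word is moved across the left word by
  \<open>sw\<close>.\<close>

fun mg :: "nat list \<Rightarrow> nat list \<Rightarrow> 'm tarr" where
  "mg [] K = lam (word K)"
| "mg (a # L) [] = rho (word (a # L))"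
| "mg (a # L) (b # K) = (if a < b then (idn (Leaf a) \<boxtimes> mg L (b # K))
    \<bullet> al (Leaf a) (word L) (word (b # K))
     else (idn (Leaf b) \<boxtimes> mg (a # L) K) \<bullet> sw (word (a # L)) (Leaf b) (word K))"

lemma mg_structure [simp]:
  "defd (mg L K) \<and> src (mg L K) = word L \<boxdot> word K \<and> tgt (mg L K) = word (merge L K)"
  by (induction L K rule: mg.induct) auto

lemma mg_Nil [simp]: "mg L [] = rho (word L)"
  by (cases L) (simp_all add: lam_One)

text \<open>Peeling a least letter off the left word obeys one formula even if the other word is
  empty; that case is \<open>rho_al\<close>. For the right word it is \<open>sw_One\<close>.\<close>

lemma mg_Cons_left:
  "\<forall>x \<in> set K. a < x \<Longrightarrow> mg (a # L) K = (idn (Leaf a) \<boxtimes> mg L K) \<bullet> al (Leaf a) (word L) (word K)"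
  by (cases K) (simp_all add: rho_al)

lemma mg_Cons_right:
  "\<forall>x \<in> set L. b < x \<Longrightarrow> mg L (b # K) = (idn (Leaf b) \<boxtimes> mg L K) \<bullet> sw (word L) (Leaf b) (word K)"
  by (cases L) (auto simp add: sw_One)

lemma mg_sg:
  assumes "increasing L" "increasing K" "set L \<inter> set K = {}"
  shows "mg K L \<bullet> sg (word L) (word K) = mg L K"
  using assms
proof (induction "length L + length K" arbitrary: L K rule: less_induct)
  case less
  from less.prems show ?case
  proof (cases rule: least_head_cases)
    case 1 then show ?thesis by (simp add: rho_sg)
  next
    case 2 then show ?thesis by (simp add: lam_sg)
  next
    case (3 a L')
    then have "mg K L' \<bullet> sg (word L') (word K) = mg L' K"
      using less.prems by (intro less.hyps) auto
    with 3 show ?thesis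
      by (simp add: mg_Cons_left mg_Cons_right sw_sg interchange_cmp)
  next
    case (4 b K')
    then have IH: "mg L K' \<bullet> sg (word K') (word L) = mg K' L"
      using less.prems by (intro less.hyps) auto
    \<comment> \<open>With the roles of the words exchanged, the computation of the previous case
      gives this; precomposing with the braiding, which is its own inverse by symmetry, then yields
      the claim.\<close>
    have "mg L K \<bullet> sg (word K) (word L) = mg K L"
      using 4 by (simp add: mg_Cons_left mg_Cons_right sw_sg interchange_cmp IH)
    then show ?thesis by (simp add: cmp_cong_left flip: \<open>mg L K \<bullet> sg (word K) (word L) = mg K L\<close>)
  qed
qed

text \<open>The lists are compared in the same induction because the two arrows have a common target
  only if both orders of merging give the same word. The word holding the least letter decides the
  step: the pentagon for \<open>L\<close>, \<open>sw_al_mid\<close> for \<open>K\<close>,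
  \<open>sw_al_right\<close> for \<open>J\<close>. Empty words are settled by \<open>lam_al\<close>,
  the triangle and \<open>rho_al\<close> respectively.\<close>

lemma mg_assoc:
  assumes "increasing L" "increasing K" "increasing J"
    "set L \<inter> set K = {}" "set L \<inter> set J = {}" "set K \<inter> set J = {}"
  shows "merge L (merge K J) = merge (merge L K) J
    \<and> mg L (merge K J) \<bullet> (idn (word L) \<boxtimes> mg K J) \<bullet> al (word L) (word K) (word J)
      = mg (merge L K) J \<bullet> (mg L K \<boxtimes> idn (word J))"
  using assms
proof (induction "length L + length K + length J" arbitrary: L K J rule: less_induct)
  case less
  consider "L = []" | "K = []" | "J = []"
  | a L' where "L = a # L'" "\<forall>x \<in> set L' \<union> set K \<union> set J. a < x"
  | b K' where "K = b # K'" "\<forall>x \<in> set L \<union> set K' \<union> set J. b < x"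
  | c J' where "J = c # J'" "\<forall>x \<in> set L \<union> set K \<union> set J'. c < x"
  proof (cases L; cases K; cases J)
    fix a L' b K' c J' assume *: "L = a # L'" "K = b # K'" "J = c # J'"
    then have "a \<noteq> b" "a \<noteq> c" "b \<noteq> c" using less.prems by auto
    then consider "a < b" "a < c" | "b < a" "b < c" | "c < a" "c < b" by linarith
    then show thesis
    proof cases
      case 1 then show thesis using that(4)[of a L'] * less.prems by force
    next
      case 2 then show thesis using that(5)[of b K'] * less.prems by force
    next
      case 3 then show thesis using that(6)[of c J'] * less.prems by force
    qed
  qed (use that in auto)
  then show ?case
  proof cases
    case 1
    then show ?thesis
      using cmp_cong_left[OF lam_natural[of "mg K J" "word (merge K J)"], of
          "al One (word K) (word J)"]
      by (simp add: lam_al)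
  next
    case 2
    then show ?thesis by (simp add: triangle_tree)
  next
    case 3
    then show ?thesis
      using rho_natural[of "mg L K" "word (merge L K)"] by (simp add: rho_al)
  next
    case (4 a L')
    let ?a = "Leaf a" and ?L = "word L'" and ?K = "word K" and ?J = "word J"
    have IH: "merge L' (merge K J) = merge (merge L' K) J \<and>
       mg L' (merge K J) \<bullet> (idn ?L \<boxtimes> mg K J) \<bullet> al ?L ?K ?J = mg (merge L' K) J \<bullet> (mg L' K \<boxtimes> idn ?J)"
      using 4 less.prems by (intro less.hyps) auto
    have "mg L (merge K J) \<bullet> (idn (word L) \<boxtimes> mg K J) \<bullet> al (word L) ?K ?J
      = (idn ?a \<boxtimes> mg L' (merge K J)) \<bullet> al ?a ?L (word (merge K J)) \<bullet> ((idn ?a \<boxtimes> idn ?L) \<boxtimes> mg K J)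
          \<bullet> al (?a \<boxdot> ?L) ?K ?J"
      using 4 by (simp add: mg_Cons_left)
    also have "\<dots> = (idn ?a \<boxtimes> mg L' (merge K J)) \<bullet> (idn ?a \<boxtimes> idn ?L \<boxtimes> mg K J) \<bullet> al ?a ?L (?K \<boxdot> ?J)
        \<bullet> al (?a \<boxdot> ?L) ?K ?J"
      \<comment> \<open>Naturality moves the inner merge to the other side of the associator, so
        that the two associators meet in the shape of the pentagon.\<close>
      by (subst cmp_cong_left[OF al_natural]) simp_all
    also have "\<dots> = (idn ?a \<boxtimes> (mg L' (merge K J) \<bullet> (idn ?L \<boxtimes> mg K J) \<bullet> al ?L ?K ?J))
        \<bullet> al ?a (?L \<boxdot> ?K) ?J \<bullet> (al ?a ?L ?K \<boxtimes> idn ?J)"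
      by (simp add: pentagon_tree interchange_cmp)
    also have "\<dots> = (idn ?a \<boxtimes> mg (merge L' K) J) \<bullet> (idn ?a \<boxtimes> (mg L' K \<boxtimes> idn ?J)) \<bullet> al ?a (?L \<boxdot> ?K) ?J
        \<bullet> (al ?a ?L ?K \<boxtimes> idn ?J)"
      using IH by (simp add: interchange_cmp)
    also have "\<dots> = (idn ?a \<boxtimes> mg (merge L' K) J) \<bullet> al ?a (word (merge L' K)) ?J
        \<bullet> ((idn ?a \<boxtimes> mg L' K) \<boxtimes> idn ?J) \<bullet> (al ?a ?L ?K \<boxtimes> idn ?J)"
      by (subst cmp_cong_left[OF al_natural]) simp_all
    also have "\<dots> = mg (merge L K) J \<bullet> (mg L K \<boxtimes> idn ?J)"
      using 4 by (simp add: mg_Cons_left merge_Cons_left interchange)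
    finally show ?thesis
      using 4 IH by (simp add: merge_Cons_left)
  next
    case (5 b K')
    let ?b = "Leaf b" and ?L = "word L" and ?K = "word K'" and ?J = "word J"
    have IH: "merge L (merge K' J) = merge (merge L K') J \<and>
       mg L (merge K' J) \<bullet> (idn ?L \<boxtimes> mg K' J) \<bullet> al ?L ?K ?J = mg (merge L K') J
           \<bullet> (mg L K' \<boxtimes> idn ?J)"
      using 5 less.prems by (intro less.hyps) auto
    have "mg L (merge K J) \<bullet> (idn ?L \<boxtimes> mg K J) \<bullet> al ?L (word K) ?J
      = (idn ?b \<boxtimes> mg L (merge K' J)) \<bullet> sw ?L ?b (word (merge K' J)) \<bullet> (idn ?L \<boxtimes> idn ?b \<boxtimes> mg K' J)
        \<bullet> (idn ?L \<boxtimes> al ?b ?K ?J) \<bullet> al ?L (?b \<boxdot> ?K) ?J"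
      using 5 by (simp add: mg_Cons_left mg_Cons_right merge_Cons_left interchange_cmp)
    also have "\<dots> = (idn ?b \<boxtimes> (mg L (merge K' J) \<bullet> (idn ?L \<boxtimes> mg K' J))) \<bullet> sw ?L ?b (?K \<boxdot> ?J)
        \<bullet> (idn ?L \<boxtimes> al ?b ?K ?J) \<bullet> al ?L (?b \<boxdot> ?K) ?J"
      by (subst cmp_cong_left[OF sw_natural]) (simp_all add: interchange_cmp)
    also have "\<dots> = (idn ?b \<boxtimes> (mg L (merge K' J) \<bullet> (idn ?L \<boxtimes> mg K' J) \<bullet> al ?L ?K ?J))
        \<bullet> al ?b (?L \<boxdot> ?K) ?J \<bullet> (sw ?L ?b ?K \<boxtimes> idn ?J)"
      by (simp add: interchange_cmp flip: sw_al_mid)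
    also have "\<dots> = (idn ?b \<boxtimes> mg (merge L K') J) \<bullet> (idn ?b \<boxtimes> (mg L K' \<boxtimes> idn ?J)) \<bullet> al ?b (?L \<boxdot> ?K) ?J
        \<bullet> (sw ?L ?b ?K \<boxtimes> idn ?J)"
      using IH by (simp add: interchange_cmp)
    also have "\<dots> = (idn ?b \<boxtimes> mg (merge L K') J) \<bullet> al ?b (word (merge L K')) ?J
        \<bullet> ((idn ?b \<boxtimes> mg L K') \<boxtimes> idn ?J) \<bullet> (sw ?L ?b ?K \<boxtimes> idn ?J)"
      by (subst cmp_cong_left[OF al_natural]) simp_all
    also have "\<dots> = mg (merge L K) J \<bullet> (mg L K \<boxtimes> idn ?J)"
      using 5 by (simp add: mg_Cons_left mg_Cons_right merge_Cons_right interchange)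
    finally show ?thesis
      using 5 IH by (simp add: merge_Cons_left merge_Cons_right)
  next
    case (6 c J')
    let ?c = "Leaf c" and ?L = "word L" and ?K = "word K" and ?J = "word J'"
    have IH: "merge L (merge K J') = merge (merge L K) J' \<and>
       mg L (merge K J') \<bullet> (idn ?L \<boxtimes> mg K J') \<bullet> al ?L ?K ?J = mg (merge L K) J' \<bullet> (mg L K \<boxtimes> idn ?J)"
      using 6 less.prems by (intro less.hyps) auto
    have "mg L (merge K J) \<bullet> (idn ?L \<boxtimes> mg K J) \<bullet> al ?L ?K (word J)
      = (idn ?c \<boxtimes> mg L (merge K J')) \<bullet> sw ?L ?c (word (merge K J')) \<bullet> (idn ?L \<boxtimes> idn ?c \<boxtimes> mg K J')
        \<bullet> (idn ?L \<boxtimes> sw ?K ?c ?J) \<bullet> al ?L ?K (?c \<boxdot> ?J)"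
      using 6 by (simp add: mg_Cons_right merge_Cons_right interchange_cmp)
    also have "\<dots> = (idn ?c \<boxtimes> (mg L (merge K J') \<bullet> (idn ?L \<boxtimes> mg K J'))) \<bullet> sw ?L ?c (?K \<boxdot> ?J)
        \<bullet> (idn ?L \<boxtimes> sw ?K ?c ?J) \<bullet> al ?L ?K (?c \<boxdot> ?J)"
      by (subst cmp_cong_left[OF sw_natural]) (simp_all add: interchange_cmp)
    also have "\<dots> = (idn ?c \<boxtimes> (mg L (merge K J') \<bullet> (idn ?L \<boxtimes> mg K J') \<bullet> al ?L ?K ?J))
        \<bullet> sw (?L \<boxdot> ?K) ?c ?J"
      by (simp add: interchange_cmp flip: sw_al_right)
    also have "\<dots> = (idn ?c \<boxtimes> mg (merge L K) J') \<bullet> (idn ?c \<boxtimes> (mg L K \<boxtimes> idn ?J)) \<bullet> sw (?L \<boxdot> ?K) ?c ?J"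
      using IH by (simp add: interchange_cmp)
    also have "\<dots> = (idn ?c \<boxtimes> mg (merge L K) J') \<bullet> sw (word (merge L K)) ?c ?J
        \<bullet> (mg L K \<boxtimes> idn ?c \<boxtimes> idn ?J)"
      by (subst sw_natural) simp_all
    also have "\<dots> = mg (merge L K) J \<bullet> (mg L K \<boxtimes> idn (word J))"
      using 6 by (simp add: mg_Cons_right)
    finally show ?thesis
      using 6 IH by (simp add: merge_Cons_right)
  qed
qed

lemma sw_left_inverse: "sw b a c \<bullet> sw a b c = idn (a \<boxdot> b \<boxdot> c)"
  by (simp add: sw_def interchange_cmp)

text \<open>A left inverse is exactly what cancels the normalization arrow in
  \<open>coh_unique\<close>, and having one is stable under composition and tensor product.\<close>

definition "split_mono x \<longleftrightarrow> defd x \<and> (\<exists>w. w \<bullet> x = idn (src x))"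

lemma split_mono_cmp: "split_mono y \<Longrightarrow> split_mono x \<Longrightarrow> src y = tgt x \<Longrightarrow> split_mono (y \<bullet> x)"
proof -
  assume y: "split_mono y" and x: "split_mono x" and yx: "src y = tgt x"
  then obtain w w' where "w \<bullet> y = idn (src y)" "w' \<bullet> x = idn (src x)" by (auto simp: split_mono_def)
  then have "(w' \<bullet> w) \<bullet> (y \<bullet> x) = idn (src x)"
    using x y yx by (simp add: cmp_cong_left[of w y] split_mono_def)
  moreover have "defd (y \<bullet> x)" "src (y \<bullet> x) = src x"
    using x y yx by (simp_all add: split_mono_def)
  ultimately show ?thesis unfolding split_mono_def by metis
qed

lemma split_mono_ten: "split_mono y \<Longrightarrow> split_mono x \<Longrightarrow> split_mono (y \<boxtimes> x)"
  unfolding split_mono_def by (metis defd_ten interchange idn_ten src_ten)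

lemma split_mono_structure: "split_mono (idn a)" "split_mono (al a b c)" "split_mono (lam a)"
    "split_mono (rho a)" "split_mono (rho' a)" "split_mono (sw a b c)"
  unfolding split_mono_def using sw_left_inverse inverses cmp_idn[OF defd_structure(1)]
  by (metis defd_structure src_structure sw_structure)+

lemma split_mono_mg: "split_mono (mg L K)"
  by (induction L K rule: mg.induct)
   (auto intro!: split_mono_cmp split_mono_ten split_mono_structure)

section \<open>Normal forms of linear trees and uniqueness of coherent arrows\<close>

primrec leaves :: "tree \<Rightarrow> nat list" where
  "leaves (Leaf a) = [a]"
| "leaves One = []"
| "leaves (s \<boxdot> t) = merge (leaves s) (leaves t)"

primrec linear :: "tree \<Rightarrow> bool" where
  "linear (Leaf a) \<longleftrightarrow> True"
| "linear One \<longleftrightarrow> True"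
| "linear (s \<boxdot> t) \<longleftrightarrow> linear s \<and> linear t \<and> set (leaves s) \<inter> set (leaves t) = {}"

primrec nf :: "tree \<Rightarrow> 'm tarr" where
  "nf (Leaf a) = rho' (Leaf a)"
| "nf One = idn One"
| "nf (s \<boxdot> t) = mg (leaves s) (leaves t) \<bullet> (nf s \<boxtimes> nf t)"

lemma nf_structure [simp]: "defd (nf t) \<and> src (nf t) = t \<and> tgt (nf t) = word (leaves t)"
  by (induction t) simp_all

lemma split_mono_nf: "split_mono (nf t)"
  by (induction t) (auto intro!: split_mono_cmp split_mono_ten split_mono_structure split_mono_mg)

lemma increasing_leaves: "linear t \<Longrightarrow> increasing (leaves t)"
  by (induction t) (auto intro: increasing_merge)

text \<open>Commuting with normalization replaces an inductive class of structural arrows. The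
  closure lemmas below put every structural composite between linear trees into it, and
  \<open>coh_unique\<close> then makes every diagram of such composites commute.\<close>

definition "coh s t x \<longleftrightarrow>
  defd x \<and> src x = s \<and> tgt x = t \<and> leaves t = leaves s \<and> linear s \<and> linear t \<and> nf t \<bullet> x = nf s"

lemma coh_unique: "coh s t x \<Longrightarrow> coh s t y \<Longrightarrow> x = y"
  using split_mono_nf[of t] left_cancel[of "nf t" x y _ t] by (auto simp: coh_def split_mono_def)

lemma coh_idn: "linear a \<Longrightarrow> coh a a (idn a)"
  by (simp add: coh_def)

lemma coh_cmp: "coh s t x \<Longrightarrow> coh t u y \<Longrightarrow> coh s u (y \<bullet> x)"
  by (auto simp: coh_def cmp_cong_left)

lemma coh_ten: "coh s t x \<Longrightarrow> coh s' t' x' \<Longrightarrow> linear (s \<boxdot> s') \<Longrightarrow> coh (s \<boxdot> s') (t \<boxdot> t') (x \<boxtimes> x')"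
  by (auto simp: coh_def interchange)

text \<open>Naturality moves the three normalizations of the factors past the associator; what is
  left concerns words and is \<open>mg_assoc\<close>.\<close>

lemma coh_al: "linear ((a \<boxdot> b) \<boxdot> c) \<Longrightarrow> coh ((a \<boxdot> b) \<boxdot> c) (a \<boxdot> b \<boxdot> c) (al a b c)"
proof -
  assume *: "linear ((a \<boxdot> b) \<boxdot> c)"
  let ?a = "leaves a" and ?b = "leaves b" and ?c = "leaves c"
  have A: "merge ?a (merge ?b ?c) = merge (merge ?a ?b) ?c
    \<and> mg ?a (merge ?b ?c) \<bullet> (idn (word ?a) \<boxtimes> mg ?b ?c) \<bullet> al (word ?a) (word ?b) (word ?c)
      = mg (merge ?a ?b) ?c \<bullet> (mg ?a ?b \<boxtimes> idn (word ?c))"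
    using * by (intro mg_assoc) (auto intro: increasing_leaves)
  have "nf (a \<boxdot> b \<boxdot> c) \<bullet> al a b c
    = mg ?a (merge ?b ?c) \<bullet> (idn (word ?a) \<boxtimes> mg ?b ?c) \<bullet> (nf a \<boxtimes> nf b \<boxtimes> nf c) \<bullet> al a b c"
    by (simp add: interchange_cmp)
  also have "\<dots> = (mg ?a (merge ?b ?c) \<bullet> (idn (word ?a) \<boxtimes> mg ?b ?c)
      \<bullet> al (word ?a) (word ?b) (word ?c))
     \<bullet> ((nf a \<boxtimes> nf b) \<boxtimes> nf c)"
    by (simp add: al_natural)
  also have "\<dots> = nf ((a \<boxdot> b) \<boxdot> c)"
    using A by (simp add: interchange)
  finally show ?thesis using A * by (auto simp: coh_def)
qed

lemma coh_lam: "linear a \<Longrightarrow> coh (One \<boxdot> a) a (lam a)"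
  by (simp add: coh_def lam_natural)

lemma coh_rho: "linear a \<Longrightarrow> coh (a \<boxdot> One) a (rho a)"
  by (simp add: coh_def rho_natural)

lemma coh_sg: "linear (a \<boxdot> b) \<Longrightarrow> coh (a \<boxdot> b) (b \<boxdot> a) (sg a b)"
proof -
  assume *: "linear (a \<boxdot> b)"
  let ?a = "leaves a" and ?b = "leaves b"
  have E: "mg ?b ?a \<bullet> sg (word ?a) (word ?b) = mg ?a ?b"
    using * by (intro mg_sg) (auto intro: increasing_leaves)
  \<comment> \<open>Commutativity of \<open>merge\<close> on these lists comes for free: equal
    arrows have equal targets.\<close>
  have "word (merge ?b ?a) = word (merge ?a ?b)"
    using arg_cong[OF E, of tgt] by simp
  then have "merge ?b ?a = merge ?a ?b" by (rule word_inject)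
  moreover have "nf (b \<boxdot> a) \<bullet> sg a b = (mg ?b ?a \<bullet> sg (word ?a) (word ?b)) \<bullet> (nf a \<boxtimes> nf b)"
    by (simp add: sg_natural)
  ultimately show ?thesis using * E by (auto simp: coh_def)
qed

lemma coh_inverse: "coh s t x \<Longrightarrow> x \<bullet> y = idn t \<Longrightarrow> defd y \<Longrightarrow> src y = t \<Longrightarrow> tgt y = s \<Longrightarrow> coh t s y"
  by (auto simp: coh_def cmp_cong_left) (metis cmp_assoc cmp_idn nf_structure)

lemma coh_al': "linear (a \<boxdot> b \<boxdot> c) \<Longrightarrow> coh (a \<boxdot> b \<boxdot> c) ((a \<boxdot> b) \<boxdot> c) (al' a b c)"
  by (rule coh_inverse[OF coh_al inverses(1)]) auto

lemma coh_lam': "linear a \<Longrightarrow> coh a (One \<boxdot> a) (lam' a)"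
  by (rule coh_inverse[OF coh_lam inverses(3)]) simp_all

lemma coh_rho': "linear a \<Longrightarrow> coh a (a \<boxdot> One) (rho' a)"
  by (rule coh_inverse[OF coh_rho inverses(5)]) simp_all

section \<open>Coherence for arbitrary factors, by substitution into linear shapes\<close>

lemma labelled_subst: "labelled C (\<lambda>i. ev (\<theta> i))"
  by unfold_locales simp

text \<open>Hence one arrow of \<open>C\<close> has two formal readings: between linear shapes over
  the substituted labelling, where \<open>coh_unique\<close> applies, and between the substituted
  trees over the original labelling.\<close>

lemma ev_subst: "labelled.ev C (\<lambda>i. ev (\<theta> i)) p = ev (subst \<theta> p)"
proof -
  interpret S: labelled C "\<lambda>i. ev (\<theta> i)" by (rule labelled_subst)
  show ?thesis by (induction p) simp_all
qed

text \<open>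
  Coherence fails for repeated atoms (\<open>\<sigma>\<^bsub>a,a\<^esub>\<close> is not the identity), so a canonical arrow between
  arbitrary objects is presented by a shape with distinct atoms together with a substitution \<open>\<theta>\<close>.
\<close>

definition canon :: "(nat \<Rightarrow> tree) \<Rightarrow> tree \<Rightarrow> tree \<Rightarrow> 'm tarr \<Rightarrow> bool" where
  "canon \<theta> p q x \<longleftrightarrow> (\<exists>f y. lifts (subst \<theta> p) (subst \<theta> q) f x \<and>
     labelled.lifts C (\<lambda>i. ev (\<theta> i)) p q f y \<and> labelled.coh C (\<lambda>i. ev (\<theta> i)) p q y)"

lemma canon_unique: "canon \<theta> p q x \<Longrightarrow> canon \<theta> p q y \<Longrightarrow> x = y"
proof -
  interpret S: labelled C "\<lambda>i. ev (\<theta> i)" by (rule labelled_subst)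
  show "canon \<theta> p q x \<Longrightarrow> canon \<theta> p q y \<Longrightarrow> x = y"
    unfolding canon_def by (auto dest: S.coh_unique simp: lifts_def S.lifts_def)
qed

lemma canon_cmp: "canon \<theta> p q x \<Longrightarrow> canon \<theta> q r y \<Longrightarrow> canon \<theta> p r (y \<bullet> x)"
proof -
  interpret S: labelled C "\<lambda>i. ev (\<theta> i)" by (rule labelled_subst)
  show "canon \<theta> p q x \<Longrightarrow> canon \<theta> q r y \<Longrightarrow> canon \<theta> p r (y \<bullet> x)"
    unfolding canon_def by (blast intro: S.coh_cmp S.lifts_cmp lifts_cmp)
qed

lemma canon_ten:
  "canon \<theta> p q x \<Longrightarrow> canon \<theta> p' q' x' \<Longrightarrow> linear (p \<boxdot> p') \<Longrightarrow> canon \<theta> (p \<boxdot> p') (q \<boxdot> q') (x \<boxtimes> x')"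
proof -
  interpret S: labelled C "\<lambda>i. ev (\<theta> i)" by (rule labelled_subst)
  show "canon \<theta> p q x \<Longrightarrow> canon \<theta> p' q' x' \<Longrightarrow> linear (p \<boxdot> p') \<Longrightarrow> canon \<theta> (p \<boxdot> p') (q \<boxdot> q') (x \<boxtimes> x')"
    unfolding canon_def subst.simps by (blast intro: S.coh_ten S.lifts_ten lifts_ten)
qed

text \<open>Substitution instances enter as equational premises. Resolution can then propagate
  shapes from the given source through a composite, and the equations and linearity conditions are
  left to the simplifier.\<close>

lemma canon_structure:
  "subst \<theta> p = a \<Longrightarrow> linear p \<Longrightarrow> canon \<theta> p p (idn a)"
  "subst \<theta> p = a \<Longrightarrow> subst \<theta> q = b \<Longrightarrow> subst \<theta> r = c \<Longrightarrow> linear ((p \<boxdot> q) \<boxdot> r)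
    \<Longrightarrow> canon \<theta> ((p \<boxdot> q) \<boxdot> r) (p \<boxdot> q \<boxdot> r) (al a b c)"
  "subst \<theta> p = a \<Longrightarrow> subst \<theta> q = b \<Longrightarrow> subst \<theta> r = c \<Longrightarrow> linear (p \<boxdot> q \<boxdot> r)
    \<Longrightarrow> canon \<theta> (p \<boxdot> q \<boxdot> r) ((p \<boxdot> q) \<boxdot> r) (al' a b c)"
  "subst \<theta> p = a \<Longrightarrow> linear p \<Longrightarrow> canon \<theta> (One \<boxdot> p) p (lam a)"
  "subst \<theta> p = a \<Longrightarrow> linear p \<Longrightarrow> canon \<theta> p (One \<boxdot> p) (lam' a)"
  "subst \<theta> p = a \<Longrightarrow> linear p \<Longrightarrow> canon \<theta> (p \<boxdot> One) p (rho a)"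
  "subst \<theta> p = a \<Longrightarrow> linear p \<Longrightarrow> canon \<theta> p (p \<boxdot> One) (rho' a)"
  "subst \<theta> p = a \<Longrightarrow> subst \<theta> q = b \<Longrightarrow> linear (p \<boxdot> q) \<Longrightarrow> canon \<theta> (p \<boxdot> q) (q \<boxdot> p) (sg a b)"
proof -
  interpret S: labelled C "\<lambda>i. ev (\<theta> i)" by (rule labelled_subst)
  have I: "lifts (subst \<theta> p) (subst \<theta> q) f x \<Longrightarrow> S.lifts p q f y \<Longrightarrow> S.coh p q y \<Longrightarrow> canon \<theta> p q x"
    for p q f x y by (auto simp: canon_def)
  note L = lifts_structure and SL = S.lifts_structure[unfolded ev_subst]
  show "subst \<theta> p = a \<Longrightarrow> linear p \<Longrightarrow> canon \<theta> p p (idn a)"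
    by (rule I[OF _ SL(1) S.coh_idn]) (use L(1) in auto)
  show "subst \<theta> p = a \<Longrightarrow> subst \<theta> q = b \<Longrightarrow> subst \<theta> r = c \<Longrightarrow> linear ((p \<boxdot> q) \<boxdot> r)
    \<Longrightarrow> canon \<theta> ((p \<boxdot> q) \<boxdot> r) (p \<boxdot> q \<boxdot> r) (al a b c)"
    by (rule I[OF _ SL(2) S.coh_al]) (use L(2) in auto)
  show "subst \<theta> p = a \<Longrightarrow> subst \<theta> q = b \<Longrightarrow> subst \<theta> r = c \<Longrightarrow> linear (p \<boxdot> q \<boxdot> r)
    \<Longrightarrow> canon \<theta> (p \<boxdot> q \<boxdot> r) ((p \<boxdot> q) \<boxdot> r) (al' a b c)"
    by (rule I[OF _ SL(3) S.coh_al']) (use L(3) in auto)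
  show "subst \<theta> p = a \<Longrightarrow> linear p \<Longrightarrow> canon \<theta> (One \<boxdot> p) p (lam a)"
    by (rule I[OF _ SL(4) S.coh_lam]) (use L(4) in auto)
  show "subst \<theta> p = a \<Longrightarrow> linear p \<Longrightarrow> canon \<theta> p (One \<boxdot> p) (lam' a)"
    by (rule I[OF _ SL(5) S.coh_lam']) (use L(5) in auto)
  show "subst \<theta> p = a \<Longrightarrow> linear p \<Longrightarrow> canon \<theta> (p \<boxdot> One) p (rho a)"
    by (rule I[OF _ SL(6) S.coh_rho]) (use L(6) in auto)
  show "subst \<theta> p = a \<Longrightarrow> linear p \<Longrightarrow> canon \<theta> p (p \<boxdot> One) (rho' a)"
    by (rule I[OF _ SL(7) S.coh_rho']) (use L(7) in auto)
  show "subst \<theta> p = a \<Longrightarrow> subst \<theta> q = b \<Longrightarrow> linear (p \<boxdot> q) \<Longrightarrow> canon \<theta> (p \<boxdot> q) (q \<boxdot> p) (sg a b)"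
    by (rule I[OF _ SL(8) S.coh_sg]) (use L(8) in auto)
qed

section \<open>The exchange of middle factors and its coherence identities\<close>

definition "ms a b c d = al' a c (b \<boxdot> d) \<bullet> (idn a \<boxtimes> sw b c d) \<bullet> al a b (c \<boxdot> d)"

lemma ms_structure [simp]: "defd (ms a b c d)" "src (ms a b c d) = (a \<boxdot> b) \<boxdot> c \<boxdot> d"
    "tgt (ms a b c d) = (a \<boxdot> c) \<boxdot> b \<boxdot> d"
  by (simp_all add: ms_def)

lemma ms_natural:
  assumes "tgt x = a" "tgt y = b" "tgt z = c" "tgt w = d"
  shows "ms a b c d \<bullet> ((x \<boxtimes> y) \<boxtimes> (z \<boxtimes> w)) = ((x \<boxtimes> z) \<boxtimes> (y \<boxtimes> w))
      \<bullet> ms (src x) (src y) (src z) (src w)"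
proof (cases "defd x \<and> defd y \<and> defd z \<and> defd w")
  case True
  have "ms a b c d \<bullet> ((x \<boxtimes> y) \<boxtimes> (z \<boxtimes> w))
     = al' a c (b \<boxdot> d) \<bullet> (x \<boxtimes> (sw b c d \<bullet> (y \<boxtimes> z \<boxtimes> w))) \<bullet> al (src x) (src y) (src z \<boxdot> src w)"
    using assms True by (simp add: ms_def al_natural interchange_cmp)
  also have "\<dots> = al' a c (b \<boxdot> d) \<bullet> (x \<boxtimes> z \<boxtimes> y \<boxtimes> w) \<bullet> (idn (src x) \<boxtimes> sw (src y) (src z) (src w))
      \<bullet> al (src x) (src y) (src z \<boxdot> src w)"
    using assms True by (simp add: sw_natural interchange_cmp)
  also have "\<dots> = ((x \<boxtimes> z) \<boxtimes> (y \<boxtimes> w)) \<bullet> ms (src x) (src y) (src z) (src w)"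
    using assms True by (simp add: cmp_cong_left[OF al'_natural] ms_def)
  finally show ?thesis .
qed (auto simp: undefd)

lemma canon_ms:
  assumes "subst \<theta> p = a" "subst \<theta> q = b" "subst \<theta> r = c" "subst \<theta> s = d" "linear ((p \<boxdot> q) \<boxdot> r \<boxdot> s)"
  shows "canon \<theta> ((p \<boxdot> q) \<boxdot> r \<boxdot> s) ((p \<boxdot> r) \<boxdot> q \<boxdot> s) (ms a b c d)"
  unfolding ms_def sw_def
  by (rule canon_cmp canon_ten canon_structure | (use assms in \<open>auto; fail\<close>))+

lemmas canon_intros = canon_cmp canon_ten canon_structure canon_ms

text \<open>Associativity of the tensor product multiplication comes down to this diagram. As in the
  lemmas that follow, the proof only names linear shapes for source and target: the list gives the
  factors substituted for the leaves, both sides are canonical between the two shapes, and canonical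
  arrows are unique.\<close>

lemma ms_assoc:
  "(al a c e \<boxtimes> al b d f) \<bullet> ms (a \<boxdot> c) (b \<boxdot> d) e f \<bullet> (ms a b c d \<boxtimes> idn (e \<boxdot> f))
    = ms a b (c \<boxdot> e) (d \<boxdot> f) \<bullet> (idn (a \<boxdot> b) \<boxtimes> ms c d e f) \<bullet> al (a \<boxdot> b) (c \<boxdot> d) (e \<boxdot> f)"
  by (rule canon_unique[of "(!) [a, b, c, d, e, f]"
      "((Leaf 0 \<boxdot> Leaf 1) \<boxdot> (Leaf 2 \<boxdot> Leaf 3)) \<boxdot> (Leaf 4 \<boxdot> Leaf 5)"
      "(Leaf 0 \<boxdot> (Leaf 2 \<boxdot> Leaf 4)) \<boxdot> (Leaf 1 \<boxdot> (Leaf 3 \<boxdot> Leaf 5))"], (rule canon_intros |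
          (simp; fail))+)

lemma ms_coassoc:
  "al (a \<boxdot> d) (b \<boxdot> e) (c \<boxdot> f) \<bullet> (ms a b d e \<boxtimes> idn (c \<boxdot> f)) \<bullet> ms (a \<boxdot> b) c (d \<boxdot> e) f
    = (idn (a \<boxdot> d) \<boxtimes> ms b c e f) \<bullet> ms a (b \<boxdot> c) d (e \<boxdot> f) \<bullet> (al a b c \<boxtimes> al d e f)"
  by (rule canon_unique[of "(!) [a, b, c, d, e, f]"
      "((Leaf 0 \<boxdot> Leaf 1) \<boxdot> Leaf 2) \<boxdot> (Leaf 3 \<boxdot> Leaf 4) \<boxdot> Leaf 5"
      "(Leaf 0 \<boxdot> Leaf 3) \<boxdot> (Leaf 1 \<boxdot> Leaf 4) \<boxdot> (Leaf 2 \<boxdot> Leaf 5)"], (rule canon_intros |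
          (simp; fail))+)

lemma ms_lam: "(lam a \<boxtimes> lam b) \<bullet> ms One One a b \<bullet> (lam' One \<boxtimes> idn (a \<boxdot> b)) = lam (a \<boxdot> b)"
  by (rule canon_unique[of "(!) [a, b]" "One \<boxdot> Leaf 0 \<boxdot> Leaf 1"
      "Leaf 0 \<boxdot> Leaf 1"], (rule canon_intros | (simp; fail))+)

lemma ms_rho: "(rho a \<boxtimes> rho b) \<bullet> ms a b One One \<bullet> (idn (a \<boxdot> b) \<boxtimes> lam' One) = rho (a \<boxdot> b)"
  by (rule canon_unique[of "(!) [a, b]" "(Leaf 0 \<boxdot> Leaf 1) \<boxdot> One"
      "Leaf 0 \<boxdot> Leaf 1"], (rule canon_intros | (simp; fail))+)

lemma lam_ms: "lam (a \<boxdot> b) \<bullet> (lam One \<boxtimes> idn (a \<boxdot> b)) \<bullet> ms One a One b = lam a \<boxtimes> lam b"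
  by (rule canon_unique[of "(!) [a, b]" "(One \<boxdot> Leaf 0) \<boxdot> One \<boxdot> Leaf 1"
      "Leaf 0 \<boxdot> Leaf 1"], (rule canon_intros | (simp; fail))+)

lemma rho_ms: "rho (a \<boxdot> b) \<bullet> (idn (a \<boxdot> b) \<boxtimes> lam One) \<bullet> ms a One b One = rho a \<boxtimes> rho b"
  by (rule canon_unique[of "(!) [a, b]" "(Leaf 0 \<boxdot> One) \<boxdot> Leaf 1 \<boxdot> One"
      "Leaf 0 \<boxdot> Leaf 1"], (rule canon_intros | (simp; fail))+)

text \<open>The structural content of the compatibility of multiplication and comultiplication on a
  tensor product: exchanging eight factors in two different orders.\<close>

lemma ms_interchange:
  "ms (a \<boxdot> c) (b \<boxdot> d) (a' \<boxdot> c') (b' \<boxdot> d') \<bullet> (ms a b c d \<boxtimes> ms a' b' c' d')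
      \<bullet> ms (a \<boxdot> b) (a' \<boxdot> b') (c \<boxdot> d) (c' \<boxdot> d')
   = (ms a a' c c' \<boxtimes> ms b b' d d') \<bullet> ms (a \<boxdot> a') (b \<boxdot> b') (c \<boxdot> c') (d \<boxdot> d')
      \<bullet> (ms a b a' b' \<boxtimes> ms c d c' d')"
  by (rule canon_unique[of "(!) [a, b, a', b', c, d, c', d']"
     "((Leaf 0 \<boxdot> Leaf 1) \<boxdot> Leaf 2 \<boxdot> Leaf 3) \<boxdot> (Leaf 4 \<boxdot> Leaf 5) \<boxdot> Leaf 6 \<boxdot> Leaf 7"
     "((Leaf 0 \<boxdot> Leaf 4) \<boxdot> Leaf 2 \<boxdot> Leaf 6) \<boxdot> (Leaf 1 \<boxdot> Leaf 5) \<boxdot> Leaf 3 \<boxdot> Leaf 7"], (rule canon_intros | (simp; fail))+)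

lemma ms_One: "ms One One One One = idn ((One \<boxdot> One) \<boxdot> One \<boxdot> One)"
  by (rule canon_unique[of "(!) []" "(One \<boxdot> One) \<boxdot> One \<boxdot> One"
      "(One \<boxdot> One) \<boxdot> One \<boxdot> One"], (rule canon_intros | (simp; fail))+)

lemma sg_One: "sg One One = idn (One \<boxdot> One)"
  by (rule canon_unique[of "(!) []" "One \<boxdot> One" "One \<boxdot> One"], (rule canon_intros | (simp; fail))+)

lemma sg_ms: "sg (a \<boxdot> c) (b \<boxdot> d) \<bullet> ms a b c d = ms b a d c \<bullet> (sg a b \<boxtimes> sg c d)"
  by (rule canon_unique[of "(!) [a, b, c, d]" "(Leaf 0 \<boxdot> Leaf 1) \<boxdot> Leaf 2 \<boxdot> Leaf 3"
    "(Leaf 1 \<boxdot> Leaf 3) \<boxdot> Leaf 0 \<boxdot> Leaf 2"], (rule canon_intros | (simp; fail))+)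

text \<open>Units in the two middle places make the exchange invisible, whereas units in the outer
  places leave the bare braiding (\<open>ms_outer_One\<close>). This contrast is what produces the
  two sides of (i).\<close>

lemma ms_middle_One: "(rho a \<boxtimes> lam b) \<bullet> ms a One One b = rho a \<boxtimes> lam b"
  by (rule canon_unique[of "(!) [a, b]" "(Leaf 0 \<boxdot> One) \<boxdot> One \<boxdot> Leaf 1"
      "Leaf 0 \<boxdot> Leaf 1"], (rule canon_intros | (simp; fail))+)

lemma ms_outer_One: "(lam a \<boxtimes> rho b) \<bullet> ms One b a One \<bullet> (lam' b \<boxtimes> rho' a) = sg b a"
  by (rule canon_unique[of "(!) [a, b]" "Leaf 1 \<boxdot> Leaf 0" "Leaf 0 \<boxdot> Leaf 1"], (rule canon_intros |
      (simp; fail))+)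

section \<open>Bialgebras of formal arrows\<close>

text \<open>
  The formal arrows as a symmetric monoidal category, so that the notions defined for \<open>C\<close> apply
  to them.
\<close>

definition D :: "(tree, 'm tarr) smc" where
  "D = \<lparr>Ob = UNIV, Hom = (\<lambda>s t. {x. defd x \<and> src x = s \<and> tgt x = t}), Id = idn, Comp = cmp,
     TensorOb = Node, Tensor = ten, UnitOb = One, Assoc = al, LUnit = lam, RUnit = rho, Braid = sg\<rparr>"

lemma D_simps [simp]:
  "Ob D = UNIV" "x \<in> Hom D s t \<longleftrightarrow> defd x \<and> src x = s \<and> tgt x = t" "Id D = idn" "Comp D = cmp"
  "TensorOb D = Node" "Tensor D = ten" "UnitOb D = One" "Assoc D = al" "LUnit D = lam"
  "RUnit D = rho" "Braid D = sg"
  by (simp_all add: D_def)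

text \<open>In \<open>D\<close> the inverses of structural arrows are given by a definite
  description; this identifies them with the tagged inverses coming from \<open>C\<close>.\<close>

lemma inverse_of_D:
  assumes "defd x" "defd y" "src y = tgt x" "tgt y = src x"
    "y \<bullet> x = idn (src x)" "x \<bullet> y = idn (tgt x)"
  shows "inverse_of D (src x) (tgt x) x = y"
  unfolding inverse_of_def
proof (rule the_equality)
  show "inverse_arrows D (src x) (tgt x) x y" using assms by (simp add: inverse_arrows_def)
  fix z assume z: "inverse_arrows D (src x) (tgt x) x z"
  show "z = y" by (rule left_cancel[OF _ assms(5)])
      (use z assms in \<open>simp_all add: inverse_arrows_def\<close>)
qed

lemma inverses_D [simp]: "assoc_inv D a b c = al' a b c" "lunit_inv D a = lam' a" "runit_inv D a
    = rho' a"
  using inverse_of_D[of "al a b c" "al' a b c"] inverse_of_D[of "lam a" "lam' a"]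
    inverse_of_D[of "rho a" "rho' a"]
  by (simp_all add: assoc_inv_def lunit_inv_def runit_inv_def)

lemma middle_swap_D [simp]: "middle_swap D a b c d = ms a b c d"
  by (simp add: middle_swap_def ms_def sw_def)

lemma tensor_structure_D [simp]:
  "tensor_mult D a m b n = (m \<boxtimes> n) \<bullet> ms a b a b"
  "tensor_unit D u w = (u \<boxtimes> w) \<bullet> lam' One"
  "tensor_comult D a d b e = ms a a b b \<bullet> (d \<boxtimes> e)"
  "tensor_counit D k l = lam One \<bullet> (k \<boxtimes> l)"
  by (simp_all add: tensor_mult_def tensor_unit_def tensor_comult_def tensor_counit_def)

section \<open>Tensor products of algebras, coalgebras and bialgebras\<close>

lemma algebra_D: "algebra D a m u \<longleftrightarrow>
   defd m \<and> src m = a \<boxdot> a \<and> tgt m = a \<and> defd u \<and> src u = One \<and> tgt u = a \<and>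
   m \<bullet> (m \<boxtimes> idn a) = m \<bullet> (idn a \<boxtimes> m) \<bullet> al a a a \<and> m \<bullet> (u \<boxtimes> idn a) = lam a \<and> m \<bullet> (idn a \<boxtimes> u) = rho a"
  by (auto simp: algebra_def)

lemma coalgebra_D: "coalgebra D a d e \<longleftrightarrow>
   defd d \<and> src d = a \<and> tgt d = a \<boxdot> a \<and> defd e \<and> src e = a \<and> tgt e = One \<and>
   al a a a \<bullet> (d \<boxtimes> idn a) \<bullet> d = (idn a \<boxtimes> d) \<bullet> d \<and>
   lam a \<bullet> (e \<boxtimes> idn a) \<bullet> d = idn a \<and> rho a \<bullet> (idn a \<boxtimes> e) \<bullet> d = idn a"
  by (auto simp: coalgebra_def)

lemma algebra_morphism_D: "algebra_morphism D a m u b n w f \<longleftrightarrow>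
   defd f \<and> src f = a \<and> tgt f = b \<and> f \<bullet> m = n \<bullet> (f \<boxtimes> f) \<and> f \<bullet> u = w"
  by (auto simp: algebra_morphism_def)

lemma coalgebra_morphism_D: "coalgebra_morphism D a d k b e l f \<longleftrightarrow>
   defd f \<and> src f = a \<and> tgt f = b \<and> e \<bullet> f = (f \<boxtimes> f) \<bullet> d \<and> l \<bullet> f = k"
  by (auto simp: coalgebra_morphism_def)

text \<open>Naturality of \<open>ms\<close> separates the two multiplications from the structural
  arrows. The laws of the factors then apply side by side, and \<open>ms_assoc\<close>,
  \<open>ms_lam\<close> and \<open>ms_rho\<close> settle the rest.\<close>

lemma algebra_tensor:
  assumes "algebra D a m u" "algebra D b n w"
  shows "algebra D (a \<boxdot> b) (tensor_mult D a m b n) (tensor_unit D u w)"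
proof -
  have [simp]: "defd m" "src m = a \<boxdot> a" "tgt m = a" "defd u" "src u = One" "tgt u = a"
    "defd n" "src n = b \<boxdot> b" "tgt n = b" "defd w" "src w = One" "tgt w = b"
    using assms by (auto simp: algebra_D)
  have mn: "m \<bullet> (m \<boxtimes> idn a) = m \<bullet> (idn a \<boxtimes> m) \<bullet> al a a a" "n \<bullet> (n \<boxtimes> idn b) = n \<bullet> (idn b \<boxtimes> n)
      \<bullet> al b b b"
    "m \<bullet> (u \<boxtimes> idn a) = lam a" "m \<bullet> (idn a \<boxtimes> u) = rho a"
    "n \<bullet> (w \<boxtimes> idn b) = lam b" "n \<bullet> (idn b \<boxtimes> w) = rho b"
    using assms by (auto simp: algebra_D)
  let ?M = "(m \<boxtimes> n) \<bullet> ms a b a b" and ?u = "(u \<boxtimes> w) \<bullet> lam' One"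
  have "?M \<bullet> (?M \<boxtimes> idn (a \<boxdot> b))
     = (m \<boxtimes> n) \<bullet> ms a b a b \<bullet> ((m \<boxtimes> n) \<boxtimes> idn (a \<boxdot> b)) \<bullet> (ms a b a b \<boxtimes> idn (a \<boxdot> b))"
    by (simp add: interchange)
  also have "\<dots> = (m \<boxtimes> n) \<bullet> ((m \<boxtimes> idn a) \<boxtimes> (n \<boxtimes> idn b)) \<bullet> ms (a \<boxdot> a) (b \<boxdot> b) a b
      \<bullet> (ms a b a b \<boxtimes> idn (a \<boxdot> b))"
    using cmp_cong_left[OF ms_natural[of m a n b "idn a" a "idn b" b]] by simp
  also have "\<dots> = ((m \<bullet> (idn a \<boxtimes> m)) \<boxtimes> (n \<bullet> (idn b \<boxtimes> n))) \<bullet> (al a a a \<boxtimes> al b b b)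
      \<bullet> ms (a \<boxdot> a) (b \<boxdot> b) a b \<bullet> (ms a b a b \<boxtimes> idn (a \<boxdot> b))"
    by (simp add: interchange_cmp mn)
  also have "\<dots> = (m \<boxtimes> n) \<bullet> ((idn a \<boxtimes> m) \<boxtimes> (idn b \<boxtimes> n)) \<bullet> ms a b (a \<boxdot> a) (b \<boxdot> b)
      \<bullet> (idn (a \<boxdot> b) \<boxtimes> ms a b a b) \<bullet> al (a \<boxdot> b) (a \<boxdot> b) (a \<boxdot> b)"
    by (simp add: ms_assoc interchange_cmp)
  also have "\<dots> = (m \<boxtimes> n) \<bullet> ms a b a b \<bullet> (idn (a \<boxdot> b) \<boxtimes> (m \<boxtimes> n)) \<bullet> (idn (a \<boxdot> b) \<boxtimes> ms a b a b)
      \<bullet> al (a \<boxdot> b) (a \<boxdot> b) (a \<boxdot> b)"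
    using cmp_cong_left[OF ms_natural[of "idn a" a "idn b" b m a n b]] by simp
  also have "\<dots> = ?M \<bullet> (idn (a \<boxdot> b) \<boxtimes> ?M) \<bullet> al (a \<boxdot> b) (a \<boxdot> b) (a \<boxdot> b)"
    by (simp add: interchange_cmp)
  finally have 1: "?M \<bullet> (?M \<boxtimes> idn (a \<boxdot> b)) = ?M \<bullet> (idn (a \<boxdot> b) \<boxtimes> ?M) \<bullet> al (a \<boxdot> b) (a \<boxdot> b) (a \<boxdot> b)" .
  have "?M \<bullet> (?u \<boxtimes> idn (a \<boxdot> b)) = (m \<boxtimes> n) \<bullet> ms a b a b \<bullet> ((u \<boxtimes> w) \<boxtimes> idn (a \<boxdot> b))
      \<bullet> (lam' One \<boxtimes> idn (a \<boxdot> b))"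
    by (simp add: interchange)
  also have "\<dots> = (m \<boxtimes> n) \<bullet> ((u \<boxtimes> idn a) \<boxtimes> (w \<boxtimes> idn b)) \<bullet> ms One One a b \<bullet> (lam' One \<boxtimes> idn (a \<boxdot> b))"
    using cmp_cong_left[OF ms_natural[of u a w b "idn a" a "idn b" b]] by simp
  also have "\<dots> = lam (a \<boxdot> b)"
    by (simp add: interchange_cmp mn ms_lam)
  finally have 2: "?M \<bullet> (?u \<boxtimes> idn (a \<boxdot> b)) = lam (a \<boxdot> b)" .
  have "?M \<bullet> (idn (a \<boxdot> b) \<boxtimes> ?u) = (m \<boxtimes> n) \<bullet> ms a b a b \<bullet> (idn (a \<boxdot> b) \<boxtimes> (u \<boxtimes> w))
      \<bullet> (idn (a \<boxdot> b) \<boxtimes> lam' One)"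
    by (simp add: interchange)
  also have "\<dots> = (m \<boxtimes> n) \<bullet> ((idn a \<boxtimes> u) \<boxtimes> (idn b \<boxtimes> w)) \<bullet> ms a b One One \<bullet> (idn (a \<boxdot> b) \<boxtimes> lam' One)"
    using cmp_cong_left[OF ms_natural[of "idn a" a "idn b" b u a w b]] by simp
  also have "\<dots> = rho (a \<boxdot> b)"
    by (simp add: interchange_cmp mn ms_rho)
  finally have 3: "?M \<bullet> (idn (a \<boxdot> b) \<boxtimes> ?u) = rho (a \<boxdot> b)" .
  from 1 2 3 show ?thesis by (simp add: algebra_D)
qed

lemma coalgebra_tensor:
  assumes "coalgebra D a d k" "coalgebra D b e l"
  shows "coalgebra D (a \<boxdot> b) (tensor_comult D a d b e) (tensor_counit D k l)"
proof -
  have [simp]: "defd d" "src d = a" "tgt d = a \<boxdot> a" "defd k" "src k = a" "tgt k = One"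
    "defd e" "src e = b" "tgt e = b \<boxdot> b" "defd l" "src l = b" "tgt l = One"
    using assms by (auto simp: coalgebra_D)
  have de: "al a a a \<bullet> (d \<boxtimes> idn a) \<bullet> d = (idn a \<boxtimes> d) \<bullet> d" "al b b b \<bullet> (e \<boxtimes> idn b) \<bullet> e = (idn b \<boxtimes> e)
      \<bullet> e"
    "lam a \<bullet> (k \<boxtimes> idn a) \<bullet> d = idn a" "rho a \<bullet> (idn a \<boxtimes> k) \<bullet> d = idn a"
    "lam b \<bullet> (l \<boxtimes> idn b) \<bullet> e = idn b" "rho b \<bullet> (idn b \<boxtimes> l) \<bullet> e = idn b"
    using assms by (auto simp: coalgebra_D)
  let ?d = "ms a a b b \<bullet> (d \<boxtimes> e)" and ?k = "lam One \<bullet> (k \<boxtimes> l)" and ?i = "idn (a \<boxdot> b)" and ?al =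
      "al (a \<boxdot> b) (a \<boxdot> b) (a \<boxdot> b)"
  have "?al \<bullet> (?d \<boxtimes> ?i) \<bullet> ?d = ?al \<bullet> (ms a a b b \<boxtimes> ?i) \<bullet> ((d \<boxtimes> e) \<boxtimes> ?i) \<bullet> ms a a b b \<bullet> (d \<boxtimes> e)"
    by (simp add: interchange_cmp)
  also have "\<dots> = ?al \<bullet> (ms a a b b \<boxtimes> ?i) \<bullet> ms (a \<boxdot> a) a (b \<boxdot> b) b \<bullet> ((d \<boxtimes> idn a) \<boxtimes> (e \<boxtimes> idn b))
      \<bullet> (d \<boxtimes> e)"
    using cmp_cong_left[OF ms_natural[of d "a \<boxdot> a" "idn a" a e "b \<boxdot> b" "idn b" b]] by simp
  also have "\<dots> = (?i \<boxtimes> ms a a b b) \<bullet> ms a (a \<boxdot> a) b (b \<boxdot> b) \<bullet> (al a a a \<boxtimes> al b b b)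
      \<bullet> ((d \<boxtimes> idn a) \<boxtimes> (e \<boxtimes> idn b)) \<bullet> (d \<boxtimes> e)"
    using arg_cong[OF ms_coassoc[of a b a b a b], of "\<lambda>x. x \<bullet> ((d \<boxtimes> idn a) \<boxtimes> (e \<boxtimes> idn b))
        \<bullet> (d \<boxtimes> e)"] by simp
  also have "\<dots> = (?i \<boxtimes> ms a a b b) \<bullet> ms a (a \<boxdot> a) b (b \<boxdot> b) \<bullet> ((idn a \<boxtimes> d) \<boxtimes> (idn b \<boxtimes> e)) \<bullet> (d \<boxtimes> e)"
    by (simp add: interchange de)
  also have "\<dots> = (?i \<boxtimes> ms a a b b) \<bullet> (?i \<boxtimes> (d \<boxtimes> e)) \<bullet> ms a a b b \<bullet> (d \<boxtimes> e)"
    using cmp_cong_left[OF ms_natural[of "idn a" a d "a \<boxdot> a" "idn b" b e "b \<boxdot> b"]] by simp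
  also have "\<dots> = (?i \<boxtimes> ?d) \<bullet> ?d" by (simp add: interchange_cmp)
  finally have 1: "?al \<bullet> (?d \<boxtimes> ?i) \<bullet> ?d = (?i \<boxtimes> ?d) \<bullet> ?d" .
  have "lam (a \<boxdot> b) \<bullet> (?k \<boxtimes> ?i) \<bullet> ?d = lam (a \<boxdot> b) \<bullet> (lam One \<boxtimes> ?i) \<bullet> ((k \<boxtimes> l) \<boxtimes> ?i) \<bullet> ms a a b b
      \<bullet> (d \<boxtimes> e)"
    by (simp add: interchange_cmp)
  also have "\<dots> = lam (a \<boxdot> b) \<bullet> (lam One \<boxtimes> ?i) \<bullet> ms One a One b \<bullet> ((k \<boxtimes> idn a) \<boxtimes> (l \<boxtimes> idn b))
      \<bullet> (d \<boxtimes> e)"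
    using cmp_cong_left[OF ms_natural[of k One "idn a" a l One "idn b" b]] by simp
  also have "\<dots> = (lam a \<boxtimes> lam b) \<bullet> ((k \<boxtimes> idn a) \<boxtimes> (l \<boxtimes> idn b)) \<bullet> (d \<boxtimes> e)"
    by (simp flip: lam_ms)
  also have "\<dots> = ?i" by (simp add: interchange de)
  finally have 2: "lam (a \<boxdot> b) \<bullet> (?k \<boxtimes> ?i) \<bullet> ?d = ?i" .
  have "rho (a \<boxdot> b) \<bullet> (?i \<boxtimes> ?k) \<bullet> ?d = rho (a \<boxdot> b) \<bullet> (?i \<boxtimes> lam One) \<bullet> (?i \<boxtimes> (k \<boxtimes> l)) \<bullet> ms a a b b
      \<bullet> (d \<boxtimes> e)"
    by (simp add: interchange_cmp)
  also have "\<dots> = rho (a \<boxdot> b) \<bullet> (?i \<boxtimes> lam One) \<bullet> ms a One b One \<bullet> ((idn a \<boxtimes> k) \<boxtimes> (idn b \<boxtimes> l))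
      \<bullet> (d \<boxtimes> e)"
    using cmp_cong_left[OF ms_natural[of "idn a" a k One "idn b" b l One]] by simp
  also have "\<dots> = (rho a \<boxtimes> rho b) \<bullet> ((idn a \<boxtimes> k) \<boxtimes> (idn b \<boxtimes> l)) \<bullet> (d \<boxtimes> e)"
    by (simp flip: rho_ms)
  also have "\<dots> = ?i" by (simp add: interchange de)
  finally have 3: "rho (a \<boxdot> b) \<bullet> (?i \<boxtimes> ?k) \<bullet> ?d = ?i" .
  from 1 2 3 show ?thesis by (simp add: coalgebra_D)
qed

lemma bialgebra_D: "bialgebra D A \<longleftrightarrow> algebra D (Car A) (mult A) (unt A)
    \<and> coalgebra D (Car A) (comult A) (counit A) \<and>
   comult A \<bullet> mult A = (mult A \<boxtimes> mult A) \<bullet> ms (Car A) (Car A) (Car A) (Car A)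
       \<bullet> (comult A \<boxtimes> comult A) \<and>
   comult A \<bullet> unt A = (unt A \<boxtimes> unt A) \<bullet> lam' One \<and>
   counit A \<bullet> mult A = lam One \<bullet> (counit A \<boxtimes> counit A) \<and> counit A \<bullet> unt A = idn One"
  by (auto simp: bialgebra_def algebra_D coalgebra_D algebra_morphism_D)

lemma typing_bialgebra:
  assumes "bialgebra D A"
  shows "defd (mult A)" "src (mult A) = Car A \<boxdot> Car A" "tgt (mult A) = Car A"
    "defd (unt A)" "src (unt A) = One" "tgt (unt A) = Car A"
    "defd (comult A)" "src (comult A) = Car A" "tgt (comult A) = Car A \<boxdot> Car A"
    "defd (counit A)" "src (counit A) = Car A" "tgt (counit A) = One"
  using assms by (simp_all add: bialgebra_D algebra_D coalgebra_D)

lemma tensor_bialgebra_simps [simp]: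
  "Car (tensor_bialgebra D A B) = Car A \<boxdot> Car B"
  "mult (tensor_bialgebra D A B) = (mult A \<boxtimes> mult B) \<bullet> ms (Car A) (Car B) (Car A) (Car B)"
  "unt (tensor_bialgebra D A B) = (unt A \<boxtimes> unt B) \<bullet> lam' One"
  "comult (tensor_bialgebra D A B) = ms (Car A) (Car A) (Car B) (Car B) \<bullet> (comult A \<boxtimes> comult B)"
  "counit (tensor_bialgebra D A B) = lam One \<bullet> (counit A \<boxtimes> counit B)"
  by (simp_all add: tensor_bialgebra_def)

text \<open>Naturality carries the multiplications to the left end and the comultiplications to the
  right end; the arrows left between them agree by \<open>ms_interchange\<close>.\<close>

lemma bialgebra_tensor:
  assumes "bialgebra D A" "bialgebra D B"
  shows "bialgebra D (tensor_bialgebra D A B)"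
proof -
  note [simp] = typing_bialgebra[OF assms(1)] typing_bialgebra[OF assms(2)]
  define a b m n u w d e k l where defs: "a = Car A" "b = Car B" "m = mult A" "n = mult B" "u
      = unt A"
    "w = unt B" "d = comult A" "e = comult B" "k = counit A" "l = counit B"
  have [simp]: "defd m" "src m = a \<boxdot> a" "tgt m = a" "defd u" "src u = One" "tgt u = a"
    "defd n" "src n = b \<boxdot> b" "tgt n = b" "defd w" "src w = One" "tgt w = b"
    "defd d" "src d = a" "tgt d = a \<boxdot> a" "defd k" "src k = a" "tgt k = One"
    "defd e" "src e = b" "tgt e = b \<boxdot> b" "defd l" "src l = b" "tgt l = One"
    by (simp_all add: defs)
  have E: "d \<bullet> m = (m \<boxtimes> m) \<bullet> ms a a a a \<bullet> (d \<boxtimes> d)" "e \<bullet> n = (n \<boxtimes> n) \<bullet> ms b b b b \<bullet> (e \<boxtimes> e)"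
    "d \<bullet> u = (u \<boxtimes> u) \<bullet> lam' One" "e \<bullet> w = (w \<boxtimes> w) \<bullet> lam' One"
    "k \<bullet> m = lam One \<bullet> (k \<boxtimes> k)" "k \<bullet> u = idn One" "l \<bullet> n = lam One \<bullet> (l \<boxtimes> l)" "l \<bullet> w = idn One"
    using assms by (simp_all add: bialgebra_D defs)
  let ?M = "(m \<boxtimes> n) \<bullet> ms a b a b" and ?D = "ms a a b b \<bullet> (d \<boxtimes> e)"
    and ?u = "(u \<boxtimes> w) \<bullet> lam' One" and ?k = "lam One \<bullet> (k \<boxtimes> l)"
  have "?D \<bullet> ?M = ms a a b b \<bullet> ((m \<boxtimes> m) \<boxtimes> (n \<boxtimes> n)) \<bullet> (ms a a a a \<boxtimes> ms b b b b) \<bullet> ((d \<boxtimes> d) \<boxtimes> (e \<boxtimes> e))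
      \<bullet> ms a b a b"
    by (simp add: interchange_cmp E)
  also have "\<dots> = ((m \<boxtimes> n) \<boxtimes> (m \<boxtimes> n)) \<bullet> ms (a \<boxdot> a) (a \<boxdot> a) (b \<boxdot> b) (b \<boxdot> b)
      \<bullet> (ms a a a a \<boxtimes> ms b b b b) \<bullet> ((d \<boxtimes> d) \<boxtimes> (e \<boxtimes> e)) \<bullet> ms a b a b"
    by (subst cmp_cong_left[OF ms_natural]) simp_all
  also have "((d \<boxtimes> d) \<boxtimes> (e \<boxtimes> e)) \<bullet> ms a b a b = ms (a \<boxdot> a) (b \<boxdot> b) (a \<boxdot> a) (b \<boxdot> b)
      \<bullet> ((d \<boxtimes> e) \<boxtimes> (d \<boxtimes> e))"
    by (subst ms_natural) simp_all
  also have "((m \<boxtimes> n) \<boxtimes> (m \<boxtimes> n)) \<bullet> ms (a \<boxdot> a) (a \<boxdot> a) (b \<boxdot> b) (b \<boxdot> b) \<bullet> (ms a a a a \<boxtimes> ms b b b b)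
      \<bullet> \<dots>
    = ((m \<boxtimes> n) \<boxtimes> (m \<boxtimes> n)) \<bullet> (ms a b a b \<boxtimes> ms a b a b) \<bullet> ms (a \<boxdot> b) (a \<boxdot> b) (a \<boxdot> b) (a \<boxdot> b)
        \<bullet> (ms a a b b \<boxtimes> ms a a b b) \<bullet> ((d \<boxtimes> e) \<boxtimes> (d \<boxtimes> e))"
    using arg_cong[OF ms_interchange[of a a a a b b b b], of "\<lambda>x. x \<bullet> ((d \<boxtimes> e) \<boxtimes> (d \<boxtimes> e))"] by simp
  also have "\<dots> = (?M \<boxtimes> ?M) \<bullet> ms (a \<boxdot> b) (a \<boxdot> b) (a \<boxdot> b) (a \<boxdot> b) \<bullet> (?D \<boxtimes> ?D)"
    by (simp add: interchange interchange_cmp)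
  finally have 1: "?D \<bullet> ?M = (?M \<boxtimes> ?M) \<bullet> ms (a \<boxdot> b) (a \<boxdot> b) (a \<boxdot> b) (a \<boxdot> b) \<bullet> (?D \<boxtimes> ?D)" .
  have "?D \<bullet> (u \<boxtimes> w) \<bullet> lam' One = ms a a b b \<bullet> ((u \<boxtimes> u) \<boxtimes> (w \<boxtimes> w)) \<bullet> (lam' One \<boxtimes> lam' One)
      \<bullet> lam' One"
    by (simp add: interchange_cmp E)
  also have "\<dots> = ((u \<boxtimes> w) \<boxtimes> (u \<boxtimes> w)) \<bullet> (lam' One \<boxtimes> lam' One) \<bullet> lam' One"
    \<comment> \<open>After the units have passed the exchange, it acts on four copies of
      \<open>One\<close> and is the identity by \<open>ms_One\<close>.\<close>
    by (subst cmp_cong_left[OF ms_natural]) (simp_all add: ms_One)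
  finally have 2: "?D \<bullet> ?u = (?u \<boxtimes> ?u) \<bullet> lam' One" by (simp add: interchange_cmp)
  have "lam One \<bullet> (k \<boxtimes> l) \<bullet> ?M = lam One \<bullet> (lam One \<boxtimes> lam One) \<bullet> ((k \<boxtimes> k) \<boxtimes> (l \<boxtimes> l)) \<bullet> ms a b a b"
    by (simp add: interchange_cmp E)
  also have "\<dots> = lam One \<bullet> (lam One \<boxtimes> lam One) \<bullet> ms One One One One \<bullet> ((k \<boxtimes> l) \<boxtimes> (k \<boxtimes> l))"
    by (subst ms_natural) simp_all
  finally have 3: "?k \<bullet> ?M = lam One \<bullet> (?k \<boxtimes> ?k)"
    by (simp add: ms_One interchange)
  have 4: "?k \<bullet> ?u = idn One"
    by (simp add: interchange_cmp E)
  show ?thesis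
    using 1 2 3 4 algebra_tensor[of a m u b n w] coalgebra_tensor[of a d k b e l] assms
    by (simp add: bialgebra_D defs)
qed

lemma cocommutative_tensor:
  assumes "bialgebra D A" "bialgebra D B" "cocommutative D A" "cocommutative D B"
  shows "cocommutative D (tensor_bialgebra D A B)"
  using assms typing_bialgebra[OF assms(1)] typing_bialgebra[OF assms(2)]
  by (simp add: cocommutative_def interchange cmp_cong_left[OF sg_ms])

section \<open>The unit bialgebra and the calculus of bialgebra morphisms\<close>

definition "unit_bialg = \<lparr>Car = One, mult = lam One, unt = idn One, comult = lam' One, counit
    = idn One\<rparr>"

lemma unit_bialg_simps [simp]: "Car unit_bialg = One" "mult unit_bialg = lam One" "unt unit_bialg
    = idn One"
    "comult unit_bialg = lam' One" "counit unit_bialg = idn One"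
  by (simp_all add: unit_bialg_def)

lemma bialgebra_unit: "bialgebra D unit_bialg"
proof -
  have "lam One \<bullet> (lam One \<boxtimes> idn One) = lam One \<bullet> (idn One \<boxtimes> lam One) \<bullet> al One One One"
    by (simp add: triangle_tree) (simp add: lam_One)
  moreover have "al One One One \<bullet> (lam' One \<boxtimes> idn One) \<bullet> lam' One = (idn One \<boxtimes> lam' One) \<bullet> lam' One"
    by (rule canon_unique[of "(!) []" One "One \<boxdot> One \<boxdot> One"], (rule canon_intros | (simp; fail))+)
  moreover have "lam' One \<bullet> lam One = (lam One \<boxtimes> lam One) \<bullet> (lam' One \<boxtimes> lam' One)"
    by (simp add: interchange)
  moreover have "rho One \<bullet> lam' One = idn One"
    by (simp flip: lam_One)
  ultimately show ?thesis
    by (simp add: bialgebra_D algebra_D coalgebra_D ms_One lam_One)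
qed

lemma cocommutative_unit: "cocommutative D unit_bialg"
  by (simp add: cocommutative_def sg_One)

lemma bialgebra_morphism_D: "bialgebra_morphism D A B f \<longleftrightarrow> defd f \<and> src f = Car A \<and> tgt f = Car B \<and>
   f \<bullet> mult A = mult B \<bullet> (f \<boxtimes> f) \<and> f \<bullet> unt A = unt B \<and>
   comult B \<bullet> f = (f \<boxtimes> f) \<bullet> comult A \<and> counit B \<bullet> f = counit A"
  by (auto simp: bialgebra_morphism_def algebra_morphism_D coalgebra_morphism_D)

lemma morphism_cmp:
  assumes "bialgebra_morphism D A B f" "bialgebra_morphism D B E g"
  shows "bialgebra_morphism D A E (g \<bullet> f)"
proof -
  have [simp]: "defd f" "src f = Car A" "tgt f = Car B" "defd g" "src g = Car B" "tgt g = Car E"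
    and F: "f \<bullet> mult A = mult B \<bullet> (f \<boxtimes> f)" "f \<bullet> unt A = unt B" "comult B \<bullet> f = (f \<boxtimes> f) \<bullet> comult A"
    and G: "g \<bullet> mult B = mult E \<bullet> (g \<boxtimes> g)" "g \<bullet> unt B = unt E"
      "comult E \<bullet> g = (g \<boxtimes> g) \<bullet> comult B" "counit E \<bullet> g = counit B" "counit B \<bullet> f = counit A"
    using assms by (simp_all add: bialgebra_morphism_D)
  show ?thesis
    by (simp add: bialgebra_morphism_D F G G[THEN cmp_cong_left] interchange interchange_cmp)
qed

lemma morphism_idn: "bialgebra D A \<Longrightarrow> bialgebra_morphism D A A (idn (Car A))"
  using typing_bialgebra[of A] by (simp add: bialgebra_morphism_D)

text \<open>Makes \<open>rho'\<close> and \<open>lam'\<close> morphisms of bialgebras, from the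
  corresponding facts on \<open>rho\<close> and \<open>lam\<close>.\<close>

lemma morphism_inverse:
  assumes "bialgebra D A" "bialgebra D B" "bialgebra_morphism D A B f" "defd g" "src g = Car B"
      "tgt g = Car A"
    "g \<bullet> f = idn (Car A)" "f \<bullet> g = idn (Car B)"
  shows "bialgebra_morphism D B A g"
proof -
  note [simp] = typing_bialgebra[OF assms(1)] typing_bialgebra[OF assms(2)] assms(4-6)
  have f [simp]: "defd f" "src f = Car A" "tgt f = Car B"
    and E: "f \<bullet> mult A = mult B \<bullet> (f \<boxtimes> f)" "f \<bullet> unt A = unt B"
      "comult B \<bullet> f = (f \<boxtimes> f) \<bullet> comult A" "counit B \<bullet> f = counit A"
    using assms by (simp_all add: bialgebra_morphism_D)
  note I = assms(7,8)
  have "g \<bullet> mult B = g \<bullet> mult B \<bullet> (f \<boxtimes> f) \<bullet> (g \<boxtimes> g)" by (simp add: interchange I)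
  also have "\<dots> = (g \<bullet> f) \<bullet> mult A \<bullet> (g \<boxtimes> g)"
    using cmp_cong_left[OF E(1)] by simp
  finally have 1: "g \<bullet> mult B = mult A \<bullet> (g \<boxtimes> g)" by (simp add: I del: cmp_assoc)
  have "g \<bullet> unt B = (g \<bullet> f) \<bullet> unt A" by (simp add: E)
  then have 2: "g \<bullet> unt B = unt A" by (simp add: I del: cmp_assoc)
  have "comult A \<bullet> g = (g \<boxtimes> g) \<bullet> (f \<boxtimes> f) \<bullet> comult A \<bullet> g" by (simp add: interchange_cmp I)
  also have "\<dots> = (g \<boxtimes> g) \<bullet> comult B \<bullet> f \<bullet> g" using cmp_cong_left[OF E(3)] by simp
  finally have 3: "comult A \<bullet> g = (g \<boxtimes> g) \<bullet> comult B" by (simp add: I)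
  have "counit A \<bullet> g = counit B \<bullet> f \<bullet> g" using cmp_cong_left[OF E(4)] by simp
  then have "counit A \<bullet> g = counit B" by (simp add: I)
  with 1 2 3 show ?thesis by (simp add: bialgebra_morphism_D)
qed

lemma morphism_ten:
  assumes "bialgebra D A" "bialgebra D A'" "bialgebra D B" "bialgebra D B'"
    and "bialgebra_morphism D A A' f" "bialgebra_morphism D B B' g"
  shows "bialgebra_morphism D (tensor_bialgebra D A B) (tensor_bialgebra D A' B') (f \<boxtimes> g)"
proof -
  note [simp] = assms(1-4)[THEN typing_bialgebra(1)] assms(1-4)[THEN typing_bialgebra(2)]
    assms(1-4)[THEN typing_bialgebra(3)] assms(1-4)[THEN typing_bialgebra(4)]
    assms(1-4)[THEN typing_bialgebra(5)] assms(1-4)[THEN typing_bialgebra(6)]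
    assms(1-4)[THEN typing_bialgebra(7)] assms(1-4)[THEN typing_bialgebra(8)]
    assms(1-4)[THEN typing_bialgebra(9)] assms(1-4)[THEN typing_bialgebra(10)]
    assms(1-4)[THEN typing_bialgebra(11)] assms(1-4)[THEN typing_bialgebra(12)]
  have [simp]: "defd f" "src f = Car A" "tgt f = Car A'" "defd g" "src g = Car B" "tgt g = Car B'"
    using assms(5,6) by (simp_all add: bialgebra_morphism_D)
  have F: "f \<bullet> mult A = mult A' \<bullet> (f \<boxtimes> f)" "f \<bullet> unt A = unt A'"
      "(f \<boxtimes> f) \<bullet> comult A = comult A' \<bullet> f" "counit A' \<bullet> f = counit A"
    and G: "g \<bullet> mult B = mult B' \<bullet> (g \<boxtimes> g)" "g \<bullet> unt B = unt B'"
      "(g \<boxtimes> g) \<bullet> comult B = comult B' \<bullet> g" "counit B' \<bullet> g = counit B"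
    using assms(5,6) by (simp_all add: bialgebra_morphism_D)
  let ?a = "Car A" and ?a' = "Car A'" and ?b = "Car B" and ?b' = "Car B'"
  have "(f \<boxtimes> g) \<bullet> (mult A \<boxtimes> mult B) \<bullet> ms ?a ?b ?a ?b
      = (mult A' \<boxtimes> mult B') \<bullet> ((f \<boxtimes> f) \<boxtimes> (g \<boxtimes> g)) \<bullet> ms ?a ?b ?a ?b"
    by (simp add: interchange_cmp F G)
  also have "\<dots> = (mult A' \<boxtimes> mult B') \<bullet> ms ?a' ?b' ?a' ?b' \<bullet> ((f \<boxtimes> g) \<boxtimes> (f \<boxtimes> g))"
    by (subst ms_natural) simp_all
  finally have 1: "(f \<boxtimes> g) \<bullet> (mult A \<boxtimes> mult B) \<bullet> ms ?a ?b ?a ?b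
      = (mult A' \<boxtimes> mult B') \<bullet> ms ?a' ?b' ?a' ?b' \<bullet> ((f \<boxtimes> g) \<boxtimes> (f \<boxtimes> g))" .
  have "((f \<boxtimes> g) \<boxtimes> (f \<boxtimes> g)) \<bullet> ms ?a ?a ?b ?b \<bullet> (comult A \<boxtimes> comult B)
      = ms ?a' ?a' ?b' ?b' \<bullet> ((f \<boxtimes> f) \<boxtimes> (g \<boxtimes> g)) \<bullet> (comult A \<boxtimes> comult B)"
    by (subst cmp_cong_left[OF ms_natural]) simp_all
  also have "\<dots> = ms ?a' ?a' ?b' ?b' \<bullet> (comult A' \<boxtimes> comult B') \<bullet> (f \<boxtimes> g)"
    by (simp add: interchange F G)
  finally have 2: "((f \<boxtimes> g) \<boxtimes> (f \<boxtimes> g)) \<bullet> ms ?a ?a ?b ?b \<bullet> (comult A \<boxtimes> comult B)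
     = ms ?a' ?a' ?b' ?b' \<bullet> (comult A' \<boxtimes> comult B') \<bullet> (f \<boxtimes> g)" .
  have "(f \<boxtimes> g) \<bullet> (unt A \<boxtimes> unt B) \<bullet> lam' One = (unt A' \<boxtimes> unt B') \<bullet> lam' One"
    "lam One \<bullet> (counit A' \<boxtimes> counit B') \<bullet> (f \<boxtimes> g) = lam One \<bullet> (counit A \<boxtimes> counit B)"
    by (simp_all add: interchange interchange_cmp F G)
  with 1 2 show ?thesis by (simp add: bialgebra_morphism_D)
qed

lemma morphism_rho:
  assumes "bialgebra D A"
  shows "bialgebra_morphism D (tensor_bialgebra D A unit_bialg) A (rho (Car A))"
proof -
  note [simp] = typing_bialgebra[OF assms(1)]
  let ?a = "Car A"
  have "rho ?a \<bullet> (mult A \<boxtimes> lam One) \<bullet> ms ?a One ?a One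
     = rho ?a \<bullet> (mult A \<boxtimes> idn One) \<bullet> (idn (?a \<boxdot> ?a) \<boxtimes> lam One) \<bullet> ms ?a One ?a One"
    by (simp add: interchange_cmp)
  also have "\<dots> = mult A \<bullet> rho (?a \<boxdot> ?a) \<bullet> (idn (?a \<boxdot> ?a) \<boxtimes> lam One) \<bullet> ms ?a One ?a One"
    by (subst cmp_cong_left[OF rho_natural]) simp_all
  finally have 1: "rho ?a \<bullet> (mult A \<boxtimes> lam One) \<bullet> ms ?a One ?a One = mult A \<bullet> (rho ?a \<boxtimes> rho ?a)"
    by (simp add: rho_ms)
  have "rho ?a \<bullet> (unt A \<boxtimes> idn One) \<bullet> lam' One = unt A \<bullet> rho One \<bullet> lam' One"
    by (subst cmp_cong_left[OF rho_natural]) simp_all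
  then have 2: "rho ?a \<bullet> (unt A \<boxtimes> idn One) \<bullet> lam' One = unt A"
    by (simp flip: lam_One)
  have "(rho ?a \<boxtimes> rho ?a) \<bullet> ms ?a ?a One One \<bullet> (comult A \<boxtimes> lam' One)
     = (rho ?a \<boxtimes> rho ?a) \<bullet> ms ?a ?a One One \<bullet> (idn (?a \<boxdot> ?a) \<boxtimes> lam' One) \<bullet> (comult A \<boxtimes> idn One)"
    by (simp add: interchange)
  also have "\<dots> = rho (?a \<boxdot> ?a) \<bullet> (comult A \<boxtimes> idn One)"
    by (simp flip: ms_rho)
  also have "\<dots> = comult A \<bullet> rho ?a"
    by (subst rho_natural) simp_all
  finally have 3: "(rho ?a \<boxtimes> rho ?a) \<bullet> ms ?a ?a One One \<bullet> (comult A \<boxtimes> lam' One) = comult A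
      \<bullet> rho ?a" .
  have "lam One \<bullet> (counit A \<boxtimes> idn One) = counit A \<bullet> rho ?a"
    unfolding lam_One by (subst rho_natural) simp_all
  with 1 2 3 show ?thesis by (simp add: bialgebra_morphism_D)
qed

lemma morphism_lam:
  assumes "bialgebra D A"
  shows "bialgebra_morphism D (tensor_bialgebra D unit_bialg A) A (lam (Car A))"
proof -
  note [simp] = typing_bialgebra[OF assms(1)]
  let ?a = "Car A"
  have "lam ?a \<bullet> (lam One \<boxtimes> mult A) \<bullet> ms One ?a One ?a
     = lam ?a \<bullet> (idn One \<boxtimes> mult A) \<bullet> (lam One \<boxtimes> idn (?a \<boxdot> ?a)) \<bullet> ms One ?a One ?a"
    by (simp add: interchange_cmp)
  also have "\<dots> = mult A \<bullet> lam (?a \<boxdot> ?a) \<bullet> (lam One \<boxtimes> idn (?a \<boxdot> ?a)) \<bullet> ms One ?a One ?a"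
    by (subst cmp_cong_left[OF lam_natural]) simp_all
  finally have 1: "lam ?a \<bullet> (lam One \<boxtimes> mult A) \<bullet> ms One ?a One ?a = mult A \<bullet> (lam ?a \<boxtimes> lam ?a)"
    by (simp add: lam_ms)
  have 2: "lam ?a \<bullet> (idn One \<boxtimes> unt A) \<bullet> lam' One = unt A"
    by (subst cmp_cong_left[OF lam_natural]) simp_all
  have "(lam ?a \<boxtimes> lam ?a) \<bullet> ms One One ?a ?a \<bullet> (lam' One \<boxtimes> comult A)
     = (lam ?a \<boxtimes> lam ?a) \<bullet> ms One One ?a ?a \<bullet> (lam' One \<boxtimes> idn (?a \<boxdot> ?a)) \<bullet> (idn One \<boxtimes> comult A)"
    by (simp add: interchange)
  also have "\<dots> = lam (?a \<boxdot> ?a) \<bullet> (idn One \<boxtimes> comult A)"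
    by (simp flip: ms_lam)
  also have "\<dots> = comult A \<bullet> lam ?a"
    by (subst lam_natural) simp_all
  finally have 3: "(lam ?a \<boxtimes> lam ?a) \<bullet> ms One One ?a ?a \<bullet> (lam' One \<boxtimes> comult A) = comult A
      \<bullet> lam ?a" .
  have "lam One \<bullet> (idn One \<boxtimes> counit A) = counit A \<bullet> lam ?a"
    by (subst lam_natural) simp_all
  with 1 2 3 show ?thesis by (simp add: bialgebra_morphism_D)
qed

text \<open>Being an algebra morphism is part of the bialgebra axioms. Compatibility with
  comultiplication is the counit law, with one of the two counits slid past \<open>lam\<close> by
  naturality.\<close>

lemma morphism_counit:
  assumes "bialgebra D A"
  shows "bialgebra_morphism D A unit_bialg (counit A)"
proof -
  note [simp] = typing_bialgebra[OF assms(1)]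
  have "lam One \<bullet> (counit A \<boxtimes> counit A) \<bullet> comult A = lam One \<bullet> (idn One \<boxtimes> counit A)
      \<bullet> (counit A \<boxtimes> idn (Car A)) \<bullet> comult A"
    by (simp add: interchange_cmp)
  also have "\<dots> = counit A \<bullet> lam (Car A) \<bullet> (counit A \<boxtimes> idn (Car A)) \<bullet> comult A"
    by (subst cmp_cong_left[OF lam_natural]) simp_all
  also have "\<dots> = counit A"
    using assms by (simp add: bialgebra_D coalgebra_D)
  finally have "lam One \<bullet> (counit A \<boxtimes> counit A) \<bullet> comult A = lam One \<bullet> lam' One \<bullet> counit A" by simp
  then have "lam' One \<bullet> counit A = (counit A \<boxtimes> counit A) \<bullet> comult A"
    by - (rule left_cancel[OF _ inverses(4)[of One]], simp_all)
  then show ?thesis using assms by (simp add: bialgebra_D bialgebra_morphism_D)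
qed

lemma morphism_unt:
  assumes "bialgebra D A"
  shows "bialgebra_morphism D unit_bialg A (unt A)"
proof -
  note [simp] = typing_bialgebra[OF assms(1)]
  have "mult A \<bullet> (unt A \<boxtimes> unt A) = mult A \<bullet> (unt A \<boxtimes> idn (Car A)) \<bullet> (idn One \<boxtimes> unt A)"
    by (simp add: interchange)
  also have "\<dots> = lam (Car A) \<bullet> (idn One \<boxtimes> unt A)"
    using assms cmp_cong_left[of "mult A" "unt A \<boxtimes> idn (Car A)"] by
        (simp add: bialgebra_D algebra_D)
  also have "\<dots> = unt A \<bullet> lam One"
    by (subst lam_natural) simp_all
  finally show ?thesis using assms by (simp add: bialgebra_D bialgebra_morphism_D)
qed

text \<open>The point at which cocommutativity is used. Iterating \<Delta> gives four copies, and
  \<open>ms\<close> exchanges the second with the third; by coassociativity these two may be taken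
  to come from a single \<Delta>, and then \<sigma> \<cdot> \<Delta> = \<Delta> absorbs the
  exchange.\<close>

lemma morphism_comult:
  assumes "bialgebra D A" "cocommutative D A"
  shows "bialgebra_morphism D A (tensor_bialgebra D A A) (comult A)"
proof -
  note [simp] = typing_bialgebra[OF assms(1)]
  let ?a = "Car A" and ?d = "comult A"
  have E: "al ?a ?a ?a \<bullet> (?d \<boxtimes> idn ?a) \<bullet> ?d = (idn ?a \<boxtimes> ?d) \<bullet> ?d" "sg ?a ?a \<bullet> ?d = ?d"
    using assms by (auto simp: bialgebra_D coalgebra_D cocommutative_def)
  have E': "al' ?a ?a ?a \<bullet> (idn ?a \<boxtimes> ?d) \<bullet> ?d = (?d \<boxtimes> idn ?a) \<bullet> ?d"
    by (simp flip: E(1))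
  have "al ?a ?a (?a \<boxdot> ?a) \<bullet> (?d \<boxtimes> ?d) \<bullet> ?d
      = al ?a ?a (?a \<boxdot> ?a) \<bullet> ((idn ?a \<boxtimes> idn ?a) \<boxtimes> ?d) \<bullet> (?d \<boxtimes> idn ?a) \<bullet> ?d"
    by (simp add: interchange_cmp)
  also have "\<dots> = (idn ?a \<boxtimes> idn ?a \<boxtimes> ?d) \<bullet> al ?a ?a ?a \<bullet> (?d \<boxtimes> idn ?a) \<bullet> ?d"
    by (subst cmp_cong_left[OF al_natural]) simp_all
  also have "\<dots> = (idn ?a \<boxtimes> ((idn ?a \<boxtimes> ?d) \<bullet> ?d)) \<bullet> ?d"
    by (simp add: E interchange_cmp)
  \<comment> \<open>The right-nested form of the fourfold comultiplication; \<open>G\<close> below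
    acts on its inner part, and \<open>F\<close> read backwards restores the balanced form.\<close>
  finally have F: "al ?a ?a (?a \<boxdot> ?a) \<bullet> (?d \<boxtimes> ?d) \<bullet> ?d = (idn ?a \<boxtimes> ((idn ?a \<boxtimes> ?d) \<bullet> ?d)) \<bullet> ?d" .
  have "sw ?a ?a ?a \<bullet> (idn ?a \<boxtimes> ?d) \<bullet> ?d = al ?a ?a ?a \<bullet> ((sg ?a ?a \<bullet> ?d) \<boxtimes> idn ?a) \<bullet> ?d"
    by (simp add: sw_def E' interchange_cmp)
  then have G: "sw ?a ?a ?a \<bullet> (idn ?a \<boxtimes> ?d) \<bullet> ?d = (idn ?a \<boxtimes> ?d) \<bullet> ?d"
    by (simp add: E)
  have "ms ?a ?a ?a ?a \<bullet> (?d \<boxtimes> ?d) \<bullet> ?d = al' ?a ?a (?a \<boxdot> ?a) \<bullet> (idn ?a \<boxtimes> (sw ?a ?a ?a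
      \<bullet> (idn ?a \<boxtimes> ?d) \<bullet> ?d)) \<bullet> ?d"
    by (simp add: ms_def F interchange_cmp)
  also have "\<dots> = al' ?a ?a (?a \<boxdot> ?a) \<bullet> al ?a ?a (?a \<boxdot> ?a) \<bullet> (?d \<boxtimes> ?d) \<bullet> ?d"
    by (simp only: G F)
  finally have 1: "ms ?a ?a ?a ?a \<bullet> (?d \<boxtimes> ?d) \<bullet> ?d = (?d \<boxtimes> ?d) \<bullet> ?d" by simp
  have H: "lam' One \<bullet> counit A = (counit A \<boxtimes> counit A) \<bullet> ?d"
    using morphism_counit[OF assms(1)] by (simp add: bialgebra_morphism_D)
  have "counit A = lam One \<bullet> (counit A \<boxtimes> counit A) \<bullet> ?d"
    by (simp flip: H)
  with 1 show ?thesis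
    using assms by (simp add: bialgebra_morphism_D bialgebra_D)
qed

section \<open>The tensor product as categorical product\<close>

lemma tensor_injections_D [simp]:
  "tensor_inl D X Y = (idn (Car X) \<boxtimes> unt Y) \<bullet> rho' (Car X)"
  "tensor_inr D X Y = (unt X \<boxtimes> idn (Car Y)) \<bullet> lam' (Car Y)"
  by (simp_all add: tensor_inl_def tensor_inr_def)

definition "pr1 X Y = rho (Car X) \<bullet> (idn (Car X) \<boxtimes> counit Y)"
definition "pr2 X Y = lam (Car Y) \<bullet> (counit X \<boxtimes> idn (Car Y))"

text \<open>The axioms need not be checked again: each injection is an inverse unit isomorphism
  followed by a tensor product of morphisms that were treated before.\<close>

lemma morphism_injections:
  assumes X: "bialgebra D X" and Y: "bialgebra D Y"
  shows "bialgebra_morphism D X (tensor_bialgebra D X Y) (tensor_inl D X Y)"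
    "bialgebra_morphism D Y (tensor_bialgebra D X Y) (tensor_inr D X Y)"
proof -
  note I = bialgebra_unit
  have "bialgebra_morphism D X (tensor_bialgebra D X unit_bialg) (rho' (Car X))"
    by (rule morphism_inverse[OF bialgebra_tensor[OF X I] X morphism_rho[OF X]]) simp_all
  then show "bialgebra_morphism D X (tensor_bialgebra D X Y) (tensor_inl D X Y)"
    unfolding tensor_injections_D
    by (rule morphism_cmp[OF _ morphism_ten[OF X X I Y morphism_idn[OF X] morphism_unt[OF Y]]])
  have "bialgebra_morphism D Y (tensor_bialgebra D unit_bialg Y) (lam' (Car Y))"
    by (rule morphism_inverse[OF bialgebra_tensor[OF I Y] Y morphism_lam[OF Y]]) simp_all
  then show "bialgebra_morphism D Y (tensor_bialgebra D X Y) (tensor_inr D X Y)"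
    unfolding tensor_injections_D
    by (rule morphism_cmp[OF _ morphism_ten[OF I X Y Y morphism_unt[OF X] morphism_idn[OF Y]]])
qed

lemma morphism_projections:
  assumes X: "bialgebra D X" and Y: "bialgebra D Y"
  shows "bialgebra_morphism D (tensor_bialgebra D X Y) X (pr1 X Y)"
    "bialgebra_morphism D (tensor_bialgebra D X Y) Y (pr2 X Y)"
  unfolding pr1_def pr2_def
  by (rule morphism_cmp[OF morphism_ten[OF X X Y bialgebra_unit morphism_idn[OF X] morphism_counit[OF Y]] morphism_rho[OF X]],
      rule morphism_cmp[OF morphism_ten[OF X bialgebra_unit Y Y morphism_counit[OF X] morphism_idn[OF Y]] morphism_lam[OF Y]])

lemma projection_injection:
  assumes X: "bialgebra D X" and Y: "bialgebra D Y"
  shows "pr1 X Y \<bullet> tensor_inl D X Y = idn (Car X)" "pr2 X Y \<bullet> tensor_inl D X Y = unt Y \<bullet> counit X"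
    "pr1 X Y \<bullet> tensor_inr D X Y = unt X \<bullet> counit Y" "pr2 X Y \<bullet> tensor_inr D X Y = idn (Car Y)"
proof -
  note [simp] = typing_bialgebra[OF X] typing_bialgebra[OF Y]
  have E: "counit X \<bullet> unt X = idn One" "counit Y \<bullet> unt Y = idn One"
    using X Y by (simp_all add: bialgebra_D)
  show "pr1 X Y \<bullet> tensor_inl D X Y = idn (Car X)" "pr2 X Y \<bullet> tensor_inr D X Y = idn (Car Y)"
    by (simp_all add: pr1_def pr2_def interchange_cmp E)
  have "pr2 X Y \<bullet> tensor_inl D X Y = lam (Car Y) \<bullet> (idn One \<boxtimes> unt Y) \<bullet> (counit X \<boxtimes> idn One)
      \<bullet> rho' (Car X)"
    by (simp add: pr2_def interchange_cmp)
  also have "\<dots> = unt Y \<bullet> lam One \<bullet> (counit X \<boxtimes> idn One) \<bullet> rho' (Car X)"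
    by (subst cmp_cong_left[OF lam_natural]) simp_all
  also have "\<dots> = unt Y \<bullet> counit X \<bullet> rho (Car X) \<bullet> rho' (Car X)"
    unfolding lam_One by (subst cmp_cong_left[OF rho_natural]) simp_all
  finally show "pr2 X Y \<bullet> tensor_inl D X Y = unt Y \<bullet> counit X" by simp
  have "pr1 X Y \<bullet> tensor_inr D X Y = rho (Car X) \<bullet> (unt X \<boxtimes> idn One) \<bullet> (idn One \<boxtimes> counit Y)
      \<bullet> lam' (Car Y)"
    by (simp add: pr1_def interchange_cmp)
  also have "\<dots> = unt X \<bullet> lam One \<bullet> (idn One \<boxtimes> counit Y) \<bullet> lam' (Car Y)"
    unfolding lam_One by (subst cmp_cong_left[OF rho_natural]) simp_all
  also have "\<dots> = unt X \<bullet> counit Y \<bullet> lam (Car Y) \<bullet> lam' (Car Y)"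
    by (subst cmp_cong_left[OF lam_natural]) simp_all
  finally show "pr1 X Y \<bullet> tensor_inr D X Y = unt X \<bullet> counit Y" by simp
qed

text \<open>The pairing is a composite of morphisms because \<open>comult T\<close> is one. Its
  components come from the counit law of \<open>T\<close>, as f and g preserve counits.\<close>

lemma pairing:
  assumes T: "bialgebra D T" "cocommutative D T" and X: "bialgebra D X" and Y: "bialgebra D Y"
    and f: "bialgebra_morphism D T X f" and g: "bialgebra_morphism D T Y g"
  shows "bialgebra_morphism D T (tensor_bialgebra D X Y) ((f \<boxtimes> g) \<bullet> comult T)"
    "pr1 X Y \<bullet> (f \<boxtimes> g) \<bullet> comult T = f" "pr2 X Y \<bullet> (f \<boxtimes> g) \<bullet> comult T = g"
proof -
  note [simp] = typing_bialgebra[OF T(1)] typing_bialgebra[OF X] typing_bialgebra[OF Y]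
  show "bialgebra_morphism D T (tensor_bialgebra D X Y) ((f \<boxtimes> g) \<bullet> comult T)"
    by (rule morphism_cmp[OF morphism_comult[OF T] morphism_ten[OF T(1) X T(1) Y f g]])
  have [simp]: "defd f" "src f = Car T" "tgt f = Car X" "defd g" "src g = Car T" "tgt g = Car Y"
    and E: "counit X \<bullet> f = counit T" "counit Y \<bullet> g = counit T"
    using f g by (simp_all add: bialgebra_morphism_D)
  have U: "lam (Car T) \<bullet> (counit T \<boxtimes> idn (Car T)) \<bullet> comult T = idn (Car T)"
     "rho (Car T) \<bullet> (idn (Car T) \<boxtimes> counit T) \<bullet> comult T = idn (Car T)"
    using T by (simp_all add: bialgebra_D coalgebra_D)
  have "pr1 X Y \<bullet> (f \<boxtimes> g) \<bullet> comult T = rho (Car X) \<bullet> (f \<boxtimes> idn One) \<bullet> (idn (Car T) \<boxtimes> counit T)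
      \<bullet> comult T"
    by (simp add: pr1_def interchange_cmp E)
  also have "\<dots> = f \<bullet> rho (Car T) \<bullet> (idn (Car T) \<boxtimes> counit T) \<bullet> comult T"
    by (subst cmp_cong_left[OF rho_natural]) simp_all
  finally show "pr1 X Y \<bullet> (f \<boxtimes> g) \<bullet> comult T = f" by (simp add: U)
  have "pr2 X Y \<bullet> (f \<boxtimes> g) \<bullet> comult T = lam (Car Y) \<bullet> (idn One \<boxtimes> g) \<bullet> (counit T \<boxtimes> idn (Car T))
      \<bullet> comult T"
    by (simp add: pr2_def interchange_cmp E)
  also have "\<dots> = g \<bullet> lam (Car T) \<bullet> (counit T \<boxtimes> idn (Car T)) \<bullet> comult T"
    by (subst cmp_cong_left[OF lam_natural]) simp_all
  finally show "pr2 X Y \<bullet> (f \<boxtimes> g) \<bullet> comult T = g" by (simp add: U)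
qed

text \<open>Uniqueness of the pairing: h commutes with comultiplication, so it suffices that the two
  projections, applied after the comultiplication of the product, give the identity.\<close>

lemma pairing_projections:
  assumes X: "bialgebra D X" and Y: "bialgebra D Y"
    and h: "bialgebra_morphism D T (tensor_bialgebra D X Y) h"
  shows "((pr1 X Y \<bullet> h) \<boxtimes> (pr2 X Y \<bullet> h)) \<bullet> comult T = h"
proof -
  note [simp] = typing_bialgebra[OF X] typing_bialgebra[OF Y]
  let ?x = "Car X" and ?y = "Car Y" and ?P = "tensor_bialgebra D X Y"
  have [simp]: "defd h" "src h = Car T" "tgt h = ?x \<boxdot> ?y"
    and E: "(h \<boxtimes> h) \<bullet> comult T = comult ?P \<bullet> h"
    using h by (simp_all add: bialgebra_morphism_D)
  have U: "lam ?y \<bullet> (counit Y \<boxtimes> idn ?y) \<bullet> comult Y = idn ?y"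
     "rho ?x \<bullet> (idn ?x \<boxtimes> counit X) \<bullet> comult X = idn ?x"
    using X Y by (simp_all add: bialgebra_D coalgebra_D)
  have [simp]: "defd (pr1 X Y)" "src (pr1 X Y) = ?x \<boxdot> ?y" "defd (pr2 X Y)" "src (pr2 X Y) = ?x \<boxdot> ?y"
    by (simp_all add: pr1_def pr2_def)
  have "(pr1 X Y \<boxtimes> pr2 X Y) \<bullet> comult ?P
     = (rho ?x \<boxtimes> lam ?y) \<bullet> ((idn ?x \<boxtimes> counit Y) \<boxtimes> (counit X \<boxtimes> idn ?y)) \<bullet> ms ?x ?x ?y ?y
         \<bullet> (comult X \<boxtimes> comult Y)"
    by (simp add: pr1_def pr2_def interchange_cmp)
  also have "\<dots> = ((rho ?x \<boxtimes> lam ?y) \<bullet> ms ?x One One ?y)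
      \<bullet> ((idn ?x \<boxtimes> counit X) \<boxtimes> (counit Y \<boxtimes> idn ?y)) \<bullet> (comult X \<boxtimes> comult Y)"
    \<comment> \<open>The counits are moved through the exchange, which afterwards has units in its
      middle places and drops out by \<open>ms_middle_One\<close>.\<close>
    by (simp add: cmp_cong_left[OF ms_natural])
  also have "\<dots> = idn (?x \<boxdot> ?y)"
    unfolding ms_middle_One by (simp add: interchange U)
  finally have F: "(pr1 X Y \<boxtimes> pr2 X Y) \<bullet> comult ?P = idn (?x \<boxdot> ?y)" .
  have "((pr1 X Y \<bullet> h) \<boxtimes> (pr2 X Y \<bullet> h)) \<bullet> comult T = (pr1 X Y \<boxtimes> pr2 X Y) \<bullet> (h \<boxtimes> h) \<bullet> comult T"
    by (simp add: interchange_cmp)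
  also have "\<dots> = h"
    unfolding E by (simp only: cmp_cong_left[OF F]) simp
  finally show ?thesis .
qed

section \<open>Cooperators and the commutation condition\<close>

lemma mult_injections:
  assumes X: "bialgebra D X" and Y: "bialgebra D Y"
  shows "mult (tensor_bialgebra D X Y) \<bullet> (tensor_inl D X Y \<boxtimes> tensor_inr D X Y)
      = idn (Car X \<boxdot> Car Y)"
    "mult (tensor_bialgebra D X Y) \<bullet> (tensor_inr D X Y \<boxtimes> tensor_inl D X Y) = sg (Car Y) (Car X)"
proof -
  note [simp] = typing_bialgebra[OF X] typing_bialgebra[OF Y]
  let ?x = "Car X" and ?y = "Car Y" and ?P = "tensor_bialgebra D X Y"
  have U: "mult X \<bullet> (idn ?x \<boxtimes> unt X) = rho ?x" "mult Y \<bullet> (unt Y \<boxtimes> idn ?y) = lam ?y"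
     "mult X \<bullet> (unt X \<boxtimes> idn ?x) = lam ?x" "mult Y \<bullet> (idn ?y \<boxtimes> unt Y) = rho ?y"
    using X Y by (simp_all add: bialgebra_D algebra_D)
  have "mult ?P \<bullet> (tensor_inl D X Y \<boxtimes> tensor_inr D X Y)
     = (mult X \<boxtimes> mult Y) \<bullet> ms ?x ?y ?x ?y \<bullet> ((idn ?x \<boxtimes> unt Y) \<boxtimes> (unt X \<boxtimes> idn ?y))
         \<bullet> (rho' ?x \<boxtimes> lam' ?y)"
    by (simp add: interchange)
  also have "\<dots> = ((mult X \<bullet> (idn ?x \<boxtimes> unt X)) \<boxtimes> (mult Y \<bullet> (unt Y \<boxtimes> idn ?y))) \<bullet> ms ?x One One ?y
      \<bullet> (rho' ?x \<boxtimes> lam' ?y)"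
    by (simp add: cmp_cong_left[OF ms_natural] interchange_cmp)
  also have "\<dots> = (rho ?x \<boxtimes> lam ?y) \<bullet> (rho' ?x \<boxtimes> lam' ?y)"
    unfolding U by (simp only: cmp_cong_left[OF ms_middle_One])
  finally show "mult ?P \<bullet> (tensor_inl D X Y \<boxtimes> tensor_inr D X Y) = idn (?x \<boxdot> ?y)"
    by (simp add: interchange)
  \<comment> \<open>In this order the units end up in the outer places of the exchange, so by
    \<open>ms_outer_One\<close> the braiding survives.\<close>
  have "mult ?P \<bullet> (tensor_inr D X Y \<boxtimes> tensor_inl D X Y)
     = (mult X \<boxtimes> mult Y) \<bullet> ms ?x ?y ?x ?y \<bullet> ((unt X \<boxtimes> idn ?y) \<boxtimes> (idn ?x \<boxtimes> unt Y))
         \<bullet> (lam' ?y \<boxtimes> rho' ?x)"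
    by (simp add: interchange)
  also have "\<dots> = ((mult X \<bullet> (unt X \<boxtimes> idn ?x)) \<boxtimes> (mult Y \<bullet> (idn ?y \<boxtimes> unt Y))) \<bullet> ms One ?y ?x One
      \<bullet> (lam' ?y \<boxtimes> rho' ?x)"
    by (simp add: cmp_cong_left[OF ms_natural] interchange_cmp)
  also have "\<dots> = sg ?y ?x"
    unfolding U by (rule ms_outer_One)
  finally show "mult ?P \<bullet> (tensor_inr D X Y \<boxtimes> tensor_inl D X Y) = sg ?y ?x" .
qed

text \<open>Together the two formulas give (i), and the first one alone gives the uniqueness of
  p.\<close>

lemma cooperator_D:
  assumes X: "bialgebra D X" and Y: "bialgebra D Y" and A: "bialgebra D A"
    and p: "bialgebra_morphism D (tensor_bialgebra D X Y) A p"
  defines "x \<equiv> p \<bullet> tensor_inl D X Y" and "y \<equiv> p \<bullet> tensor_inr D X Y"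
  shows "p = mult A \<bullet> (x \<boxtimes> y)" "p = mult A \<bullet> sg (Car A) (Car A) \<bullet> (x \<boxtimes> y)"
proof -
  note [simp] = typing_bialgebra[OF X] typing_bialgebra[OF Y] typing_bialgebra[OF A]
  let ?x = "Car X" and ?y = "Car Y" and ?P = "tensor_bialgebra D X Y"
  have [simp]: "defd p" "src p = ?x \<boxdot> ?y" "tgt p = Car A" and E: "p \<bullet> mult ?P = mult A \<bullet> (p \<boxtimes> p)"
    using p by (simp_all add: bialgebra_morphism_D)
  note E' = cmp_cong_left[OF E]
  have "p = p \<bullet> mult ?P \<bullet> (tensor_inl D X Y \<boxtimes> tensor_inr D X Y)"
    by (simp only: mult_injections[OF X Y]) simp
  also have "\<dots> = mult A \<bullet> (x \<boxtimes> y)"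
    unfolding E' by (simp add: interchange x_def y_def)
  finally show "p = mult A \<bullet> (x \<boxtimes> y)" .
  have "p = p \<bullet> (mult ?P \<bullet> (tensor_inr D X Y \<boxtimes> tensor_inl D X Y)) \<bullet> sg ?x ?y"
    by (simp only: mult_injections[OF X Y]) simp
  also have "\<dots> = (p \<bullet> mult ?P \<bullet> (tensor_inr D X Y \<boxtimes> tensor_inl D X Y)) \<bullet> sg ?x ?y" by simp
  also have "\<dots> = mult A \<bullet> (y \<boxtimes> x) \<bullet> sg ?x ?y"
    unfolding E' by (simp add: interchange x_def y_def)
  also have "\<dots> = mult A \<bullet> sg (Car A) (Car A) \<bullet> (x \<boxtimes> y)"
    by (simp add: sg_natural x_def y_def)
  finally show "p = mult A \<bullet> sg (Car A) (Car A) \<bullet> (x \<boxtimes> y)" .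
qed

text \<open>Commutation is used for multiplicativity. The restrictions to X and Y follow from the
  unit laws, and comultiplicativity from the bialgebra axiom that m is a coalgebra morphism on A
  \<otimes> A, composed with x \<otimes> y.\<close>

lemma cooperator_exists_D:
  assumes X: "bialgebra D X" and Y: "bialgebra D Y" and A: "bialgebra D A"
    and x: "bialgebra_morphism D X A x" and y: "bialgebra_morphism D Y A y"
    and comm: "mult A \<bullet> sg (Car A) (Car A) \<bullet> (x \<boxtimes> y) = mult A \<bullet> (x \<boxtimes> y)"
  shows "bialgebra_morphism D (tensor_bialgebra D X Y) A (mult A \<bullet> (x \<boxtimes> y))"
    "(mult A \<bullet> (x \<boxtimes> y)) \<bullet> tensor_inl D X Y = x" "(mult A \<bullet> (x \<boxtimes> y)) \<bullet> tensor_inr D X Y = y"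
proof -
  note [simp] = typing_bialgebra[OF X] typing_bialgebra[OF Y] typing_bialgebra[OF A]
  let ?a = "Car A" and ?m = "mult A" and ?P = "tensor_bialgebra D X Y"
  have [simp]: "defd x" "src x = Car X" "tgt x = ?a" "defd y" "src y = Car Y" "tgt y = ?a"
    and E: "x \<bullet> mult X = ?m \<bullet> (x \<boxtimes> x)" "y \<bullet> mult Y = ?m \<bullet> (y \<boxtimes> y)" "x \<bullet> unt X = unt A" "y \<bullet> unt Y
        = unt A"
    using x y by (simp_all add: bialgebra_morphism_D)
  have U: "?m \<bullet> (idn ?a \<boxtimes> unt A) = rho ?a" "?m \<bullet> (unt A \<boxtimes> idn ?a) = lam ?a"
    and assoc: "?m \<bullet> (?m \<boxtimes> idn ?a) = ?m \<bullet> (idn ?a \<boxtimes> ?m) \<bullet> al ?a ?a ?a"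
    and hom: "comult A \<bullet> ?m = (?m \<boxtimes> ?m) \<bullet> ms ?a ?a ?a ?a \<bullet> (comult A \<boxtimes> comult A)"
      "counit A \<bullet> ?m = lam One \<bullet> (counit A \<boxtimes> counit A)"
    using A by (simp_all add: bialgebra_D algebra_D)
  have inl: "(?m \<bullet> (x \<boxtimes> y)) \<bullet> tensor_inl D X Y = (?m \<bullet> (idn ?a \<boxtimes> unt A)) \<bullet> (x \<boxtimes> idn One)
      \<bullet> rho' (Car X)"
    and inr: "(?m \<bullet> (x \<boxtimes> y)) \<bullet> tensor_inr D X Y = (?m \<bullet> (unt A \<boxtimes> idn ?a)) \<bullet> (idn One \<boxtimes> y)
        \<bullet> lam' (Car Y)"
    by (simp_all add: interchange_cmp E)
  show "(?m \<bullet> (x \<boxtimes> y)) \<bullet> tensor_inl D X Y = x"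
    unfolding inl U by (subst cmp_cong_left[OF rho_natural]) simp_all
  show "(?m \<bullet> (x \<boxtimes> y)) \<bullet> tensor_inr D X Y = y"
    unfolding inr U by (subst cmp_cong_left[OF lam_natural]) simp_all
  \<comment> \<open>The middle factors of (x \<otimes> y) \<otimes> (x \<otimes> y) are y and x in
    this order, so (i) is wanted for the reversed pair; conjugating by the braiding gives
    it.\<close>
  have comm': "?m \<bullet> sg ?a ?a \<bullet> (y \<boxtimes> x) = ?m \<bullet> (y \<boxtimes> x)"
  proof -
    have "?m \<bullet> sg ?a ?a \<bullet> (y \<boxtimes> x) = (?m \<bullet> (x \<boxtimes> y)) \<bullet> sg (Car Y) (Car X)"
      by (simp add: sg_natural)
    also have "\<dots> = ?m \<bullet> (sg ?a ?a \<bullet> (x \<boxtimes> y)) \<bullet> sg (Car Y) (Car X)"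
      unfolding comm[symmetric] by simp
    also have "\<dots> = ?m \<bullet> (y \<boxtimes> x)"
      by (simp add: sg_natural)
    finally show ?thesis .
  qed
  have assoc': "?m \<bullet> (idn ?a \<boxtimes> ?m) = ?m \<bullet> (?m \<boxtimes> idn ?a) \<bullet> al' ?a ?a ?a"
    using arg_cong[OF assoc, of "\<lambda>z. z \<bullet> al' ?a ?a ?a"] by simp
  have "?m \<bullet> (?m \<boxtimes> ?m) = (?m \<bullet> (?m \<boxtimes> idn ?a)) \<bullet> (idn (?a \<boxdot> ?a) \<boxtimes> ?m)"
    by (simp add: interchange)
  also have "\<dots> = ?m \<bullet> (idn ?a \<boxtimes> ?m) \<bullet> al ?a ?a ?a \<bullet> ((idn ?a \<boxtimes> idn ?a) \<boxtimes> ?m)"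
    unfolding assoc by simp
  also have "\<dots> = ?m \<bullet> (idn ?a \<boxtimes> (?m \<bullet> (idn ?a \<boxtimes> ?m))) \<bullet> al ?a ?a (?a \<boxdot> ?a)"
    by (subst al_natural) (simp_all add: interchange_cmp)
  \<comment> \<open>This bracketing multiplies the second and third factors first, where a braiding
    inserted by \<open>ms\<close> can be absorbed.\<close>
  finally have four: "?m \<bullet> (?m \<boxtimes> ?m) = ?m \<bullet> (idn ?a \<boxtimes> (?m \<bullet> (?m \<boxtimes> idn ?a) \<bullet> al' ?a ?a ?a))
      \<bullet> al ?a ?a (?a \<boxdot> ?a)"
    unfolding assoc' .
  have "(?m \<bullet> (?m \<boxtimes> ?m)) \<bullet> ms ?a ?a ?a ?a \<bullet> ((x \<boxtimes> y) \<boxtimes> (x \<boxtimes> y))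
     = ?m \<bullet> (idn ?a \<boxtimes> (?m \<bullet> ((?m \<bullet> sg ?a ?a) \<boxtimes> idn ?a) \<bullet> al' ?a ?a ?a)) \<bullet> al ?a ?a (?a \<boxdot> ?a)
         \<bullet> ((x \<boxtimes> y) \<boxtimes> (x \<boxtimes> y))"
    unfolding four by (simp add: ms_def sw_def interchange_cmp)
  also have "\<dots> = ?m \<bullet> (x \<boxtimes> (?m \<bullet> ((?m \<bullet> sg ?a ?a \<bullet> (y \<boxtimes> x)) \<boxtimes> y) \<bullet> al' (Car Y) (Car X) (Car Y)))
      \<bullet> al (Car X) (Car Y) (Car X \<boxdot> Car Y)"
    by (simp add: al_natural al'_natural interchange_cmp)
  also have "\<dots> = ?m \<bullet> (idn ?a \<boxtimes> (?m \<bullet> (?m \<boxtimes> idn ?a) \<bullet> al' ?a ?a ?a)) \<bullet> al ?a ?a (?a \<boxdot> ?a)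
      \<bullet> ((x \<boxtimes> y) \<boxtimes> (x \<boxtimes> y))"
    unfolding comm' by (simp add: al_natural al'_natural interchange_cmp)
  also have "\<dots> = (?m \<bullet> (?m \<boxtimes> ?m)) \<bullet> ((x \<boxtimes> y) \<boxtimes> (x \<boxtimes> y))"
    unfolding four by simp
  finally have swap: "(?m \<bullet> (?m \<boxtimes> ?m)) \<bullet> ms ?a ?a ?a ?a \<bullet> ((x \<boxtimes> y) \<boxtimes> (x \<boxtimes> y)) = (?m \<bullet> (?m \<boxtimes> ?m))
      \<bullet> ((x \<boxtimes> y) \<boxtimes> (x \<boxtimes> y))" .
  have "(?m \<bullet> (x \<boxtimes> y)) \<bullet> mult ?P = ?m \<bullet> (?m \<boxtimes> ?m) \<bullet> ((x \<boxtimes> x) \<boxtimes> (y \<boxtimes> y))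
      \<bullet> ms (Car X) (Car Y) (Car X) (Car Y)"
    by (simp add: interchange_cmp E)
  also have "\<dots> = (?m \<bullet> (?m \<boxtimes> ?m)) \<bullet> ms ?a ?a ?a ?a \<bullet> ((x \<boxtimes> y) \<boxtimes> (x \<boxtimes> y))"
    by (simp add: ms_natural)
  finally have mult: "(?m \<bullet> (x \<boxtimes> y)) \<bullet> mult ?P = ?m \<bullet> ((?m \<bullet> (x \<boxtimes> y)) \<boxtimes> (?m \<bullet> (x \<boxtimes> y)))"
    unfolding swap by (simp add: interchange)
  have "?m \<bullet> (unt A \<boxtimes> unt A) = unt A \<bullet> lam One"
    using morphism_unt[OF A] by (simp add: bialgebra_morphism_D)
  then have unt: "(?m \<bullet> (x \<boxtimes> y)) \<bullet> unt ?P = unt A"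
    by (simp add: interchange_cmp E cmp_cong_left)
  have xy: "comult (tensor_bialgebra D A A) \<bullet> (x \<boxtimes> y) = ((x \<boxtimes> y) \<boxtimes> (x \<boxtimes> y)) \<bullet> comult ?P"
     "counit (tensor_bialgebra D A A) \<bullet> (x \<boxtimes> y) = counit ?P"
    using morphism_ten[OF X A Y A x y] by (simp_all only: bialgebra_morphism_D)
  have "comult A \<bullet> ?m \<bullet> (x \<boxtimes> y) = (?m \<boxtimes> ?m) \<bullet> comult (tensor_bialgebra D A A) \<bullet> (x \<boxtimes> y)"
    by (simp add: cmp_cong_left[OF hom(1)])
  then have comult: "comult A \<bullet> ?m \<bullet> (x \<boxtimes> y) = ((?m \<bullet> (x \<boxtimes> y)) \<boxtimes> (?m \<bullet> (x \<boxtimes> y))) \<bullet> comult ?P"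
    unfolding xy by (simp add: interchange_cmp)
  have "counit A \<bullet> ?m \<bullet> (x \<boxtimes> y) = counit (tensor_bialgebra D A A) \<bullet> (x \<boxtimes> y)"
    by (simp add: cmp_cong_left[OF hom(2)])
  then have counit: "counit A \<bullet> ?m \<bullet> (x \<boxtimes> y) = counit ?P"
    unfolding xy .
  show "bialgebra_morphism D ?P A (?m \<bullet> (x \<boxtimes> y))"
    unfolding bialgebra_morphism_D using mult unt comult counit by simp
qed

end

section \<open>Cocommutative bialgebras\<close>

context category begin

text \<open>Zero arrows may factor through different zero objects; the arrow k between these is
  compatible with both factorizations by the uniqueness of arrows into and out of a zero
  object.\<close>

lemma zero_arrow_unique:
  assumes "a \<in> Ob C" "b \<in> Ob C" "is_zero_arrow C a b f" "is_zero_arrow C a b g"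
  shows "f = g"
proof -
  obtain z t i where z: "is_zero_object C z" "t \<in> Hom C a z" "i \<in> Hom C z b" "f = i \<cdot> t"
    using assms(3) by (auto simp: is_zero_arrow_def)
  obtain w s j where w: "is_zero_object C w" "s \<in> Hom C a w" "j \<in> Hom C w b" "g = j \<cdot> s"
    using assms(4) by (auto simp: is_zero_arrow_def)
  have Ob: "z \<in> Ob C" "w \<in> Ob C" using z w by (auto simp: is_zero_object_def)
  obtain k where k: "k \<in> Hom C z w" using z(1) Ob by (auto simp: is_zero_object_def)
  have "k \<cdot> t = s"
    using w(1,2) Comp_Hom[OF assms(1) Ob z(2) k] assms(1) unfolding is_zero_object_def by blast
  moreover have "j \<cdot> k = i"
    using z(1,3) Comp_Hom[OF Ob assms(2) k w(3)] assms(2) unfolding is_zero_object_def by blast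
  ultimately show ?thesis
    using Comp_assoc[OF assms(1) Ob assms(2) z(2) k w(3)] z(4) w(4) by simp
qed

text \<open>\<open>huq_commute\<close> allows any product and any pair of injections. The comparison
  arrow q between two products respects the projections, hence the injections, and a cooperator on
  one product is carried to the other by precomposition with q.\<close>

lemma huq_commute_iff:
  assumes Ob: "a \<in> Ob C" "b \<in> Ob C" "c \<in> Ob C"
    and P: "is_product C a b P \<pi>\<^sub>1 \<pi>\<^sub>2"
    and i: "i\<^sub>1 \<in> Hom C a P" "\<pi>\<^sub>1 \<cdot> i\<^sub>1 = Id C a" "is_zero_arrow C a b (\<pi>\<^sub>2 \<cdot> i\<^sub>1)"
      "i\<^sub>2 \<in> Hom C b P" "is_zero_arrow C b a (\<pi>\<^sub>1 \<cdot> i\<^sub>2)" "\<pi>\<^sub>2 \<cdot> i\<^sub>2 = Id C b"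
  shows "huq_commute C a b c x y \<longleftrightarrow> (\<exists>p \<in> Hom C P c. p \<cdot> i\<^sub>1 = x \<and> p \<cdot> i\<^sub>2 = y)"
proof
  assume "huq_commute C a b c x y"
  then obtain Q \<rho>\<^sub>1 \<rho>\<^sub>2 j\<^sub>1 j\<^sub>2 p where Q: "is_product C a b Q \<rho>\<^sub>1 \<rho>\<^sub>2"
    and j: "j\<^sub>1 \<in> Hom C a Q" "\<rho>\<^sub>1 \<cdot> j\<^sub>1 = Id C a" "is_zero_arrow C a b (\<rho>\<^sub>2 \<cdot> j\<^sub>1)"
      "j\<^sub>2 \<in> Hom C b Q" "is_zero_arrow C b a (\<rho>\<^sub>1 \<cdot> j\<^sub>2)" "\<rho>\<^sub>2 \<cdot> j\<^sub>2 = Id C b"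
    and p: "p \<in> Hom C Q c" "p \<cdot> j\<^sub>1 = x" "p \<cdot> j\<^sub>2 = y"
    unfolding huq_commute_def by blast
  have PO: "P \<in> Ob C" "\<pi>\<^sub>1 \<in> Hom C P a" "\<pi>\<^sub>2 \<in> Hom C P b"
    using P by (auto simp: is_product_def)
  have QO: "Q \<in> Ob C" "\<rho>\<^sub>1 \<in> Hom C Q a" "\<rho>\<^sub>2 \<in> Hom C Q b"
    using Q by (auto simp: is_product_def)
  obtain q where q: "q \<in> Hom C P Q" "\<rho>\<^sub>1 \<cdot> q = \<pi>\<^sub>1" "\<rho>\<^sub>2 \<cdot> q = \<pi>\<^sub>2"
    using Q PO unfolding is_product_def by blast
  \<comment> \<open>The projections of \<open>Q\<close> are jointly monic.\<close>
  have Q_unique: "f = g" if "d \<in> Ob C" "f \<in> Hom C d Q" "g \<in> Hom C d Q" "\<rho>\<^sub>1 \<cdot> f = \<rho>\<^sub>1 \<cdot> g" "\<rho>\<^sub>2 \<cdot> f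
      = \<rho>\<^sub>2 \<cdot> g" for d f g
  proof -
    have "\<rho>\<^sub>1 \<cdot> f \<in> Hom C d a" "\<rho>\<^sub>2 \<cdot> f \<in> Hom C d b"
      using Comp_Hom[OF that(1) QO(1) Ob(1) that(2) QO(2)] Comp_Hom[OF that(1) QO(1) Ob(2) that(2) QO(3)] .
    then show ?thesis using Q that unfolding is_product_def by metis
  qed
  have \<rho>q: "\<rho>\<^sub>1 \<cdot> q \<cdot> f = \<pi>\<^sub>1 \<cdot> f" "\<rho>\<^sub>2 \<cdot> q \<cdot> f = \<pi>\<^sub>2 \<cdot> f" if "d \<in> Ob C" "f \<in> Hom C d P" for d f
    using Comp_assoc[OF that(1) PO(1) QO(1) Ob(1) that(2) q(1) QO(2)]
      Comp_assoc[OF that(1) PO(1) QO(1) Ob(2) that(2) q(1) QO(3)] q by simp_all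
  have z: "\<pi>\<^sub>2 \<cdot> i\<^sub>1 = \<rho>\<^sub>2 \<cdot> j\<^sub>1" "\<pi>\<^sub>1 \<cdot> i\<^sub>2 = \<rho>\<^sub>1 \<cdot> j\<^sub>2"
    using zero_arrow_unique Ob i j by blast+
  have "q \<cdot> i\<^sub>1 = j\<^sub>1"
    by (rule Q_unique[OF Ob(1) Comp_Hom[OF Ob(1) PO(1) QO(1) i(1) q(1)] j(1)])
      (use \<rho>q[OF Ob(1) i(1)] i j z in simp_all)
  moreover have "q \<cdot> i\<^sub>2 = j\<^sub>2"
    by (rule Q_unique[OF Ob(2) Comp_Hom[OF Ob(2) PO(1) QO(1) i(4) q(1)] j(4)])
      (use \<rho>q[OF Ob(2) i(4)] i j z in simp_all)
  ultimately have "(p \<cdot> q) \<cdot> i\<^sub>1 = x" "(p \<cdot> q) \<cdot> i\<^sub>2 = y"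
    using Comp_assoc[OF Ob(1) PO(1) QO(1) Ob(3) i(1) q(1) p(1)]
      Comp_assoc[OF Ob(2) PO(1) QO(1) Ob(3) i(4) q(1) p(1)] p by simp_all
  then show "\<exists>p \<in> Hom C P c. p \<cdot> i\<^sub>1 = x \<and> p \<cdot> i\<^sub>2 = y"
    using Comp_Hom[OF PO(1) QO(1) Ob(3) q(1) p(1)] by blast
next
  assume "\<exists>p \<in> Hom C P c. p \<cdot> i\<^sub>1 = x \<and> p \<cdot> i\<^sub>2 = y"
  then show "huq_commute C a b c x y"
    unfolding huq_commute_def using P i by blast
qed

end

section \<open>Transfer between formal bialgebras and bialgebras in \<open>C\<close>\<close>

context labelled begin

lemma arr_cmp [simp]: "defd y \<Longrightarrow> defd x \<Longrightarrow> src y = tgt x \<Longrightarrow> arr (y \<bullet> x) = arr y \<cdot> arr x"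
  and arr_ten [simp]: "defd y \<Longrightarrow> defd x \<Longrightarrow> arr (y \<boxtimes> x) = arr y \<otimes> arr x"
  by (simp_all add: cmp_def ten_def arr_def)

lemma arr_structure [simp]:
  "arr (idn a) = Id C (ev a)"
  "arr (al a b c) = Assoc C (ev a) (ev b) (ev c)"
  "arr (al' a b c) = assoc_inv C (ev a) (ev b) (ev c)"
  "arr (lam a) = LUnit C (ev a)"
  "arr (lam' a) = lunit_inv C (ev a)"
  "arr (rho a) = RUnit C (ev a)"
  "arr (rho' a) = runit_inv C (ev a)"
  "arr (sg a b) = Braid C (ev a) (ev b)"
  using lifts_structure[THEN liftsD(4)] by blast+

lemma arr_ms [simp]: "arr (ms a b c d) = middle_swap C (ev a) (ev b) (ev c) (ev d)"
  by (simp add: ms_def sw_def middle_swap_def)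

lemma tarr_eq_iff:
  "defd x \<Longrightarrow> defd y \<Longrightarrow> src x = src y \<Longrightarrow> tgt x = tgt y \<Longrightarrow> x = y \<longleftrightarrow> arr x = arr y"
  by (metis defd_lifts lifts_eq_iff)

lemma arr_Hom: "defd x \<Longrightarrow> src x = s \<Longrightarrow> tgt x = t \<Longrightarrow> arr x \<in> Hom C (ev s) (ev t)"
  using defd_lifts liftsD(5) by blast

text \<open>Equality of formal arrows reduces to equality in \<open>C\<close> only when sources and
  targets agree. This predicate supplies that for the structure maps before any bialgebra law is
  known.\<close>

definition typed :: "(tree, 'm tarr) bialg \<Rightarrow> bool" where
  "typed A \<longleftrightarrow> defd (mult A) \<and> src (mult A) = Car A \<boxdot> Car A \<and> tgt (mult A) = Car A \<and>
    defd (unt A) \<and> src (unt A) = One \<and> tgt (unt A) = Car A \<and>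
    defd (comult A) \<and> src (comult A) = Car A \<and> tgt (comult A) = Car A \<boxdot> Car A \<and>
    defd (counit A) \<and> src (counit A) = Car A \<and> tgt (counit A) = One"

lemma typed_bialgebra: "bialgebra D A \<Longrightarrow> typed A"
  by (simp add: typed_def typing_bialgebra)

definition lower :: "(tree, 'm tarr) bialg \<Rightarrow> ('o, 'm) bialg" where
  "lower A = \<lparr>Car = ev (Car A), mult = arr (mult A), unt = arr (unt A), comult = arr (comult A),
     counit = arr (counit A)\<rparr>"

lemma lower_simps [simp]: "Car (lower A) = ev (Car A)" "mult (lower A) = arr (mult A)"
    "unt (lower A) = arr (unt A)" "comult (lower A) = arr (comult A)" "counit (lower A)
        = arr (counit A)"
  by (simp_all add: lower_def)

lemma bialgebra_lower_iff:
  assumes "typed A"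
  shows "bialgebra C (lower A) \<longleftrightarrow> bialgebra D A"
proof -
  have [simp]: "defd (mult A)" "src (mult A) = Car A \<boxdot> Car A" "tgt (mult A) = Car A"
    "defd (unt A)" "src (unt A) = One" "tgt (unt A) = Car A"
    "defd (comult A)" "src (comult A) = Car A" "tgt (comult A) = Car A \<boxdot> Car A"
    "defd (counit A)" "src (counit A) = Car A" "tgt (counit A) = One"
    using assms by (simp_all add: typed_def)
  have [simp]: "arr (mult A) \<in> Hom C (ev (Car A) \<odot> ev (Car A)) (ev (Car A))"
      "arr (unt A) \<in> Hom C \<I> (ev (Car A))"
      "arr (comult A) \<in> Hom C (ev (Car A)) (ev (Car A) \<odot> ev (Car A))"
      "arr (counit A) \<in> Hom C (ev (Car A)) \<I>"
    using arr_Hom[of "mult A" "Car A \<boxdot> Car A" "Car A"] arr_Hom[of "unt A" One "Car A"]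
      arr_Hom[of "comult A" "Car A" "Car A \<boxdot> Car A"] arr_Hom[of "counit A" "Car A" One] by simp_all
  let ?m = "mult A" and ?d = "comult A" and ?ms = "ms (Car A) (Car A) (Car A) (Car A)"
  \<comment> \<open>\<open>tensor_mult\<close> brackets to the left, whereas formal composites are
    normalized to the right. Associativity in \<open>C\<close> has typing premises, so the
    rebracketing is imported from the unconditional \<open>cmp_assoc\<close>.\<close>
  have "arr (((?m \<boxtimes> ?m) \<bullet> ?ms) \<bullet> (?d \<boxtimes> ?d)) = arr ((?m \<boxtimes> ?m) \<bullet> ?ms \<bullet> (?d \<boxtimes> ?d))" by simp
  then have assoc: "((arr ?m \<otimes> arr ?m) \<cdot> arr ?ms) \<cdot> (arr ?d \<otimes> arr ?d)
      = (arr ?m \<otimes> arr ?m) \<cdot> arr ?ms \<cdot> (arr ?d \<otimes> arr ?d)"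
    by (simp del: cmp_assoc arr_ms)
  show ?thesis
    by (simp add: bialgebra_D algebra_D coalgebra_D tarr_eq_iff bialgebra_def algebra_def coalgebra_def
      algebra_morphism_def tensor_mult_def tensor_unit_def assoc[simplified])
qed

lemma cocommutative_lower_iff: "typed A \<Longrightarrow> cocommutative C (lower A) \<longleftrightarrow> cocommutative D A"
  by (simp add: typed_def cocommutative_def tarr_eq_iff)

lemma morphism_lower_iff:
  assumes "typed A" "typed B" "defd f" "src f = Car A" "tgt f = Car B"
  shows "bialgebra_morphism C (lower A) (lower B) (arr f) \<longleftrightarrow> bialgebra_morphism D A B f"
  using assms arr_Hom[of f "Car A" "Car B"]
  by (simp add: typed_def bialgebra_morphism_D bialgebra_morphism_def algebra_morphism_def
    coalgebra_morphism_def tarr_eq_iff)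

lemma lower_tensor:
  "typed A \<Longrightarrow> typed B \<Longrightarrow> lower (tensor_bialgebra D A B) = tensor_bialgebra C (lower A) (lower B)"
  by (simp add: typed_def lower_def tensor_bialgebra_def tensor_mult_def tensor_unit_def
    tensor_comult_def tensor_counit_def)

text \<open>Tagging the structure maps with a tree that evaluates to the carrier turns a bialgebra
  in \<open>C\<close> into a formal one; the laws are transferred by
  \<open>bialgebra_lower_iff\<close>.\<close>

lemma obtain_bialgebra:
  assumes "bialgebra C A" "ev t = Car A"
  obtains A' where "bialgebra D A'" "lower A' = A" "Car A' = t"
proof
  let ?A = "\<lparr>Car = t, mult = tag (t \<boxdot> t) t (mult A), unt = tag One t (unt A),
    comult = tag t (t \<boxdot> t) (comult A), counit = tag t One (counit A)\<rparr>"
  have "lifts (t \<boxdot> t) t (mult A) (mult ?A)" "lifts One t (unt A) (unt ?A)"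
    "lifts t (t \<boxdot> t) (comult A) (comult ?A)" "lifts t One (counit A) (counit ?A)"
    using assms by (auto intro!: lifts_tag simp: bialgebra_def algebra_def coalgebra_def)
  note L = this[THEN liftsD(1)] this[THEN liftsD(2)] this[THEN liftsD(3)] this[THEN liftsD(4)]
  have "typed ?A" using L by (simp add: typed_def)
  moreover show "lower ?A = A"
    using L assms(2) by (cases A) (simp add: lower_def)
  ultimately show "bialgebra D ?A"
    using assms(1) bialgebra_lower_iff[of ?A] by simp
  show "Car ?A = t" by simp
qed

lemma obtain_morphism:
  assumes "bialgebra_morphism C (lower A) (lower B) f" "bialgebra D A" "bialgebra D B"
  obtains f' where "bialgebra_morphism D A B f'" "arr f' = f"
proof
  have "f \<in> Hom C (ev (Car A)) (ev (Car B))"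
    using assms by (simp add: bialgebra_morphism_def algebra_morphism_def)
  note L = lifts_tag[OF this, THEN liftsD(1)] lifts_tag[OF this, THEN liftsD(2)]
    lifts_tag[OF this, THEN liftsD(3)] lifts_tag[OF this, THEN liftsD(4)]
  then show "arr (tag (Car A) (Car B) f) = f" by simp
  show "bialgebra_morphism D A B (tag (Car A) (Car B) f)"
    using L assms morphism_lower_iff[of A B "tag (Car A) (Car B) f"] typed_bialgebra by simp
qed

lemma morphism_lower:
  "bialgebra D A \<Longrightarrow> bialgebra D B \<Longrightarrow> bialgebra_morphism D A B f \<Longrightarrow>
    bialgebra_morphism C (lower A) (lower B) (arr f)"
  using morphism_lower_iff[of A B f] typed_bialgebra by (simp add: bialgebra_morphism_D)

lemma lowerD:
  assumes "lower A = B"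
  shows "ev (Car A) = Car B" "arr (mult A) = mult B" "arr (unt A) = unt B"
    "arr (comult A) = comult B" "arr (counit A) = counit B"
  using assms by auto

end

section \<open>The pointed category of cocommutative bialgebras and its products\<close>

context symmetric_monoidal_category begin

definition unit_bialgebra :: "('o, 'm) bialg" where
  "unit_bialgebra = \<lparr>Car = \<I>, mult = LUnit C \<I>, unt = Id C \<I>, comult = lunit_inv C \<I>, counit
      = Id C \<I>\<rparr>"

definition "proj1 X Y = RUnit C (Car X) \<cdot> (Id C (Car X) \<otimes> counit Y)"
definition "proj2 X Y = LUnit C (Car Y) \<cdot> (counit X \<otimes> Id C (Car Y))"

text \<open>The transfers below label leaves by the carriers of at most three bialgebras, lift the
  data to formal arrows, apply the formal result and return by \<open>arr\<close>. The last carrier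
  fills all remaining leaves.\<close>

lemma labelled_three:
  assumes "bialgebra C X" "bialgebra C Y" "bialgebra C Z"
  shows "labelled C (\<lambda>i. if i = 0 then Car X else if i = 1 then Car Y else Car Z)"
  by unfold_locales (use assms in \<open>simp add: bialgebra_def algebra_def\<close>)

lemma BiAlg_coc_simps [simp]:
  "A \<in> Ob (BiAlg_coc C) \<longleftrightarrow> bialgebra C A \<and> cocommutative C A"
  "f \<in> Hom (BiAlg_coc C) A B \<longleftrightarrow> bialgebra_morphism C A B f"
  "Id (BiAlg_coc C) A = Id C (Car A)" "Comp (BiAlg_coc C) = Comp C"
  by (simp_all add: BiAlg_coc_def)

lemma category_BiAlg_coc: "category (BiAlg_coc C)"
proof -
  have Ob: "Car A \<in> Ob C" if "bialgebra C A" for A using that by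
      (simp add: bialgebra_def algebra_def)
  have Hom: "f \<in> Hom C (Car A) (Car B)" if "bialgebra_morphism C A B f" for A B f
    using that by (simp add: bialgebra_morphism_def algebra_morphism_def)
  have cmp: "bialgebra_morphism C X Z (g \<cdot> f)"
    if *: "bialgebra C X" "bialgebra C Y" "bialgebra C Z" and f: "bialgebra_morphism C X Y f"
      and g: "bialgebra_morphism C Y Z g" for X Y Z f g
  proof -
    interpret L: labelled C "\<lambda>i. if i = 0 then Car X else if i = 1 then Car Y else Car Z"
      by (rule labelled_three[OF *])
    obtain X' where X': "bialgebra L.D X'" "L.lower X' = X"
      by (rule L.obtain_bialgebra[OF *(1), of "Leaf 0"]) auto
    obtain Y' where Y': "bialgebra L.D Y'" "L.lower Y' = Y"
      by (rule L.obtain_bialgebra[OF *(2), of "Leaf 1"]) auto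
    obtain Z' where Z': "bialgebra L.D Z'" "L.lower Z' = Z"
      by (rule L.obtain_bialgebra[OF *(3), of "Leaf 2"]) auto
    obtain f' where f': "bialgebra_morphism L.D X' Y' f'" "arr f' = f"
      by (rule L.obtain_morphism[of X' Y' f, unfolded X'(2) Y'(2), OF f X'(1) Y'(1)])
    obtain g' where g': "bialgebra_morphism L.D Y' Z' g'" "arr g' = g"
      by (rule L.obtain_morphism[of Y' Z' g, unfolded Y'(2) Z'(2), OF g Y'(1) Z'(1)])
    have "arr (L.cmp g' f') = g \<cdot> f"
      using f' g' by (auto simp: L.bialgebra_morphism_D)
    then show ?thesis
      using L.morphism_lower[OF X'(1) Z'(1) L.morphism_cmp[OF f'(1) g'(1)]] X' Z' by simp
  qed
  have idn: "bialgebra_morphism C X X (Id C (Car X))" if *: "bialgebra C X" for X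
  proof -
    interpret L: labelled C "\<lambda>i. if i = 0 then Car X else if i = 1 then Car X else Car X"
      by (rule labelled_three[OF * * *])
    obtain X' where X': "bialgebra L.D X'" "L.lower X' = X"
      by (rule L.obtain_bialgebra[OF *, of "Leaf 0"]) auto
    show ?thesis
      using L.morphism_lower[OF X'(1) X'(1) L.morphism_idn[OF X'(1)]] L.lowerD[OF X'(2)] X' by simp
  qed
  show ?thesis
  proof
    fix X Y f assume "X \<in> Ob (BiAlg_coc C)" "Y \<in> Ob (BiAlg_coc C)" "f \<in> Hom (BiAlg_coc C) X Y"
    then have *: "Car X \<in> Ob C" "Car Y \<in> Ob C" "f \<in> Hom C (Car X) (Car Y)"
      by (simp_all add: Ob Hom)
    from * show "f \<cdot>\<^bsub>BiAlg_coc C\<^esub> Id (BiAlg_coc C) X = f" by (simp add: Comp_Id_right)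
    from * show "Id (BiAlg_coc C) Y \<cdot>\<^bsub>BiAlg_coc C\<^esub> f = f" by (simp add: Comp_Id_left)
  next
    fix X Y Z f g
    assume "X \<in> Ob (BiAlg_coc C)" "Y \<in> Ob (BiAlg_coc C)" "Z \<in> Ob (BiAlg_coc C)"
      "f \<in> Hom (BiAlg_coc C) X Y" "g \<in> Hom (BiAlg_coc C) Y Z"
    then show "g \<cdot>\<^bsub>BiAlg_coc C\<^esub> f \<in> Hom (BiAlg_coc C) X Z"
      using cmp[of X Y Z f g] by simp
  next
    fix W X Y Z f g h
    assume *: "W \<in> Ob (BiAlg_coc C)" "X \<in> Ob (BiAlg_coc C)" "Y \<in> Ob (BiAlg_coc C)"
        "Z \<in> Ob (BiAlg_coc C)"
      "f \<in> Hom (BiAlg_coc C) W X" "g \<in> Hom (BiAlg_coc C) X Y" "h \<in> Hom (BiAlg_coc C) Y Z"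
    show "(h \<cdot>\<^bsub>BiAlg_coc C\<^esub> g) \<cdot>\<^bsub>BiAlg_coc C\<^esub> f = h \<cdot>\<^bsub>BiAlg_coc C\<^esub> g \<cdot>\<^bsub>BiAlg_coc C\<^esub> f"
      using Comp_assoc[of "Car W" "Car X" "Car Y" "Car Z" f g h] * by (simp add: Ob Hom)
  qed (simp add: idn)
qed

lemma unit_bialgebra:
  shows "bialgebra C unit_bialgebra" "cocommutative C unit_bialgebra"
    and "bialgebra C X \<Longrightarrow> bialgebra_morphism C X unit_bialgebra (counit X)"
    and "bialgebra C X \<Longrightarrow> bialgebra_morphism C unit_bialgebra X (unt X)"
proof -
  interpret L: labelled C "\<lambda>_. \<I>" by unfold_locales (rule Unit_Ob)
  have U: "L.lower L.unit_bialg = unit_bialgebra"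
    by (simp add: L.lower_def L.unit_bialg_def unit_bialgebra_def)
  show "bialgebra C unit_bialgebra" "cocommutative C unit_bialgebra"
    using L.bialgebra_lower_iff[OF L.typed_bialgebra[OF L.bialgebra_unit]] L.bialgebra_unit
       L.cocommutative_lower_iff[OF L.typed_bialgebra[OF L.bialgebra_unit]] L.cocommutative_unit U
    by simp_all
next
  assume X: "bialgebra C X"
  interpret L: labelled C "\<lambda>i. if i = 0 then Car X else if i = 1 then Car X else Car X"
    by (rule labelled_three[OF X X X])
  obtain X' where X': "bialgebra L.D X'" "L.lower X' = X"
    by (rule L.obtain_bialgebra[OF X, of "Leaf 0"]) auto
  note [simp] = L.lowerD[OF X'(2)]
  have U: "L.lower L.unit_bialg = unit_bialgebra"
    by (simp add: L.lower_def L.unit_bialg_def unit_bialgebra_def)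
  show "bialgebra_morphism C X unit_bialgebra (counit X)"
      "bialgebra_morphism C unit_bialgebra X (unt X)"
    using L.morphism_lower[OF X'(1) L.bialgebra_unit L.morphism_counit[OF X'(1)]]
      L.morphism_lower[OF L.bialgebra_unit X'(1) L.morphism_unt[OF X'(1)]] U X' by simp_all
qed

lemma tensor_BiAlg_coc:
  assumes X: "bialgebra C X" "cocommutative C X" and Y: "bialgebra C Y" "cocommutative C Y"
  shows "bialgebra C (tensor_bialgebra C X Y)" "cocommutative C (tensor_bialgebra C X Y)"
    and "bialgebra_morphism C (tensor_bialgebra C X Y) X (proj1 X Y)"
    and "bialgebra_morphism C (tensor_bialgebra C X Y) Y (proj2 X Y)"
    and "bialgebra_morphism C X (tensor_bialgebra C X Y) (tensor_inl C X Y)"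
    and "bialgebra_morphism C Y (tensor_bialgebra C X Y) (tensor_inr C X Y)"
    and "proj1 X Y \<cdot> tensor_inl C X Y = Id C (Car X)"
    and "proj2 X Y \<cdot> tensor_inl C X Y = unt Y \<cdot> counit X"
    and "proj1 X Y \<cdot> tensor_inr C X Y = unt X \<cdot> counit Y"
    and "proj2 X Y \<cdot> tensor_inr C X Y = Id C (Car Y)"
proof -
  interpret L: labelled C "\<lambda>i. if i = 0 then Car X else if i = 1 then Car Y else Car Y"
    by (rule labelled_three[OF X(1) Y(1) Y(1)])
  obtain X' where X': "bialgebra L.D X'" "L.lower X' = X"
    by (rule L.obtain_bialgebra[OF X(1), of "Leaf 0"]) auto
  obtain Y' where Y': "bialgebra L.D Y'" "L.lower Y' = Y"
    by (rule L.obtain_bialgebra[OF Y(1), of "Leaf 1"]) auto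
  note [simp] = L.typing_bialgebra[OF X'(1)] L.typing_bialgebra[OF Y'(1)]
  note [simp] = L.lowerD[OF X'(2)] L.lowerD[OF Y'(2)]
  let ?P = "tensor_bialgebra L.D X' Y'"
  have P: "bialgebra L.D ?P" "L.lower ?P = tensor_bialgebra C X Y"
    using L.bialgebra_tensor[OF X'(1) Y'(1)]
      L.lower_tensor[OF L.typed_bialgebra[OF X'(1)] L.typed_bialgebra[OF Y'(1)]] X' Y' by simp_all
  have arr_eqs: "arr (L.pr1 X' Y') = proj1 X Y" "arr (L.pr2 X' Y') = proj2 X Y"
      "arr (tensor_inl L.D X' Y') = tensor_inl C X Y" "arr (tensor_inr L.D X' Y')
          = tensor_inr C X Y"
    by (simp_all add: L.pr1_def L.pr2_def proj1_def proj2_def tensor_inl_def tensor_inr_def)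
  have coc: "cocommutative L.D X'" "cocommutative L.D Y'"
    using X(2) Y(2) L.cocommutative_lower_iff[OF L.typed_bialgebra[OF X'(1)], unfolded X'(2)]
      L.cocommutative_lower_iff[OF L.typed_bialgebra[OF Y'(1)], unfolded Y'(2)] by blast+
  show "bialgebra C (tensor_bialgebra C X Y)"
    using P(1) L.bialgebra_lower_iff[OF L.typed_bialgebra[OF P(1)], unfolded P(2)] by blast
  show "cocommutative C (tensor_bialgebra C X Y)"
    using L.cocommutative_lower_iff[OF L.typed_bialgebra[OF P(1)], unfolded P(2)]
      L.cocommutative_tensor[OF X'(1) Y'(1) coc] by blast
  show "bialgebra_morphism C (tensor_bialgebra C X Y) X (proj1 X Y)"
    "bialgebra_morphism C (tensor_bialgebra C X Y) Y (proj2 X Y)"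
    using L.morphism_lower[OF P(1) X'(1) L.morphism_projections(1)[OF X'(1) Y'(1)]]
      L.morphism_lower[OF P(1) Y'(1) L.morphism_projections(2)[OF X'(1) Y'(1)]]
    by (simp_all only: P X' Y' arr_eqs)
  have inj: "bialgebra_morphism L.D X' ?P (tensor_inl L.D X' Y')" "bialgebra_morphism
      L.D Y' ?P (tensor_inr L.D X' Y')"
    by (rule L.morphism_injections[OF X'(1) Y'(1)])+
  show "bialgebra_morphism C X (tensor_bialgebra C X Y) (tensor_inl C X Y)"
    "bialgebra_morphism C Y (tensor_bialgebra C X Y) (tensor_inr C X Y)"
    using L.morphism_lower[OF X'(1) P(1) inj(1)] L.morphism_lower[OF Y'(1) P(1) inj(2)]
    by (simp_all only: P X' Y' arr_eqs)
  have [simp]: "L.defd (L.pr1 X' Y')" "src (L.pr1 X' Y') = Car X' \<boxdot> Car Y'"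
     "L.defd (L.pr2 X' Y')" "src (L.pr2 X' Y') = Car X' \<boxdot> Car Y'"
     by (simp_all add: L.pr1_def L.pr2_def)
  have inj_typing: "L.defd (tensor_inl L.D X' Y')" "tgt (tensor_inl L.D X' Y') = Car X' \<boxdot> Car Y'"
    "L.defd (tensor_inr L.D X' Y')" "tgt (tensor_inr L.D X' Y') = Car X' \<boxdot> Car Y'"
    by simp_all
  note PI = L.projection_injection[OF X'(1) Y'(1), THEN arg_cong[of _ _ arr]]
  show "proj1 X Y \<cdot> tensor_inl C X Y = Id C (Car X)"
    using PI(1) inj_typing by (simp add: arr_eqs del: L.tensor_injections_D)
  show "proj2 X Y \<cdot> tensor_inl C X Y = unt Y \<cdot> counit X"
    using PI(2) inj_typing by (simp add: arr_eqs del: L.tensor_injections_D)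
  show "proj1 X Y \<cdot> tensor_inr C X Y = unt X \<cdot> counit Y"
    using PI(3) inj_typing by (simp add: arr_eqs del: L.tensor_injections_D)
  show "proj2 X Y \<cdot> tensor_inr C X Y = Id C (Car Y)"
    using PI(4) inj_typing by (simp add: arr_eqs del: L.tensor_injections_D)
qed

lemma pairing_BiAlg_coc:
  assumes X: "bialgebra C X" and Y: "bialgebra C Y" and T: "bialgebra C T" "cocommutative C T"
    and f: "bialgebra_morphism C T X f" and g: "bialgebra_morphism C T Y g"
  shows "\<exists>!h. bialgebra_morphism C T (tensor_bialgebra C X Y) h \<and> proj1 X Y \<cdot> h = f \<and> proj2 X Y \<cdot> h
      = g"
proof -
  interpret L: labelled C "\<lambda>i. if i = 0 then Car X else if i = 1 then Car Y else Car T"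
    by (rule labelled_three[OF X Y T(1)])
  obtain X' where X': "bialgebra L.D X'" "L.lower X' = X"
    by (rule L.obtain_bialgebra[OF X, of "Leaf 0"]) auto
  obtain Y' where Y': "bialgebra L.D Y'" "L.lower Y' = Y"
    by (rule L.obtain_bialgebra[OF Y, of "Leaf 1"]) auto
  obtain T' where T': "bialgebra L.D T'" "L.lower T' = T"
    by (rule L.obtain_bialgebra[OF T(1), of "Leaf 2"]) auto
  note [simp] = L.typing_bialgebra[OF X'(1)] L.typing_bialgebra[OF Y'(1)]
      L.typing_bialgebra[OF T'(1)]
  note [simp] = L.lowerD[OF X'(2)] L.lowerD[OF Y'(2)] L.lowerD[OF T'(2)]
  let ?P = "tensor_bialgebra L.D X' Y'"
  have P: "bialgebra L.D ?P" "L.lower ?P = tensor_bialgebra C X Y"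
    using L.bialgebra_tensor[OF X'(1) Y'(1)]
      L.lower_tensor[OF L.typed_bialgebra[OF X'(1)] L.typed_bialgebra[OF Y'(1)]] X' Y' by simp_all
  have pr: "arr (L.pr1 X' Y') = proj1 X Y" "arr (L.pr2 X' Y') = proj2 X Y"
    by (simp_all add: L.pr1_def L.pr2_def proj1_def proj2_def)
  have coc: "cocommutative L.D T'"
    using T(2) L.cocommutative_lower_iff[OF L.typed_bialgebra[OF T'(1)], unfolded T'(2)] by blast
  have [simp]: "L.defd (L.pr1 X' Y')" "src (L.pr1 X' Y') = Car X' \<boxdot> Car Y'" "tgt (L.pr1 X' Y')
      = Car X'"
     "L.defd (L.pr2 X' Y')" "src (L.pr2 X' Y') = Car X' \<boxdot> Car Y'" "tgt (L.pr2 X' Y') = Car Y'"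
     by (simp_all add: L.pr1_def L.pr2_def)
  obtain f' where f': "bialgebra_morphism L.D T' X' f'" "arr f' = f"
    by (rule L.obtain_morphism[of T' X' f, unfolded T'(2) X'(2), OF f T'(1) X'(1)])
  obtain g' where g': "bialgebra_morphism L.D T' Y' g'" "arr g' = g"
    by (rule L.obtain_morphism[of T' Y' g, unfolded T'(2) Y'(2), OF g T'(1) Y'(1)])
  have [simp]: "L.defd f'" "src f' = Car T'" "tgt f' = Car X'" "L.defd g'" "src g' = Car T'" "tgt g'
      = Car Y'"
    using f' g' by (simp_all add: L.bialgebra_morphism_D)
  note pair = L.pairing[OF T'(1) coc X'(1) Y'(1) f'(1) g'(1)]
  let ?h = "L.cmp (L.ten f' g') (comult T')"
  show ?thesis
  proof (rule ex1I[of _ "arr ?h"], intro conjI)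
    show "bialgebra_morphism C T (tensor_bialgebra C X Y) (arr ?h)"
      using L.morphism_lower[OF T'(1) P(1) pair(1)] by (simp only: T' P)
    show "proj1 X Y \<cdot> arr ?h = f" "proj2 X Y \<cdot> arr ?h = g"
      using pair(2,3)[THEN arg_cong[of _ _ arr]] by (simp_all add: f' g' pr)
    fix h
    assume h: "bialgebra_morphism C T (tensor_bialgebra C X Y) h \<and> proj1 X Y \<cdot> h = f \<and> proj2 X Y \<cdot> h
        = g"
    obtain h' where h': "bialgebra_morphism L.D T' ?P h'" "arr h' = h"
      by (rule L.obtain_morphism[of T' ?P h, unfolded T'(2) P(2), OF conjunct1[OF h] T'(1) P(1)])
    then have [simp]: "L.defd h'" "src h' = Car T'" "tgt h' = Car X' \<boxdot> Car Y'"
      by (simp_all add: L.bialgebra_morphism_D)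
    \<comment> \<open>Lifting turns the assumptions on h into equations of formal arrows, so that
      \<open>pairing_projections\<close> determines h'.\<close>
    have "L.cmp (L.pr1 X' Y') h' = f'" "L.cmp (L.pr2 X' Y') h' = g'"
      using h by (simp_all add: L.tarr_eq_iff pr f' g' h')
    then show "h = arr ?h"
      using L.pairing_projections[OF X'(1) Y'(1) h'(1)] h'(2) by simp
  qed
qed

text \<open>Stated for a fixed p, since the right-hand side determines p: existence and uniqueness
  of the cooperator follow from one equivalence.\<close>

lemma cooperator:
  assumes X: "bialgebra C X" and Y: "bialgebra C Y" and A: "bialgebra C A"
    and x: "bialgebra_morphism C X A x" and y: "bialgebra_morphism C Y A y"
  shows "bialgebra_morphism C (tensor_bialgebra C X Y) A p \<and> p \<cdot> tensor_inl C X Y = x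
      \<and> p \<cdot> tensor_inr C X Y = y
    \<longleftrightarrow> mult A \<cdot> Braid C (Car A) (Car A) \<cdot> (x \<otimes> y) = mult A \<cdot> (x \<otimes> y) \<and> p = mult A \<cdot> (x \<otimes> y)"
    (is "?coop \<longleftrightarrow> ?comm")
proof -
  interpret L: labelled C "\<lambda>i. if i = 0 then Car X else if i = 1 then Car Y else Car A"
    by (rule labelled_three[OF X Y A])
  obtain X' where X': "bialgebra L.D X'" "L.lower X' = X"
    by (rule L.obtain_bialgebra[OF X, of "Leaf 0"]) auto
  obtain Y' where Y': "bialgebra L.D Y'" "L.lower Y' = Y"
    by (rule L.obtain_bialgebra[OF Y, of "Leaf 1"]) auto
  obtain A' where A': "bialgebra L.D A'" "L.lower A' = A"
    by (rule L.obtain_bialgebra[OF A, of "Leaf 2"]) auto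
  note [simp] = L.typing_bialgebra[OF X'(1)] L.typing_bialgebra[OF Y'(1)]
      L.typing_bialgebra[OF A'(1)]
  note [simp] = L.lowerD[OF X'(2)] L.lowerD[OF Y'(2)] L.lowerD[OF A'(2)]
  let ?P = "tensor_bialgebra L.D X' Y'"
  have P: "bialgebra L.D ?P" "L.lower ?P = tensor_bialgebra C X Y"
    using L.bialgebra_tensor[OF X'(1) Y'(1)]
      L.lower_tensor[OF L.typed_bialgebra[OF X'(1)] L.typed_bialgebra[OF Y'(1)]] X' Y' by simp_all
  obtain x' where x': "bialgebra_morphism L.D X' A' x'" "arr x' = x"
    by (rule L.obtain_morphism[of X' A' x, unfolded X'(2) A'(2), OF x X'(1) A'(1)])
  obtain y' where y': "bialgebra_morphism L.D Y' A' y'" "arr y' = y"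
    by (rule L.obtain_morphism[of Y' A' y, unfolded Y'(2) A'(2), OF y Y'(1) A'(1)])
  have [simp]: "L.defd x'" "src x' = Car X'" "tgt x' = Car A'" "L.defd y'" "src y' = Car Y'" "tgt y'
      = Car A'"
    using x' y' by (simp_all add: L.bialgebra_morphism_D)
  have inj: "arr (tensor_inl L.D X' Y') = tensor_inl C X Y" "arr (tensor_inr L.D X' Y')
      = tensor_inr C X Y"
    by (simp_all add: tensor_inl_def tensor_inr_def)
  have inj_typing: "L.defd (tensor_inl L.D X' Y')" "tgt (tensor_inl L.D X' Y') = Car X' \<boxdot> Car Y'"
      "src (tensor_inl L.D X' Y') = Car X'"
    "L.defd (tensor_inr L.D X' Y')" "tgt (tensor_inr L.D X' Y') = Car X' \<boxdot> Car Y'" "src (tensor_inr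
        L.D X' Y') = Car Y'"
    by simp_all
  show ?thesis
  proof
    assume *: ?coop
    obtain p' where p': "bialgebra_morphism L.D ?P A' p'" "arr p' = p"
      by (rule L.obtain_morphism[of ?P A' p, unfolded A'(2) P(2), OF conjunct1[OF *] P(1) A'(1)])
    then have [simp]: "L.defd p'" "src p' = Car X' \<boxdot> Car Y'" "tgt p' = Car A'"
      by (simp_all add: L.bialgebra_morphism_D)
    have E: "L.cmp p' (tensor_inl L.D X' Y') = x'" "L.cmp p' (tensor_inr L.D X' Y') = y'"
      using * inj_typing by (simp_all add: L.tarr_eq_iff inj x' y' p' del: L.tensor_injections_D)
    note L.cooperator_D[OF X'(1) Y'(1) A'(1) p'(1), unfolded E]
    from this[THEN arg_cong[of _ _ arr]] show ?comm by (simp add: p' x' y')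
  next
    assume *: ?comm
    then have "L.cmp (mult A') (L.cmp (L.sg (Car A') (Car A')) (L.ten x' y')) =
        L.cmp (mult A') (L.ten x' y')"
      by (simp add: L.tarr_eq_iff x' y')
    note co = L.cooperator_exists_D[OF X'(1) Y'(1) A'(1) x'(1) y'(1) this]
    have p: "arr (L.cmp (mult A') (L.ten x' y')) = p"
      using * by (simp add: x' y')
    show ?coop
      using co(2,3)[THEN arg_cong[of _ _ arr]] L.morphism_lower[OF P(1) A'(1) co(1)] inj_typing *
      by (simp add: p P A' inj x' y' del: L.tensor_injections_D L.cmp_assoc)
  qed
qed

text \<open>The counit and the unit of the unit bialgebra are identities. Hence preserving counits
  forces a morphism into it to be \<open>counit A\<close>, and preserving units forces a morphism
  out of it to be \<open>unt A\<close>.\<close>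

lemma zero_object_BiAlg_coc: "is_zero_object (BiAlg_coc C) unit_bialgebra"
proof -
  have Ob: "Car A \<in> Ob C" if "bialgebra C A" for A
    using that by (simp add: bialgebra_def algebra_def)
  have 1: "f = counit A" if "bialgebra C A" "bialgebra_morphism C A unit_bialgebra f" for A f
  proof -
    have "f \<in> Hom C (Car A) \<I>" "Id C \<I> \<cdot> f = counit A"
      using that by (simp_all add: bialgebra_morphism_def coalgebra_morphism_def unit_bialgebra_def)
    then show ?thesis using Comp_Id_left[OF Ob Unit_Ob] that(1) by simp
  qed
  have 2: "f = unt A" if "bialgebra C A" "bialgebra_morphism C unit_bialgebra A f" for A f
  proof -
    have "f \<in> Hom C \<I> (Car A)" "f \<cdot> Id C \<I> = unt A"
      using that by (simp_all add: bialgebra_morphism_def algebra_morphism_def unit_bialgebra_def)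
    then show ?thesis using Comp_Id_right[OF Unit_Ob Ob] that(1) by simp
  qed
  have "\<exists>!f. f \<in> Hom (BiAlg_coc C) A unit_bialgebra" if "A \<in> Ob (BiAlg_coc C)" for A
    by (rule ex1I[of _ "counit A"]) (use that unit_bialgebra(3) 1 in simp_all)
  moreover have "\<exists>!f. f \<in> Hom (BiAlg_coc C) unit_bialgebra A" if "A \<in> Ob (BiAlg_coc C)" for A
    by (rule ex1I[of _ "unt A"]) (use that unit_bialgebra(4) 2 in simp_all)
  moreover have "unit_bialgebra \<in> Ob (BiAlg_coc C)"
    using unit_bialgebra by simp
  ultimately show ?thesis
    unfolding is_zero_object_def by blast
qed

lemma zero_arrow_BiAlg_coc:
  assumes "X \<in> Ob (BiAlg_coc C)" "Y \<in> Ob (BiAlg_coc C)"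
  shows "is_zero_arrow (BiAlg_coc C) X Y (unt Y \<cdot> counit X)"
proof -
  have "counit X \<in> Hom (BiAlg_coc C) X unit_bialgebra" "unt Y \<in> Hom (BiAlg_coc C) unit_bialgebra Y"
    using unit_bialgebra assms by simp_all
  then show ?thesis
    using zero_object_BiAlg_coc unfolding is_zero_arrow_def BiAlg_coc_simps(4) by blast
qed

lemma product_BiAlg_coc:
  assumes "X \<in> Ob (BiAlg_coc C)" "Y \<in> Ob (BiAlg_coc C)"
  shows "is_product (BiAlg_coc C) X Y (tensor_bialgebra C X Y) (proj1 X Y) (proj2 X Y)"
  using assms tensor_BiAlg_coc[of X Y] pairing_BiAlg_coc[of X Y] by (simp add: is_product_def)

lemma huq_commute_BiAlg_coc:
  assumes "X \<in> Ob (BiAlg_coc C)" "Y \<in> Ob (BiAlg_coc C)" "A \<in> Ob (BiAlg_coc C)"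
  shows "huq_commute (BiAlg_coc C) X Y A x y
      \<longleftrightarrow> (\<exists>p. bialgebra_morphism C (tensor_bialgebra C X Y) A p \<and>
     p \<cdot> tensor_inl C X Y = x \<and> p \<cdot> tensor_inr C X Y = y)"
proof -
  interpret B: category "BiAlg_coc C" by (rule category_BiAlg_coc)
  show ?thesis
    using B.huq_commute_iff[OF assms product_BiAlg_coc[OF assms(1,2)], of "tensor_inl C X Y"
        "tensor_inr C X Y" x y]
      tensor_BiAlg_coc[of X Y] zero_arrow_BiAlg_coc[of X Y] zero_arrow_BiAlg_coc[of Y X] assms
    by auto
qed

end

theorem proposition3p1:
  fixes C :: "('o, 'm, 'z) smc_scheme"
    and A X Y :: "('o, 'm) bialg"
    and x y :: 'm
  assumes "symmetric_monoidal_category C"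
    and "has_equalizers C"
    and "A \<in> Ob (BiAlg_coc C)"
    and "X \<in> Ob (BiAlg_coc C)"
    and "Y \<in> Ob (BiAlg_coc C)"
    and "monomorphism (BiAlg_coc C) X A x"
    and "monomorphism (BiAlg_coc C) Y A y"
  shows "((mult A \<cdot>\<^bsub>C\<^esub> Braid C (Car A) (Car A) \<cdot>\<^bsub>C\<^esub> (x \<otimes>\<^bsub>C\<^esub> y) = mult A \<cdot>\<^bsub>C\<^esub> (x \<otimes>\<^bsub>C\<^esub> y))
           \<longleftrightarrow> huq_commute (BiAlg_coc C) X Y A x y) \<and>
         (huq_commute (BiAlg_coc C) X Y A x y
           \<longleftrightarrow> (\<exists>p. bialgebra_morphism C (tensor_bialgebra C X Y) A p \<and>
               p \<cdot>\<^bsub>C\<^esub> tensor_inl C X Y = x \<and> p \<cdot>\<^bsub>C\<^esub> tensor_inr C X Y = y)) \<and>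
         ((\<exists>p. bialgebra_morphism C (tensor_bialgebra C X Y) A p \<and>
               p \<cdot>\<^bsub>C\<^esub> tensor_inl C X Y = x \<and> p \<cdot>\<^bsub>C\<^esub> tensor_inr C X Y = y)
           \<longrightarrow> (\<exists>!p. bialgebra_morphism C (tensor_bialgebra C X Y) A p \<and>
               p \<cdot>\<^bsub>C\<^esub> tensor_inl C X Y = x \<and> p \<cdot>\<^bsub>C\<^esub> tensor_inr C X Y = y))"
proof -
  interpret symmetric_monoidal_category C by fact
  have "bialgebra_morphism C X A x" "bialgebra_morphism C Y A y"
    using assms by (simp_all add: monomorphism_def)
  then show ?thesis
    \<comment> \<open>The Huq condition becomes the existence of p on the tensor product;
      \<open>cooperator\<close> says that under (i) exactly m \<cdot> (x \<otimes> y) qualifies, and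
      otherwise nothing does.\<close>
    using assms huq_commute_BiAlg_coc[of X Y A x y] cooperator[of X Y A x y] by simp
qed

end
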